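(* Let $X$ be a metrizable, locally compact, separable topological space and let $T\colon X\to X$ be continuous. Then $$\sup_{\mu} h_\mu(T) \;=\; h(T) \;=\; \min_{d} h^B_d(T),$$ where the supremum is over all $T$-invariant Radon probability measures $\mu$ on $X$ (taken to be $0$ if there is none) and the minimum is over all metrics $d$ on $X$ compatible with its topology. Moreover, the minimum is attained at every compatible metric $d$ on $X$ that is the restriction of a metric on the one point compactification $X\cup\{\infty\}$ of $X$.
   Context: Covers: for covers $\mathcal A,\mathcal B$ of $X$, $\mathcal A\vee\mathcal B=\{A\cap B: A\in\mathcal A,B\in\mathcal B, A\cap B\neq\emptyset\}$, $T^{-1}(\mathcal A)=\{T^{-1}(A):A\in\mathcal A\}$, and $\mathcal A^n=\mathcal A\vee T^{-1}(\mathcal A)\vee\dots\vee T^{-(n-1)}(\mathcal A)$. $N(\mathcal A)$ is the least cardinality of a subcover of $\mathcal A$; for $Y\subset X$, $N_Y(\mathcal A)$ is the least cardinality of a subfamily of $\mathcal A$ whose union contains $Y$. An open cover is admissible if at least one of its elements has compact complement. For a cover $\mathcal A$, $h(\mathcal A,T)=\lim_{n\to\infty}\frac1n\log N(\mathcal A^n)$, and the topological entropy is $h(T)=\sup\{h(\mathcal A,T): \mathcal A \text{ admissible open cover}\}$. Bowen entropy: for a metric $d$, $d_n(x,y)=\max_{0\le j<n} d(T^jx,T^jy)$, $\mathcal B_{d_n}(\varepsilon)$ is the family of all open $d_n$-balls of radius $\varepsilon$ centered at points of $X$, and $h^B_d(T)=\sup_{\varepsilon>0,\,K\subset X\text{ compact}}\limsup_{n\to\infty}\frac1n\log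 N_K(\mathcal B_{d_n}(\varepsilon))$. Kolmogorov–Sinai entropy: for a $T$-invariant finite Borel measure $\mu$ ($\mu(T^{-1}A)=\mu(A)$) and a finite measurable partition $\mathcal C$, $H_\mu(\mathcal C)=\sum_{C\in\mathcal C}\mu(C)\log\frac1{\mu(C)}$ (with $0\log\frac10=0$), $h_\mu(\mathcal C,T)=\lim_n\frac1n H_\mu(\mathcal C^n)$, and $h_\mu(T)=\sup_{\mathcal C} h_\mu(\mathcal C,T)$ over finite measurable partitions. *)

theory Defs
  imports "HOL-Analysis.Analysis" "HOL-Probability.Probability"
begin

definition cover_join :: "'a set set \<Rightarrow> 'a set set \<Rightarrow> 'a set set" where
  "cover_join A B = {a \<inter> b | a b. a \<in> A \<and> b \<in> B \<and> a \<inter> b \<noteq> {}}"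

definition cover_preimage :: "('a \<Rightarrow> 'a) \<Rightarrow> 'a set set \<Rightarrow> 'a set set" where
  "cover_preimage T A = (\<lambda>a. T -` a) ` A"

fun cover_iter :: "('a \<Rightarrow> 'a) \<Rightarrow> 'a set set \<Rightarrow> nat \<Rightarrow> 'a set set" where
  "cover_iter T A 0 = {UNIV}"
| "cover_iter T A (Suc 0) = A"
| "cover_iter T A (Suc (Suc n)) =
     cover_join (cover_iter T A (Suc n)) (cover_preimage (T ^^ Suc n) A)"

definition N_on :: "'a set \<Rightarrow> 'a set set \<Rightarrow> nat" where
  "N_on Y A = (LEAST n. \<exists>B. B \<subseteq> A \<and> finite B \<and> card B = n \<and> Y \<subseteq> \<Union>B)"

definition N_cover :: "'a set set \<Rightarrow> nat" where
  "N_cover A = N_on UNIV A"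

definition admissible_open_cover :: "'a::topological_space set set \<Rightarrow> bool" where
  "admissible_open_cover A \<longleftrightarrow>
     (\<forall>a\<in>A. open a) \<and> \<Union>A = UNIV \<and> (\<exists>a\<in>A. compact (UNIV - a))"

definition cover_entropy :: "('a \<Rightarrow> 'a) \<Rightarrow> 'a set set \<Rightarrow> real" where
  "cover_entropy T A = lim (\<lambda>n. ln (real (N_cover (cover_iter T A n))) / real n)"

definition top_entropy :: "('a::topological_space \<Rightarrow> 'a) \<Rightarrow> ereal" where
  "top_entropy T = (SUP A\<in>{A. admissible_open_cover A}. ereal (cover_entropy T A))"

definition compatible_metric :: "('a::topological_space \<Rightarrow> 'a \<Rightarrow> real) \<Rightarrow> bool" where
  "compatible_metric d \<longleftrightarrow> Metric_space UNIV d \<and> Metric_space.mtopology UNIV d = euclidean"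

definition bowen_dist :: "('a \<Rightarrow> 'a \<Rightarrow> real) \<Rightarrow> ('a \<Rightarrow> 'a) \<Rightarrow> nat \<Rightarrow> 'a \<Rightarrow> 'a \<Rightarrow> real" where
  "bowen_dist d T n x y = Max ((\<lambda>j. d ((T ^^ j) x) ((T ^^ j) y)) ` {..<n})"

definition bowen_balls :: "('a \<Rightarrow> 'a \<Rightarrow> real) \<Rightarrow> ('a \<Rightarrow> 'a) \<Rightarrow> nat \<Rightarrow> real \<Rightarrow> 'a set set" where
  "bowen_balls d T n \<epsilon> = {{y. bowen_dist d T n x y < \<epsilon>} | x. True}"

definition bowen_entropy :: "('a::topological_space \<Rightarrow> 'a \<Rightarrow> real) \<Rightarrow> ('a \<Rightarrow> 'a) \<Rightarrow> ereal" where
  "bowen_entropy d T =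
     (SUP p\<in>{(\<epsilon>, K). \<epsilon> > 0 \<and> compact K}.
        limsup (\<lambda>n. ereal (ln (real (N_on (snd p) (bowen_balls d T n (fst p)))) / real n)))"

definition finite_meas_partition :: "'a::topological_space set set \<Rightarrow> bool" where
  "finite_meas_partition C \<longleftrightarrow>
     finite C \<and> C \<subseteq> sets borel \<and> \<Union>C = UNIV \<and> disjoint C"

definition partition_entropy :: "'a measure \<Rightarrow> 'a set set \<Rightarrow> real" where
  "partition_entropy \<mu> C =
     (\<Sum>c\<in>C. if measure \<mu> c = 0 then 0 else measure \<mu> c * ln (1 / measure \<mu> c))"

definition ks_partition_entropy :: "'a measure \<Rightarrow> ('a \<Rightarrow> 'a) \<Rightarrow> 'a set set \<Rightarrow> real" where
  "ks_partition_entropy \<mu> T C = lim (\<lambda>n. partition_entropy \<mu> (cover_iter T C n) / real n)"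

definition ks_entropy :: "'a::topological_space measure \<Rightarrow> ('a \<Rightarrow> 'a) \<Rightarrow> ereal" where
  "ks_entropy \<mu> T = (SUP C\<in>{C. finite_meas_partition C}. ereal (ks_partition_entropy \<mu> T C))"

text \<open>Radon probability measure on the Borel sets: inner regular by compact sets
  and outer regular by open sets (locally finiteness is automatic for a probability).\<close>
definition radon_prob :: "'a::topological_space measure \<Rightarrow> bool" where
  "radon_prob \<mu> \<longleftrightarrow> prob_space \<mu> \<and> sets \<mu> = sets borel \<and>
     (\<forall>A\<in>sets borel.
        emeasure \<mu> A = (SUP K\<in>{K. compact K \<and> K \<subseteq> A}. emeasure \<mu> K) \<and>
        emeasure \<mu> A = (INF U\<in>{U. open U \<and> A \<subseteq> U}. emeasure \<mu> U))"

definition invariant_measure :: "('a \<Rightarrow> 'a) \<Rightarrow> 'a measure \<Rightarrow> bool" where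
  "invariant_measure T \<mu> \<longleftrightarrow> (\<forall>A\<in>sets \<mu>. T -` A \<in> sets \<mu> \<and> emeasure \<mu> (T -` A) = emeasure \<mu> A)"

text \<open>X \<union> {\<infinity>} is modelled as 'a option, with None the point at infinity.
  A set V is open in the one point compactification iff its trace on X is open
  and, if it contains \<infinity>, the complement of its trace is compact (closed is
  then automatic).\<close>
definition alexandroff_open :: "'a::topological_space option set \<Rightarrow> bool" where
  "alexandroff_open V \<longleftrightarrow> open (Some -` V) \<and> (None \<in> V \<longrightarrow> compact (UNIV - Some -` V))"

definition extends_to_compactification :: "('a::topological_space \<Rightarrow> 'a \<Rightarrow> real) \<Rightarrow> bool" where
  "extends_to_compactification d \<longleftrightarrow>
     (\<exists>D :: 'a option \<Rightarrow> 'a option \<Rightarrow> real.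
        Metric_space UNIV D \<and>
        (\<forall>V. openin (Metric_space.mtopology UNIV D) V \<longleftrightarrow> alexandroff_open V) \<and>
        (\<forall>x y. d x y = D (Some x) (Some y)))"

end

theory Submission
  imports Defs
begin

text \<open>
  The three quantities are compared cyclically. If \<open>d\<close> extends to a metric on the compactification,
  then \<open>X\<close> has admissible covers by \<open>d\<close>-small sets, whence \<open>h\<^sup>B\<^sub>d(T) \<le> h(T)\<close>.

  For an invariant Radon measure and any compatible \<open>d\<close>, a finite partition is approximated from inside by
  compact sets. A small \<open>d\<close>-ball meets at most one of them, so a Bowen ball of order \<open>n\<close> meets at most
  \<open>2\<^sup>n\<close> cells of the iterated partition; together with a compact set of almost full measure this gives
  \<open>h\<^sub>\<mu>(T) \<le> h\<^sup>B\<^sub>d(T) + const\<close>, and replacing \<open>T\<close> by its powers removes the constant.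

  For \<open>h(T) \<le> sup h\<^sub>\<mu>(T)\<close> Misiurewicz's argument is run with separated sets for a metric of the
  compactification. The orbit measures have a vague limit \<open>\<mu>\<close> on \<open>X\<close> of mass at most one. Although \<open>T\<close>
  need not extend to the compactification, \<open>\<mu>\<close> is invariant, because \<open>\<mu>(T\<^sup>-\<^sup>1 K) \<le> \<mu>(K)\<close> for compact \<open>K\<close>.
  Invariance also shows that the escaping mass sits on the single itinerary that stays forever near
  infinity; it contributes nothing to the entropy per unit time, so the normalization of \<open>\<mu>\<close> has
  entropy at least \<open>h(A, T)\<close>, and \<open>h(A, T) = 0\<close> if \<open>\<mu> = 0\<close>.
\<close>

section \<open>Shannon entropy of finite-valued random variables\<close>

text \<open>Partitions are handled as finite-valued labellings, and their iterated joins as words of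
  labels. Refinement becomes pairing of random variables, and subadditivity of Shannon entropy does
  the work usually done by conditional entropy.

  In the Bowen bound, words of \<open>T ^^ m\<close> are therefore counted by Bowen balls of
  \<open>T\<close> itself of order \<open>n * m\<close>, which avoids comparing the Bowen entropies
  of \<open>T\<close> and \<open>T ^^ m\<close>. In the vague limit two one-sided estimates survive:
  a lower one on open sets and an upper one on compact sets. Preimages of compact sets under
  \<open>T\<close> need not be compact, so upper bounds along orbits come from combining the almost
  invariance of the orbit measures with the exact invariance of the limit.

  Escaping mass alters the limiting entropy of words of length \<open>n\<close> by a quantity
  bounded independently of \<open>n\<close>. This is why it disappears after division by
  \<open>n\<close>.\<close>

definition shannon :: "'a measure \<Rightarrow> ('a \<Rightarrow> 'b) \<Rightarrow> real" where
  "shannon M X = - (\<Sum>l\<in>X ` space M. measure M (X -` {l} \<inter> space M) * ln (measure M (X -` {l} \<inter> space M)))"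

text \<open>Values outside the range have an empty fibre, so different variables or measures can be
  compared term by term over one index set.\<close>

lemma (in prob_space) shannon_superset:
  assumes "finite S" "X ` space M \<subseteq> S"
  shows "shannon M X = - (\<Sum>l\<in>S. prob (X -` {l} \<inter> space M) * ln (prob (X -` {l} \<inter> space M)))"
proof -
  have "X -` {l} \<inter> space M = {}" if "l \<in> S - X ` space M" for l
    using that by auto
  then show ?thesis
    unfolding shannon_def
    by (subst sum.mono_neutral_left[OF assms]) auto
qed

lemma (in prob_space) information_space_exp: "information_space M (exp 1)"
  by unfold_locales simp

lemma (in prob_space) entropy_eq_shannon:
  assumes "simple_function M X"
  shows "entropy (exp 1) (count_space (X ` space M)) X = shannon M X"
  using information_space.entropy_simple_distributed[OF information_space_exp
      simple_distributedI[OF assms measure_nonneg refl]]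
  by (simp add: shannon_def log_def)

lemma (in prob_space) shannon_nonneg: "0 \<le> shannon M X"
proof -
  have "p * ln p \<le> 0" if "0 \<le> p" "p \<le> 1" for p :: real
    using that by (cases "p = 0") (auto intro: mult_nonneg_nonpos)
  then have "(\<Sum>l\<in>X ` space M. prob (X -` {l} \<inter> space M) * ln (prob (X -` {l} \<inter> space M))) \<le> 0"
    by (intro sum_nonpos) simp
  then show ?thesis by (simp add: shannon_def)
qed

lemma (in prob_space) shannon_le_ln_card:
  assumes "simple_function M X"
  shows "shannon M X \<le> ln (card (X ` space M))"
  using information_space.entropy_le_card[OF information_space_exp
      simple_distributedI[OF assms measure_nonneg refl]] assms
  by (simp add: entropy_eq_shannon log_def)

lemma (in prob_space) shannon_comp_le:
  assumes "simple_function M X"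
  shows "shannon M (\<lambda>x. f (X x)) \<le> shannon M X"
  using information_space.entropy_data_processing[OF information_space_exp assms, of f]
    entropy_eq_shannon[OF assms] entropy_eq_shannon[OF simple_function_compose[OF assms, of f]]
  by (simp add: o_def)

lemma (in prob_space) shannon_comp_eq:
  assumes "simple_function M X" and "\<And>x. x \<in> space M \<Longrightarrow> Y x = f (X x)" and "\<And>x. x \<in> space M \<Longrightarrow> X x = g (Y x)"
  shows "shannon M Y = shannon M X"
proof -
  have "inj_on f (X ` space M)"
  proof (rule inj_on_inverseI)
    show "g (f l) = l" if "l \<in> X ` space M" for l
      using that assms(2,3) by force
  qed
  then have "shannon M (\<lambda>x. f (X x)) = shannon M X"
    using information_space.entropy_of_inj[OF information_space_exp assms(1), of f]
      entropy_eq_shannon[OF assms(1)] entropy_eq_shannon[OF simple_function_compose[OF assms(1), of f]]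
    by (simp add: o_def)
  moreover have "Y -` {l} \<inter> space M = (\<lambda>x. f (X x)) -` {l} \<inter> space M" for l
    using assms(2) by auto
  moreover have "Y ` space M = (\<lambda>x. f (X x)) ` space M"
    using assms(2) by auto
  ultimately show ?thesis unfolding shannon_def by simp
qed

lemma (in prob_space) shannon_const: "shannon M (\<lambda>x. c) = 0"
proof -
  have "(\<lambda>x. c) -` {c} \<inter> space M = space M" by auto
  moreover have "(\<lambda>x. c) ` space M = {c}" using not_empty by auto
  ultimately show ?thesis by (simp add: shannon_def prob_space)
qed

text \<open>Chain rule, then the fact that conditioning does not increase entropy. Conditional
  entropy enters only here.\<close>

lemma (in prob_space) shannon_pair_le:
  assumes X: "simple_function M X" and Y: "simple_function M Y"
  shows "shannon M (\<lambda>x. (X x, Y x)) \<le> shannon M X + shannon M Y"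
  using information_space.entropy_chain_rule[OF information_space_exp X Y]
    information_space.conditional_entropy_less_eq_entropy[OF information_space_exp Y X]
  by (simp add: entropy_eq_shannon[OF X] entropy_eq_shannon[OF Y] entropy_eq_shannon[OF simple_function_Pair[OF X Y]])

text \<open>Fekete's lemma. The limit is the infimum of \<open>a n / n\<close> over
  \<open>n >= 1\<close>: pick \<open>p\<close> nearly attaining it and split \<open>n\<close> into
  blocks of length \<open>p\<close> and a remainder of bounded cost.\<close>

lemma subadditive_limit:
  fixes a :: "nat \<Rightarrow> real"
  assumes sub: "\<And>m n. a (m + n) \<le> a m + a n" and nn: "\<And>n. 0 \<le> a n"
  obtains L where "(\<lambda>n. a n / real n) \<longlonglongrightarrow> L" and "\<And>n. n \<ge> 1 \<Longrightarrow> L \<le> a n / real n" and "0 \<le> L"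
proof -
  define L where "L = (INF n\<in>{1..}. a n / real n)"
  have bdd: "bdd_below ((\<lambda>n. a n / real n) ` {1..})"
    using nn by (intro bdd_belowI[of _ 0]) auto
  have L_le: "L \<le> a n / real n" if "n \<ge> 1" for n
    unfolding L_def using that bdd by (intro cINF_lower) auto
  have L_nn: "0 \<le> L"
    unfolding L_def by (intro cINF_greatest) (auto simp: nn)
  have mult: "a (q * p) \<le> real q * a p + a 0" for q p
  proof (induction q)
    case (Suc q)
    then show ?case using sub[of p "q * p"] by (simp add: algebra_simps)
  qed simp
  have "(\<lambda>n. a n / real n) \<longlonglongrightarrow> L"
  proof (rule LIMSEQ_I)
    fix e :: real assume e: "e > 0"
    have "\<exists>p\<ge>1. a p / real p < L + e / 2"
    proof (rule ccontr)
      assume "\<not> ?thesis"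
      then have "L + e / 2 \<le> L"
        by (subst (2) L_def) (intro cINF_greatest, auto simp: not_less)
      with e show False by simp
    qed
    then obtain p where p: "p \<ge> 1" "a p / real p < L + e / 2" by blast
    \<comment> \<open>\<open>a 0\<close> is only known to be nonnegative, and chaining blocks of
      length \<open>p\<close> starts from it.\<close>
    define B where "B = a 0 + (\<Sum>r<p. a r)"
    have B: "a 0 + a r \<le> B" if "r < p" for r
      unfolding B_def using that by (auto intro!: member_le_sum nn)
    have an: "a n \<le> real (n div p) * a p + B" for n
    proof -
      have "a n = a ((n div p) * p + n mod p)" by simp
      also have "\<dots> \<le> a ((n div p) * p) + a (n mod p)" by (rule sub)
      also have "\<dots> \<le> real (n div p) * a p + B"
        using mult[of "n div p" p] B[of "n mod p"] p by simp
      finally show ?thesis .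
    qed
    obtain N where N: "real N > 2 * B / e" using reals_Archimedean2 by blast
    show "\<exists>no. \<forall>n\<ge>no. norm (a n / real n - L) < e"
    proof (intro exI allI impI)
      fix n assume n: "n \<ge> max N 1"
      have "real (n div p) * a p \<le> real n * (a p / real p)"
      proof -
        have "real (n div p) \<le> real n / real p" by (simp add: of_nat_div_le_of_nat)
        then have "real (n div p) * a p \<le> real n / real p * a p" by (intro mult_right_mono nn)
        then show ?thesis by simp
      qed
      moreover have "B < real n * (e / 2)"
      proof -
        have "2 * B / e < real n" using N n by linarith
        then show ?thesis using e by (simp add: field_simps)
      qed
      ultimately have "a n < real n * (a p / real p) + real n * (e / 2)"
        using an[of n] by linarith
      also have "\<dots> = real n * (a p / real p + e / 2)" by (simp add: algebra_simps)
      also have "\<dots> \<le> real n * (L + e)"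
        using p by (intro mult_left_mono) auto
      finally have "a n / real n < L + e" using n by (simp add: divide_less_eq mult.commute)
      moreover have "L \<le> a n / real n" using n by (intro L_le) simp
      ultimately show "norm (a n / real n - L) < e" by simp
    qed
  qed
  with L_le L_nn that show thesis by blast
qed

text \<open>The fibres of this map are the cells of the iterated partition. With lists as values,
  adding times is concatenation and powers of \<open>T\<close> correspond to cutting into
  blocks.\<close>

definition itinerary :: "('a \<Rightarrow> 'b) \<Rightarrow> ('a \<Rightarrow> 'a) \<Rightarrow> nat \<Rightarrow> 'a \<Rightarrow> 'b list" where
  "itinerary f T n x = map (\<lambda>j. f ((T ^^ j) x)) [0..<n]"

section \<open>Itineraries and the entropy of measure-preserving maps\<close>

lemma itinerary_Suc: "itinerary f T (Suc n) x = itinerary f T n x @ [f ((T ^^ n) x)]"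
  by (simp add: itinerary_def)

lemma itinerary_add: "itinerary f T (m + n) x = itinerary f T m x @ itinerary f T n ((T ^^ m) x)"
  by (induction n) (simp_all add: itinerary_Suc itinerary_def funpow_add add.commute)

lemma length_itinerary [simp]: "length (itinerary f T n x) = n"
  by (simp add: itinerary_def)

lemma nth_itinerary: "j < n \<Longrightarrow> itinerary f T n x ! j = f ((T ^^ j) x)"
  by (simp add: itinerary_def)

lemma set_itinerary_subset: "set (itinerary f T n x) \<subseteq> range f"
  by (auto simp: itinerary_def)

lemma range_itinerary_subset:
  assumes "range f \<subseteq> S"
  shows "range (itinerary f T n) \<subseteq> {l. set l \<subseteq> S \<and> length l = n}"
  using assms set_itinerary_subset[of f T n] by fastforce

lemma finite_range_itinerary:
  assumes "finite (range f)"
  shows "finite (range (itinerary f T n))"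
  by (rule finite_subset[OF range_itinerary_subset[OF subset_refl]]) (rule finite_lists_length_eq[OF assms])

lemma card_range_itinerary_le:
  assumes "finite (range f)"
  shows "card (range (itinerary f T n)) \<le> card (range f) ^ n"
  using card_mono[OF finite_lists_length_eq[OF assms] range_itinerary_subset[OF subset_refl]]
  by (simp add: card_lists_length_eq assms)

lemma itinerary_eq_iff:
  "itinerary f T n x = itinerary f T n y \<longleftrightarrow> (\<forall>j<n. f ((T ^^ j) x) = f ((T ^^ j) y))"
  by (auto simp: itinerary_def)

section \<open>Partitions as labellings\<close>

definition cell :: "'a set set \<Rightarrow> 'a \<Rightarrow> 'a set" where
  "cell C x = (THE c. c \<in> C \<and> x \<in> c)"

lemma cell_eq:
  assumes "disjoint C" "c \<in> C" "x \<in> c"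
  shows "cell C x = c"
  unfolding cell_def
proof (rule the_equality)
  show "\<And>c'. c' \<in> C \<and> x \<in> c' \<Longrightarrow> c' = c"
    using assms by (meson disjointD disjoint_iff)
qed (use assms in auto)

lemma
  assumes "disjoint C" "\<Union>C = UNIV"
  shows cell_mem: "cell C x \<in> C" and mem_cell: "x \<in> cell C x"
proof -
  obtain c where "c \<in> C" "x \<in> c" using assms by blast
  then show "cell C x \<in> C" "x \<in> cell C x" using cell_eq[OF assms(1)] by auto
qed

text \<open>Indexed by points rather than by values, so no fibre is empty.\<close>

definition fibers :: "('a \<Rightarrow> 'b) \<Rightarrow> 'a set set" where
  "fibers X = range (\<lambda>x. X -` {X x})"

lemma fibers_cell:
  assumes "disjoint C" "\<Union>C = UNIV"
  shows "fibers (cell C) = C - {{}}"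
proof -
  have *: "cell C -` {cell C x} = cell C x" for x
    using assms cell_eq cell_mem mem_cell by (fastforce simp: vimage_def)
  show ?thesis
  proof
    show "fibers (cell C) \<subseteq> C - {{}}"
      using assms * cell_mem[OF assms] mem_cell[OF assms] by (fastforce simp: fibers_def)
    show "C - {{}} \<subseteq> fibers (cell C)"
    proof
      fix c assume "c \<in> C - {{}}"
      then obtain x where "x \<in> c" "c \<in> C" by auto
      then have "c = cell C x" using cell_eq[OF assms(1)] by auto
      then show "c \<in> fibers (cell C)" using * by (auto simp: fibers_def)
    qed
  qed
qed

text \<open>Closed form of the recursion. Empty sets are removed because
  \<open>cover_iter T A (Suc 0)\<close> is \<open>A\<close> itself, which may contain the empty set,
  whereas every later join discards empty intersections.\<close>

lemma cover_iter_eq: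
  "cover_iter T A n - {{}} = {W. W \<noteq> {} \<and> (\<exists>s. (\<forall>j<n. s j \<in> A) \<and> W = (\<Inter>j<n. (T ^^ j) -` s j))}"
proof (induction T A n rule: cover_iter.induct)
  case (1 T A)
  then show ?case by auto
next
  case (2 T A)
  show ?case
  proof (intro set_eqI iffI)
    fix W assume "W \<in> cover_iter T A (Suc 0) - {{}}"
    then show "W \<in> {W. W \<noteq> {} \<and> (\<exists>s. (\<forall>j<Suc 0. s j \<in> A) \<and> W = (\<Inter>j<Suc 0. (T ^^ j) -` s j))}"
      by (auto intro!: exI[of _ "\<lambda>_. W"])
  next
    fix W assume "W \<in> {W. W \<noteq> {} \<and> (\<exists>s. (\<forall>j<Suc 0. s j \<in> A) \<and> W = (\<Inter>j<Suc 0. (T ^^ j) -` s j))}"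
    then obtain s where "W \<noteq> {}" "s 0 \<in> A" "W = (\<Inter>j<Suc 0. (T ^^ j) -` s j)" by auto
    moreover have "(\<Inter>j<Suc 0. (T ^^ j) -` s j) = s 0" by (simp add: lessThan_Suc)
    ultimately show "W \<in> cover_iter T A (Suc 0) - {{}}" by simp
  qed
next
  case (3 T A n)
  have INT_Suc: "(\<Inter>j<Suc k. g j) = (\<Inter>j<k. g j) \<inter> g k" for k and g :: "nat \<Rightarrow> 'a set"
    by (simp add: lessThan_Suc Int_commute)
  show ?case
  proof (intro set_eqI iffI)
    fix W assume "W \<in> cover_iter T A (Suc (Suc n)) - {{}}"
    then obtain a b where W: "W = a \<inter> (T ^^ Suc n) -` b" "W \<noteq> {}" "a \<in> cover_iter T A (Suc n)" "b \<in> A"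
      by (auto simp: cover_join_def cover_preimage_def simp del: funpow.simps)
    then have "a \<in> cover_iter T A (Suc n) - {{}}" by auto
    then obtain s where s: "\<forall>j<Suc n. s j \<in> A" "a = (\<Inter>j<Suc n. (T ^^ j) -` s j)"
      using "3.IH" by auto
    have "W = (\<Inter>j<Suc (Suc n). (T ^^ j) -` (s(Suc n := b)) j)"
    proof -
      have "(\<Inter>j<Suc n. (T ^^ j) -` (s(Suc n := b)) j) = a"
        unfolding s(2) by (intro INF_cong) auto
      then show ?thesis unfolding W(1) INT_Suc by simp
    qed
    with W s show "W \<in> {W. W \<noteq> {} \<and> (\<exists>s. (\<forall>j<Suc (Suc n). s j \<in> A) \<and> W = (\<Inter>j<Suc (Suc n). (T ^^ j) -` s j))}"
      by (intro CollectI conjI exI[of _ "s(Suc n := b)"]) (auto simp: less_Suc_eq)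
  next
    fix W assume "W \<in> {W. W \<noteq> {} \<and> (\<exists>s. (\<forall>j<Suc (Suc n). s j \<in> A) \<and> W = (\<Inter>j<Suc (Suc n). (T ^^ j) -` s j))}"
    then obtain s where s: "W \<noteq> {}" "\<forall>j<Suc (Suc n). s j \<in> A" "W = (\<Inter>j<Suc (Suc n). (T ^^ j) -` s j)" by auto
    let ?a = "\<Inter>j<Suc n. (T ^^ j) -` s j"
    have eq: "W = ?a \<inter> (T ^^ Suc n) -` s (Suc n)"
      unfolding s(3) by (rule INT_Suc)
    then have "?a \<noteq> {}" using s by auto
    then have "?a \<in> cover_iter T A (Suc n) - {{}}"
      unfolding "3.IH" using s(2) \<open>?a \<noteq> {}\<close>
      by (intro CollectI conjI exI[of _ s]) auto
    then show "W \<in> cover_iter T A (Suc (Suc n)) - {{}}"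
      unfolding cover_iter.simps cover_join_def cover_preimage_def
      using eq s(1,2) by (simp del: funpow.simps cover_iter.simps) blast
  qed
qed

text \<open>In a partition the cells along the orbit are forced by the point, so a nonempty
  intersection of pulled-back cells is exactly the set of points with one common word.\<close>

lemma cover_iter_partition:
  assumes "disjoint C" "\<Union>C = UNIV"
  shows "cover_iter T C n - {{}} = fibers (itinerary (cell C) T n)"
proof -
  have c: "cell C y = cell C z \<longleftrightarrow> y \<in> cell C z" for y z
    using cell_eq[OF assms(1)] mem_cell[OF assms] cell_mem[OF assms] by metis
  have fib: "(\<Inter>j<n. (T ^^ j) -` cell C ((T ^^ j) x)) = itinerary (cell C) T n -` {itinerary (cell C) T n x}" for x
    by (auto simp: itinerary_eq_iff c)
  show ?thesis
  proof (intro set_eqI iffI)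
    fix W assume "W \<in> cover_iter T C n - {{}}"
    then obtain s x where s: "x \<in> W" "\<forall>j<n. s j \<in> C" "W = (\<Inter>j<n. (T ^^ j) -` s j)"
      unfolding cover_iter_eq by auto
    have "s j = cell C ((T ^^ j) x)" if "j < n" for j
      using s that by (subst cell_eq[OF assms(1), of "s j"]) auto
    then have "W = (\<Inter>j<n. (T ^^ j) -` cell C ((T ^^ j) x))"
      unfolding s(3) by (intro INF_cong) auto
    then show "W \<in> fibers (itinerary (cell C) T n)" by (auto simp: fib fibers_def)
  next
    fix W assume "W \<in> fibers (itinerary (cell C) T n)"
    then obtain x where W: "W = itinerary (cell C) T n -` {itinerary (cell C) T n x}"
      by (auto simp: fibers_def)
    then show "W \<in> cover_iter T C n - {{}}"
    proof -
      have "x \<in> W" using W by simp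
      then show ?thesis
        unfolding cover_iter_eq using cell_mem[OF assms] W fib[of x, symmetric]
        by (intro CollectI conjI exI[of _ "\<lambda>j. cell C ((T ^^ j) x)"]) auto
    qed
  qed
qed

lemma partition_entropy_fibers:
  assumes "space M = UNIV" "finite (range X)" "P - {{}} = fibers X"
  shows "partition_entropy M P = shannon M X"
proof -
  have eta: "(if p = 0 then 0 else p * ln (1 / p)) = - (p * ln p)" if "p \<ge> 0" for p :: real
    using that by (simp add: ln_div)
  have fib: "fibers X = (\<lambda>l. X -` {l}) ` range X" by (auto simp: fibers_def)
  then have fin: "finite P" using assms finite_Diff_insert[of P "{}" "{}"] by simp
  have inj: "inj_on (\<lambda>l. X -` {l}) (range X)" by (auto simp: inj_on_def)
  have "partition_entropy M P = (\<Sum>c\<in>P. - (measure M c * ln (measure M c)))"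
    unfolding partition_entropy_def by (intro sum.cong refl eta) simp
  also have "\<dots> = (\<Sum>c\<in>P - {{}}. - (measure M c * ln (measure M c)))"
    using fin by (intro sum.mono_neutral_right) auto
  also have "\<dots> = (\<Sum>l\<in>range X. - (measure M (X -` {l}) * ln (measure M (X -` {l}))))"
    unfolding assms(3) fib by (subst sum.reindex[OF inj]) simp
  finally show ?thesis by (simp add: shannon_def assms sum_negf)
qed

section \<open>Entropy rates of measure-preserving maps\<close>

locale measure_preserving = prob_space M for M :: "'a measure" +
  fixes T :: "'a \<Rightarrow> 'a"
  assumes space_UNIV [simp]: "space M = UNIV"
    and T_measurable [measurable]: "T \<in> measurable M M"
    and measure_vimage: "\<And>A. A \<in> sets M \<Longrightarrow> prob (T -` A) = prob A"
begin

lemma funpow_measurable [measurable]: "(T ^^ n) \<in> measurable M M"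
  by (induction n) simp_all

lemma measure_preserving_funpow: "measure_preserving M (T ^^ n)"
proof
  show "(T ^^ n) \<in> measurable M M" by simp
  show "prob ((T ^^ n) -` A) = prob A" if A: "A \<in> sets M" for A
  proof (induction n)
    case (Suc n)
    have "(T ^^ n) -` A \<in> sets M" using measurable_sets[OF funpow_measurable A] by simp
    then have "prob (T -` ((T ^^ n) -` A)) = prob A" using measure_vimage Suc by simp
    moreover have "T -` ((T ^^ n) -` A) = (T ^^ Suc n) -` A"
      by (simp only: vimage_comp funpow.simps(2) o_def funpow_swap1)
    ultimately show ?case by metis
  qed simp
qed simp

lemma simple_function_funpow:
  assumes "simple_function M X"
  shows "simple_function M (\<lambda>x. X ((T ^^ n) x))"
proof -
  have "finite (range X)" using simple_functionD(1)[OF assms] by simp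
  moreover have "(\<lambda>x. X ((T ^^ n) x)) ` UNIV \<subseteq> range X" by auto
  moreover have "(\<lambda>x. X ((T ^^ n) x)) -` {l} \<in> sets M" for l
    using measurable_sets[OF funpow_measurable, of "X -` {l}" n] simple_functionD(2)[OF assms, of "{l}"]
    by (simp add: vimage_def)
  ultimately show ?thesis unfolding simple_function_def by (auto intro: finite_subset)
qed

lemma shannon_funpow:
  assumes "simple_function M X"
  shows "shannon M (\<lambda>x. X ((T ^^ n) x)) = shannon M X"
proof -
  interpret Tn: measure_preserving M "T ^^ n" by (rule measure_preserving_funpow)
  have fin: "finite (range X)" using simple_functionD(1)[OF assms] by simp
  have "prob ((\<lambda>x. X ((T ^^ n) x)) -` {l}) = prob (X -` {l})" for l
    using Tn.measure_vimage[of "X -` {l}"] simple_functionD(2)[OF assms, of "{l}"] by (simp add: vimage_def)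
  then show ?thesis
    using shannon_superset[OF fin, of X] shannon_superset[OF fin, of "\<lambda>x. X ((T ^^ n) x)"] by auto
qed

lemma simple_function_itinerary:
  assumes "simple_function M f"
  shows "simple_function M (itinerary f T n)"
proof (induction n)
  case (Suc n)
  have "simple_function M (\<lambda>x. (itinerary f T n x, f ((T ^^ n) x)))"
    by (intro simple_function_Pair Suc simple_function_funpow assms)
  from simple_function_compose[OF this, of "\<lambda>(l, a). l @ [a]"]
  show ?case by (simp add: o_def itinerary_Suc[abs_def])
qed (simp add: itinerary_def)

text \<open>A word of length \<open>m + n\<close> is determined by its two blocks; by invariance the
  shifted block has the same distribution as the unshifted one.\<close>

lemma shannon_itinerary_add:
  assumes "simple_function M f"
  shows "shannon M (itinerary f T (m + n)) \<le> shannon M (itinerary f T m) + shannon M (itinerary f T n)"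
proof -
  note sf = simple_function_itinerary[OF assms]
  have "shannon M (itinerary f T (m + n)) \<le> shannon M (\<lambda>x. (itinerary f T m x, itinerary f T n ((T ^^ m) x)))"
    using shannon_comp_le[OF simple_function_Pair[OF sf[of m] simple_function_funpow[OF sf[of n], of m]],
        where f="\<lambda>(a, b). a @ b"]
    by (simp add: itinerary_add[abs_def])
  also have "\<dots> \<le> shannon M (itinerary f T m) + shannon M (itinerary f T n)"
    using shannon_pair_le[OF sf[of m] simple_function_funpow[OF sf[of n], of m]] shannon_funpow[OF sf[of n], of m]
    by simp
  finally show ?thesis .
qed

text \<open>The Kolmogorov-Sinai entropy of the partition into fibres of \<open>f\<close>. The label
  type is arbitrary, so that words can themselves serve as labels.\<close>

definition rate :: "('a \<Rightarrow> 'b) \<Rightarrow> real" where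
  "rate f = lim (\<lambda>n. shannon M (itinerary f T n) / real n)"

lemma
  assumes "simple_function M f"
  shows rate_tendsto: "(\<lambda>n. shannon M (itinerary f T n) / real n) \<longlonglongrightarrow> rate f"
    and rate_le: "n \<ge> 1 \<Longrightarrow> rate f \<le> shannon M (itinerary f T n) / real n"
    and rate_nonneg: "0 \<le> rate f"
proof -
  obtain L where "(\<lambda>n. shannon M (itinerary f T n) / real n) \<longlonglongrightarrow> L"
     "\<And>n. n \<ge> 1 \<Longrightarrow> L \<le> shannon M (itinerary f T n) / real n" "0 \<le> L"
    using subadditive_limit[of "\<lambda>n. shannon M (itinerary f T n)"] shannon_itinerary_add[OF assms] shannon_nonneg
    by blast
  moreover from this(1) have "rate f = L" unfolding rate_def by (rule limI)
  ultimately show "(\<lambda>n. shannon M (itinerary f T n) / real n) \<longlonglongrightarrow> rate f"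
    "n \<ge> 1 \<Longrightarrow> rate f \<le> shannon M (itinerary f T n) / real n" "0 \<le> rate f" by auto
qed

lemma shannon_itinerary_le:
  assumes "simple_function M f"
  shows "shannon M (itinerary f T n) \<le> real n * shannon M f"
proof (induction n)
  case 0
  have "itinerary f T 0 = (\<lambda>x. [])" by (simp add: itinerary_def fun_eq_iff)
  then show ?case by (simp add: shannon_const)
next
  case (Suc n)
  have "itinerary f T 1 = (\<lambda>x. [f x])" by (simp add: itinerary_def fun_eq_iff)
  then have "shannon M (itinerary f T 1) \<le> shannon M f" using shannon_comp_le[OF assms, of "\<lambda>a. [a]"] by simp
  then show ?case using shannon_itinerary_add[OF assms, of n 1] Suc by (simp add: algebra_simps)
qed

text \<open>A word of length \<open>n\<close> over the alphabet of words of length \<open>m\<close>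
  carries the same information as a word of length \<open>n * m\<close>. The factor \<open>m\<close>
  is what later dilutes an additive constant.\<close>

lemma rate_funpow:
  assumes f: "simple_function M f" and m: "m \<ge> 1"
  shows "measure_preserving.rate M (T ^^ m) (itinerary f T m) = real m * rate f"
proof -
  interpret Tm: measure_preserving M "T ^^ m" by (rule measure_preserving_funpow)
  note sf = simple_function_itinerary[OF f]
  have chunk: "(T ^^ j) (((T ^^ m) ^^ i) x) = (T ^^ (i * m + j)) x" for i j x
    unfolding funpow_mult by (metis add.commute comp_apply funpow_add mult.commute)
  have eq: "shannon M (itinerary (itinerary f T m) (T ^^ m) n) = shannon M (itinerary f T (n * m))" for n
  \<comment> \<open>Cutting into blocks of length \<open>m\<close> and concatenating are mutually
    inverse on these words.\<close>
  proof (rule shannon_comp_eq[OF sf,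
        where g="concat" and f="\<lambda>l. map (\<lambda>i. map (\<lambda>j. l ! (i * m + j)) [0..<m]) [0..<n]"])
    fix x
    show "itinerary (itinerary f T m) (T ^^ m) n x
        = map (\<lambda>i. map (\<lambda>j. itinerary f T (n * m) x ! (i * m + j)) [0..<m]) [0..<n]"
    proof -
      have "i * m + j < n * m" if "i < n" "j < m" for i j
      proof -
        have "i * m + j < Suc i * m" using that by simp
        also have "\<dots> \<le> n * m" using that by (intro mult_le_mono1) simp
        finally show ?thesis .
      qed
      then have "f ((T ^^ j) (((T ^^ m) ^^ i) x)) = itinerary f T (n * m) x ! (i * m + j)" if "i < n" "j < m" for i j
        using that by (simp add: nth_itinerary chunk)
      then show ?thesis
        by (simp add: itinerary_def[of _ "T ^^ m"] itinerary_def[of f T m])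
    qed
    show "itinerary f T (n * m) x = concat (itinerary (itinerary f T m) (T ^^ m) n x)"
    proof (induction n)
      case (Suc n)
      have "itinerary f T (Suc n * m) x = itinerary f T (n * m + m) x" by (simp add: add.commute)
      also have "\<dots> = itinerary f T (n * m) x @ itinerary f T m ((T ^^ (n * m)) x)"
        by (rule itinerary_add)
      finally show ?case using Suc by (simp add: itinerary_Suc funpow_mult mult.commute)
    qed (simp add: itinerary_def)
  qed
  have "(\<lambda>n. shannon M (itinerary f T (n * m)) / real (n * m)) \<longlonglongrightarrow> rate f"
    using LIMSEQ_subseq_LIMSEQ[OF rate_tendsto[OF f], of "\<lambda>n. n * m"] m
    by (simp add: o_def strict_mono_def)
  then have "(\<lambda>n. real m * (shannon M (itinerary f T (n * m)) / real (n * m))) \<longlonglongrightarrow> real m * rate f"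
    by (intro tendsto_intros)
  moreover have "real m * (shannon M (itinerary f T (n * m)) / real (n * m)) = shannon M (itinerary f T (n * m)) / real n" for n
    using m by simp
  ultimately have "(\<lambda>n. shannon M (itinerary (itinerary f T m) (T ^^ m) n) / real n) \<longlonglongrightarrow> real m * rate f"
    by (simp add: eq)
  then show ?thesis unfolding Tm.rate_def by (rule limI)
qed

end

section \<open>Covers\<close>

lemma N_on_le:
  assumes "B \<subseteq> A" "finite B" "Y \<subseteq> \<Union>B"
  shows "N_on Y A \<le> card B"
  unfolding N_on_def by (rule Least_le) (use assms in blast)

text \<open>The \<open>LEAST\<close> in \<open>N_on\<close> is meaningful only if some finite
  subfamily covers \<open>Y\<close>; the given \<open>B\<close> guarantees this.\<close>

lemma N_on_obtain:
  assumes "B \<subseteq> A" "finite B" "Y \<subseteq> \<Union>B"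
  obtains B' where "B' \<subseteq> A" "finite B'" "Y \<subseteq> \<Union>B'" "card B' = N_on Y A"
proof -
  have "\<exists>n B. B \<subseteq> A \<and> finite B \<and> card B = n \<and> Y \<subseteq> \<Union>B" using assms by blast
  then have "\<exists>B. B \<subseteq> A \<and> finite B \<and> card B = N_on Y A \<and> Y \<subseteq> \<Union>B"
    unfolding N_on_def by (rule LeastI_ex)
  then show ?thesis using that by blast
qed

text \<open>Enlarge each member of an optimal subfamily to a member of \<open>A'\<close>. Refinement
  is asked of nonempty members only, since those of a \<open>cover_iter\<close> are the ones known
  to be intersections of preimages.\<close>

lemma N_on_refine:
  assumes "B \<subseteq> A" "finite B" "Y \<subseteq> \<Union>B" and "Z \<subseteq> Y"
    and ref: "\<And>a. a \<in> A \<Longrightarrow> a \<noteq> {} \<Longrightarrow> \<exists>a'\<in>A'. a \<subseteq> a'"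
  shows "N_on Z A' \<le> N_on Y A"
proof -
  obtain B' where B': "B' \<subseteq> A" "finite B'" "Y \<subseteq> \<Union>B'" "card B' = N_on Y A"
    using N_on_obtain[OF assms(1-3)] .
  obtain g where g: "\<And>a. a \<in> A \<Longrightarrow> a \<noteq> {} \<Longrightarrow> g a \<in> A' \<and> a \<subseteq> g a"
    using ref by metis
  have "N_on Z A' \<le> card (g ` (B' - {{}}))"
  proof (rule N_on_le)
    show "g ` (B' - {{}}) \<subseteq> A'" using g B' by auto
    show "Z \<subseteq> \<Union> (g ` (B' - {{}}))"
    proof
      fix z assume "z \<in> Z"
      then obtain b where "b \<in> B'" "z \<in> b" using B' assms by blast
      then show "z \<in> \<Union> (g ` (B' - {{}}))" using g[of b] B' by blast
    qed
  qed (use B' in simp)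
  also have "\<dots> \<le> card (B' - {{}})" by (rule card_image_le) (use B' in simp)
  also have "\<dots> \<le> card B'" by (rule card_mono) (use B' in auto)
  finally show ?thesis using B' by simp
qed

lemma N_on_pos:
  assumes "B \<subseteq> A" "finite B" "Y \<subseteq> \<Union>B" "Y \<noteq> {}"
  shows "1 \<le> N_on Y A"
proof -
  obtain B' where "B' \<subseteq> A" "finite B'" "Y \<subseteq> \<Union>B'" "card B' = N_on Y A"
    using N_on_obtain[OF assms(1-3)] .
  then show ?thesis using assms(4) by (cases "B' = {}") (auto simp: Suc_le_eq card_gt_0_iff simp flip: card_0_eq)
qed

lemma cover_iter_memI:
  assumes "\<And>j. j < n \<Longrightarrow> s j \<in> A" "x \<in> (\<Inter>j<n. (T ^^ j) -` s j)"
  shows "(\<Inter>j<n. (T ^^ j) -` s j) \<in> cover_iter T A n"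
proof -
  have "(\<Inter>j<n. (T ^^ j) -` s j) \<in> cover_iter T A n - {{}}"
    unfolding cover_iter_eq using assms by (intro CollectI conjI exI[of _ s]) blast+
  then show ?thesis by simp
qed

lemma cover_iter_memE:
  assumes "W \<in> cover_iter T A n" "W \<noteq> {}"
  obtains s where "\<forall>j<n. s j \<in> A" "W = (\<Inter>j<n. (T ^^ j) -` s j)"
proof -
  have "W \<in> cover_iter T A n - {{}}" using assms by simp
  then show ?thesis using that unfolding cover_iter_eq by blast
qed

lemma cover_iter_finite_subcover:
  assumes "B \<subseteq> A" "finite B" "\<Union>B = UNIV"
  obtains B' where "B' \<subseteq> cover_iter T A n" "finite B'" "\<Union>B' = UNIV"
proof
  let ?F = "(\<lambda>s. \<Inter>j<n. (T ^^ j) -` s j) ` (PiE {..<n} (\<lambda>_. B))"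
  show "finite (?F - {{}})" using assms by (intro finite_Diff finite_imageI finite_PiE) auto
  show "?F - {{}} \<subseteq> cover_iter T A n"
  proof
    fix W assume "W \<in> ?F - {{}}"
    then obtain s x where "s \<in> PiE {..<n} (\<lambda>_. B)" "W = (\<Inter>j<n. (T ^^ j) -` s j)" "x \<in> W" by blast
    then show "W \<in> cover_iter T A n"
      using assms(1) by (auto intro!: cover_iter_memI[of _ _ _ x] simp: PiE_iff)
  qed
  show "\<Union> (?F - {{}}) = UNIV"
  proof (intro set_eqI iffI UNIV_I)
    fix x
    have "\<forall>j. \<exists>b. b \<in> B \<and> (T ^^ j) x \<in> b" using assms(3) by blast
    then obtain s where s: "\<And>j. s j \<in> B \<and> (T ^^ j) x \<in> s j" by metis
    let ?s = "restrict s {..<n}"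
    have "(\<Inter>j<n. (T ^^ j) -` ?s j) \<in> ?F" using s by (intro imageI) auto
    moreover have "x \<in> (\<Inter>j<n. (T ^^ j) -` ?s j)" using s by auto
    ultimately show "x \<in> \<Union> (?F - {{}})" by blast
  qed
qed

text \<open>Intersect an optimal subcover of the \<open>m\<close>-th iterate with the
  \<open>T ^^ m\<close>-preimages of one of the \<open>n\<close>-th. This is the subadditivity
  behind the limit defining \<open>cover_entropy\<close>.\<close>

lemma N_cover_iter_add:
  assumes "B \<subseteq> A" "finite B" "\<Union>B = UNIV"
  shows "N_cover (cover_iter T A (m + n)) \<le> N_cover (cover_iter T A m) * N_cover (cover_iter T A n)"
proof -
  have ex: "\<exists>Bk. Bk \<subseteq> cover_iter T A k \<and> finite Bk \<and> \<Union>Bk = UNIV \<and> card Bk = N_cover (cover_iter T A k)" for k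
  proof -
    obtain B' where B': "B' \<subseteq> cover_iter T A k" "finite B'" "\<Union>B' = UNIV"
      using cover_iter_finite_subcover[OF assms] by metis
    then have "UNIV \<subseteq> \<Union>B'" by simp
    from N_on_obtain[OF B'(1,2) this]
    show ?thesis unfolding N_cover_def by (metis top.extremum_uniqueI)
  qed
  obtain Bm Bn where Bm: "Bm \<subseteq> cover_iter T A m" "finite Bm" "\<Union>Bm = UNIV" "card Bm = N_cover (cover_iter T A m)"
    and Bn: "Bn \<subseteq> cover_iter T A n" "finite Bn" "\<Union>Bn = UNIV" "card Bn = N_cover (cover_iter T A n)"
    using ex[of m] ex[of n] by blast
  let ?F = "(\<lambda>(b, c). b \<inter> (T ^^ m) -` c) ` (Bm \<times> Bn)"
  have "N_cover (cover_iter T A (m + n)) \<le> card (?F - {{}})"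
    unfolding N_cover_def
  proof (rule N_on_le)
    show "?F - {{}} \<subseteq> cover_iter T A (m + n)"
    proof
      fix W assume "W \<in> ?F - {{}}"
      then obtain b c x where W: "b \<in> Bm" "c \<in> Bn" "W = b \<inter> (T ^^ m) -` c" "x \<in> W" by fast
      then have bc: "b \<in> cover_iter T A m" "b \<noteq> {}" "c \<in> cover_iter T A n" "c \<noteq> {}" using Bm Bn by auto
      obtain s where s: "\<forall>j<m. s j \<in> A" "b = (\<Inter>j<m. (T ^^ j) -` s j)"
        using cover_iter_memE[OF bc(1,2)] .
      obtain t where t: "\<forall>j<n. t j \<in> A" "c = (\<Inter>j<n. (T ^^ j) -` t j)"
        using cover_iter_memE[OF bc(3,4)] .
      \<comment> \<open>Glues the two sequences of choices, the second delayed by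
        \<open>m\<close>.\<close>
      define u where "u j = (if j < m then s j else t (j - m))" for j
      have u_iff: "y \<in> W \<longleftrightarrow> y \<in> (\<Inter>j<m+n. (T ^^ j) -` u j)" for y
      proof -
        have "y \<in> (\<Inter>j<m+n. (T ^^ j) -` u j) \<longleftrightarrow> (\<forall>j<m+n. (T ^^ j) y \<in> u j)" by auto
        also have "\<dots> \<longleftrightarrow> (\<forall>j<m. (T ^^ j) y \<in> s j) \<and> (\<forall>j<n. (T ^^ (j + m)) y \<in> t j)"
        proof safe
          fix j assume *: "\<forall>j<m+n. (T ^^ j) y \<in> u j"
          { assume "j < m" then show "(T ^^ j) y \<in> s j" using *[rule_format, of j] by (simp add: u_def) }
          { assume "j < n" then show "(T ^^ (j + m)) y \<in> t j" using *[rule_format, of "j + m"] by (simp add: u_def) }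
        next
          fix j assume *: "\<forall>j<m. (T ^^ j) y \<in> s j" "\<forall>j<n. (T ^^ (j + m)) y \<in> t j" "j < m + n"
          show "(T ^^ j) y \<in> u j"
          proof (cases "j < m")
            case False
            then have "j - m < n" using *(3) by linarith
            then show ?thesis using *(2)[rule_format, of "j - m"] False by (simp add: u_def)
          qed (use * in \<open>simp add: u_def\<close>)
        qed
        also have "\<dots> \<longleftrightarrow> y \<in> W" by (auto simp: W s t funpow_add)
        finally show ?thesis ..
      qed
      have eq: "W = (\<Inter>j<m+n. (T ^^ j) -` u j)" by (intro set_eqI u_iff)
      have "u j \<in> A" if "j < m + n" for j using s(1) t(1)[rule_format, of "j - m"] that by (auto simp: u_def)
      then show "W \<in> cover_iter T A (m + n)"
        unfolding eq using W(4) u_iff by (intro cover_iter_memI[of _ _ _ x]) blast+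
    qed
    show "UNIV \<subseteq> \<Union> (?F - {{}})"
    proof
      fix x
      obtain b c where "b \<in> Bm" "x \<in> b" "c \<in> Bn" "(T ^^ m) x \<in> c" using Bm Bn by (metis UNIV_I UnionE)
      then have "x \<in> b \<inter> (T ^^ m) -` c" "b \<inter> (T ^^ m) -` c \<in> ?F" by auto
      then show "x \<in> \<Union> (?F - {{}})" by (intro UnionI[of "b \<inter> (T ^^ m) -` c"]) auto
    qed
  qed (use Bm Bn in auto)
  also have "\<dots> \<le> card ?F" by (rule card_mono) (use Bm Bn in auto)
  also have "\<dots> \<le> card (Bm \<times> Bn)" by (rule card_image_le) (use Bm Bn in auto)
  finally show ?thesis by (simp add: Bm Bn card_cartesian_product)
qed

lemma
  assumes "B \<subseteq> A" "finite B" "\<Union>B = UNIV"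
  shows N_cover_iter_pos: "1 \<le> N_cover (cover_iter T A n)"
    and cover_entropy_tendsto: "(\<lambda>n. ln (real (N_cover (cover_iter T A n))) / real n) \<longlonglongrightarrow> cover_entropy T A"
    and cover_entropy_nonneg: "0 \<le> cover_entropy T A"
proof -
  show pos: "1 \<le> N_cover (cover_iter T A n)" for n
  proof -
    obtain B' where B': "B' \<subseteq> cover_iter T A n" "finite B'" "\<Union>B' = UNIV"
      using cover_iter_finite_subcover[OF assms] by metis
    then show ?thesis unfolding N_cover_def by (intro N_on_pos[of B']) auto
  qed
  have "ln (real (N_cover (cover_iter T A (m + n)))) \<le> ln (real (N_cover (cover_iter T A m))) + ln (real (N_cover (cover_iter T A n)))" for m n
  proof -
    have "ln (real (N_cover (cover_iter T A (m + n)))) \<le> ln (real (N_cover (cover_iter T A m) * N_cover (cover_iter T A n)))"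
      by (intro ln_mono of_nat_mono N_cover_iter_add[OF assms]) (use pos[of "m+n"] in simp)
    also have "\<dots> = ln (real (N_cover (cover_iter T A m))) + ln (real (N_cover (cover_iter T A n)))"
      using pos[of m] pos[of n] by (simp add: ln_mult)
    finally show ?thesis .
  qed
  moreover have "0 \<le> ln (real (N_cover (cover_iter T A n)))" for n using pos[of n] by simp
  ultimately obtain L where L: "(\<lambda>n. ln (real (N_cover (cover_iter T A n))) / real n) \<longlonglongrightarrow> L" "0 \<le> L"
    using subadditive_limit[of "\<lambda>n. ln (real (N_cover (cover_iter T A n)))"] by blast
  have "cover_entropy T A = L" unfolding cover_entropy_def by (rule limI[OF L(1)])
  with L show "(\<lambda>n. ln (real (N_cover (cover_iter T A n))) / real n) \<longlonglongrightarrow> cover_entropy T A" "0 \<le> cover_entropy T A"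
    by auto
qed

text \<open>For \<open>n = 0\<close> the maximum would range over the empty set.\<close>

lemma bowen_dist_less_iff:
  assumes "n \<ge> 1"
  shows "bowen_dist d T n x y < e \<longleftrightarrow> (\<forall>j<n. d ((T ^^ j) x) ((T ^^ j) y) < e)"
proof -
  have "{..<n} \<noteq> {}" using assms by (simp add: lessThan_empty_iff)
  then show ?thesis unfolding bowen_dist_def by (subst Max_less_iff) auto
qed

lemma continuous_on_funpow:
  fixes T :: "'a::topological_space \<Rightarrow> 'a"
  assumes "continuous_on UNIV T"
  shows "continuous_on UNIV (T ^^ j)"
proof (induction j)
  case (Suc j)
  then show ?case using continuous_on_compose[OF Suc continuous_on_subset[OF assms]] by (simp add: o_def)
qed (simp add: id_def)

lemma bowen_balls_memI:
  "{y. bowen_dist d T n x y < e} \<in> bowen_balls d T n e"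
  by (auto simp: bowen_balls_def)

text \<open>The member with compact complement takes care of infinity.\<close>

lemma admissible_finite_subcover:
  assumes "admissible_open_cover A"
  obtains B where "B \<subseteq> A" "finite B" "\<Union>B = UNIV"
proof -
  obtain a where a: "a \<in> A" "compact (UNIV - a)" and A: "\<And>b. b \<in> A \<Longrightarrow> open b" "\<Union>A = UNIV"
    using assms unfolding admissible_open_cover_def by blast
  obtain B where "B \<subseteq> A" "finite B" "UNIV - a \<subseteq> \<Union>B"
  proof (rule compactE[OF a(2), of A])
    show "UNIV - a \<subseteq> \<Union>A" using A(2) by simp
  qed (use A(1) in auto)
  then show ?thesis using a by (intro that[of "insert a B"]) auto
qed

text \<open>If the members of \<open>A\<close> are \<open>e\<close>-small, each nonempty member of
  its \<open>n\<close>-th iterate lies in the Bowen ball of radius \<open>e\<close> about any of its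
  points. Subcovers thus give at least as many sets as balls are needed for
  \<open>K\<close>.\<close>

lemma bowen_entropy_le:
  assumes small: "\<And>e. e > 0 \<Longrightarrow> \<exists>A. admissible_open_cover A \<and> (\<forall>a\<in>A. \<forall>x\<in>a. \<forall>y\<in>a. d x y < e)"
  shows "bowen_entropy d T \<le> top_entropy T"
  unfolding bowen_entropy_def
proof (rule SUP_least, clarsimp)
  fix e :: real and K :: "'a set" assume e: "e > 0" "compact K"
  obtain A where A: "admissible_open_cover A" "\<And>a x y. a \<in> A \<Longrightarrow> x \<in> a \<Longrightarrow> y \<in> a \<Longrightarrow> d x y < e"
    using small[OF e(1)] by blast
  obtain B where B: "B \<subseteq> A" "finite B" "\<Union>B = UNIV" using admissible_finite_subcover[OF A(1)] .
  have le: "N_on K (bowen_balls d T n e) \<le> N_cover (cover_iter T A n)" if n: "n \<ge> 1" for n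
  proof -
    obtain B' where B': "B' \<subseteq> cover_iter T A n" "finite B'" "\<Union>B' = UNIV"
      using cover_iter_finite_subcover[OF B] by metis
    show ?thesis unfolding N_cover_def
    proof (rule N_on_refine[OF B'(1,2)])
      fix W assume W: "W \<in> cover_iter T A n" "W \<noteq> {}"
      obtain s where s: "\<forall>j<n. s j \<in> A" "W = (\<Inter>j<n. (T ^^ j) -` s j)"
        by (rule cover_iter_memE[OF W])
      obtain x where x: "x \<in> W" using W by blast
      have "W \<subseteq> {y. bowen_dist d T n x y < e}"
      proof
        fix y assume "y \<in> W"
        then have "d ((T ^^ j) x) ((T ^^ j) y) < e" if "j < n" for j
          using s x that by (intro A(2)[of "s j"]) auto
        then show "y \<in> {y. bowen_dist d T n x y < e}" by (simp add: bowen_dist_less_iff[OF n])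
      qed
      then show "\<exists>a'\<in>bowen_balls d T n e. W \<subseteq> a'" by (rule bexI[OF _ bowen_balls_memI])
    qed (use B' in auto)
  qed
  have "limsup (\<lambda>n. ereal (ln (real (N_on K (bowen_balls d T n e))) / real n))
      \<le> limsup (\<lambda>n. ereal (ln (real (N_cover (cover_iter T A n))) / real n))"
  proof (rule Limsup_mono, rule eventually_mono[OF eventually_ge_at_top[of 1]])
    fix n :: nat assume n: "n \<ge> 1"
    \<comment> \<open>\<open>K\<close> may be empty; the left-hand side is then
      \<open>ln 0 = 0\<close>.\<close>
    have "ln (real (N_on K (bowen_balls d T n e))) \<le> ln (real (N_cover (cover_iter T A n)))"
      using le[OF n] N_cover_iter_pos[OF B, of T n]
      by (cases "N_on K (bowen_balls d T n e) = 0") auto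
    then show "ereal (ln (real (N_on K (bowen_balls d T n e))) / real n) \<le> ereal (ln (real (N_cover (cover_iter T A n))) / real n)"
      by (simp add: divide_right_mono)
  qed
  also have "\<dots> = ereal (cover_entropy T A)"
    by (rule lim_imp_Limsup) (use cover_entropy_tendsto[OF B, of T] in auto)
  also have "\<dots> \<le> top_entropy T"
    unfolding top_entropy_def by (rule SUP_upper) (use A in simp)
  finally show "limsup (\<lambda>n. ereal (ln (real (N_on K (bowen_balls d T n e))) / real n)) \<le> top_entropy T" .
qed

section \<open>The one-point compactification\<close>

lemma compatible_metric_open_iff:
  assumes "compatible_metric d"
  shows "open U \<longleftrightarrow> (\<forall>x\<in>U. \<exists>r>0. \<forall>y. d x y < r \<longrightarrow> y \<in> U)"
proof -
  interpret Metric_space UNIV d using assms by (simp add: compatible_metric_def)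
  have "open U \<longleftrightarrow> openin mtopology U"
    using assms by (simp add: compatible_metric_def)
  also have "\<dots> \<longleftrightarrow> (\<forall>x\<in>U. \<exists>r>0. \<forall>y. d x y < r \<longrightarrow> y \<in> U)"
    by (simp add: openin_mtopology subset_eq Ball_def)
  finally show ?thesis .
qed

lemma compatible_metric_open_ball:
  assumes "compatible_metric d"
  shows "open {y. d x y < e}"
proof -
  interpret Metric_space UNIV d using assms by (simp add: compatible_metric_def)
  have "mtopology = euclidean" using assms by (simp add: compatible_metric_def)
  then show ?thesis using openin_mball[of x e, unfolded mball_def] by simp
qed

text \<open>The type class provides only a topology, so separation, and with it closedness of
  compact sets, has to come from a metric.\<close>

lemma compatible_metric_imp_Hausdorff:
  fixes d :: "'a::topological_space \<Rightarrow> 'a \<Rightarrow> real"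
  assumes "compatible_metric d"
  shows "Hausdorff_space (euclidean :: 'a topology)"
proof -
  interpret Metric_space UNIV d using assms by (simp add: compatible_metric_def)
  show ?thesis using Hausdorff_space_mtopology assms by (simp add: compatible_metric_def)
qed

lemma Hausdorff_imp_compact_closed:
  assumes "Hausdorff_space (euclidean :: 'a::topological_space topology)" "compact (K :: 'a set)"
  shows "closed K"
  using compactin_imp_closedin[OF assms(1), of K] assms(2) by simp

lemma openin_Alexandroff_compactification_iff:
  assumes "Hausdorff_space (euclidean :: 'a::topological_space topology)"
  shows "openin (Alexandroff_compactification (euclidean :: 'a topology)) V \<longleftrightarrow> alexandroff_open V"
proof -
  have 1: "V = Some ` (Some -` V)" if "None \<notin> V"
  proof (intro set_eqI iffI)
    fix x assume "x \<in> V" then show "x \<in> Some ` (Some -` V)" using that by (cases x) auto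
  qed auto
  have 2: "V = insert None (Some ` (Some -` V))" if "None \<in> V"
  proof (intro set_eqI iffI)
    fix x assume "x \<in> V" then show "x \<in> insert None (Some ` (Some -` V))" by (cases x) auto
  qed (use that in auto)
  have 3: "Some -` (Some ` U) = U" "Some -` insert None (Some ` U) = U" for U :: "'a set" by auto
  show ?thesis
  proof
    assume "openin (Alexandroff_compactification (euclidean :: 'a topology)) V"
    then consider U where "open U" "V = Some ` U"
      | C where "compact C" "closed C" "V = insert None (Some ` (UNIV - C))"
      by (auto simp: openin_Alexandroff_compactification)
    then show "alexandroff_open V"
    proof cases
      case 1
      then show ?thesis by (auto simp: alexandroff_open_def 3)
    next
      case 2
      then have "Some -` V = - C" by (auto simp: Compl_eq_Diff_UNIV)
      with 2 show ?thesis by (auto simp: alexandroff_open_def Compl_eq_Diff_UNIV[symmetric] open_Compl)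
    qed
  next
    assume V: "alexandroff_open V"
    show "openin (Alexandroff_compactification (euclidean :: 'a topology)) V"
    proof (cases "None \<in> V")
      case True
      have "compact (UNIV - Some -` V)" "closed (UNIV - Some -` V)"
        using V True by (auto simp: alexandroff_open_def Compl_eq_Diff_UNIV[symmetric])
      then show ?thesis
        using 2[OF True] unfolding openin_Alexandroff_compactification
        by (intro disjI2 exI[of _ "UNIV - Some -` V"]) (simp add: double_diff)
    next
      case False
      then show ?thesis
        using 1 V unfolding openin_Alexandroff_compactification
        by (intro disjI1 exI[of _ "Some -` V"]) (simp add: alexandroff_open_def)
    qed
  qed
qed

text \<open>Countably many tent functions that vanish near infinity map the compactification
  continuously and injectively into the space of real sequences. Since the source is compact and the
  target Hausdorff, this is an embedding, and the metric of the target is pulled back.\<close>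

lemma ex_compactification_metric:
  assumes met: "metrizable_space (euclidean :: 'a::topological_space topology)"
    and lc: "locally_compact_space (euclidean :: 'a topology)"
    and sep: "separable_space (euclidean :: 'a topology)"
  obtains D :: "'a::topological_space option \<Rightarrow> 'a option \<Rightarrow> real"
  where "Metric_space UNIV D" "\<And>V. openin (Metric_space.mtopology UNIV D) V \<longleftrightarrow> alexandroff_open V"
proof -
  have H: "Hausdorff_space (euclidean :: 'a topology)" by (rule metrizable_imp_Hausdorff_space[OF met])
  obtain M d where d: "Metric_space M d" "(euclidean :: 'a topology) = Metric_space.mtopology M d"
    using met unfolding metrizable_space_def by blast
  then have "M = UNIV" using Metric_space.topspace_mtopology[OF d(1)] by (metis topspace_euclidean)
  with d have d_metric: "Metric_space UNIV d" and d_compat: "compatible_metric d"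
    by (auto simp: compatible_metric_def)
  interpret d: Metric_space UNIV d by (rule d_metric)
  note open_d = compatible_metric_open_iff[OF d_compat]
  obtain C :: "'a set" where C: "countable C" "euclidean closure_of C = UNIV"
    using sep unfolding separable_space_def by auto
  have dense: "\<exists>c\<in>C. d c x < r" if "r > 0" for x r
  proof -
    have "x \<in> d.mtopology closure_of C" using C d_compat by (simp add: compatible_metric_def)
    then show ?thesis using that by (auto simp: d.metric_closure_of d.commute)
  qed
  \<comment> \<open>A tent of height \<open>q\<close> on the ball of radius \<open>q\<close> about
    \<open>c\<close>. It is replaced by 0 unless the ball lies in a compact set, so that extension
    by 0 at \<open>None\<close> is continuous.\<close>
  define g where "g c q y = (if \<exists>K. compact K \<and> {y. d c y < q} \<subseteq> K then max 0 (q - d c y) else 0)" for c :: 'a and q y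
  have g_lip: "\<bar>g c q y - g c q z\<bar> \<le> d y z" for c q y z
  proof -
    have "d c z \<le> d c y + d y z" "d c y \<le> d c z + d y z" "0 \<le> d y z"
      using d.triangle[of c y z] d.triangle[of c z y] d.commute[of z y] by simp_all
    then show ?thesis unfolding g_def by (auto split: split_max)
  qed
  have g_open: "open {y. g c q y \<in> U}" if U: "open U" for U c q
    unfolding open_d
  proof
    fix y assume "y \<in> {y. g c q y \<in> U}"
    then obtain e where e: "e > 0" "\<And>t. dist t (g c q y) < e \<Longrightarrow> t \<in> U"
      using U unfolding open_dist by blast
    have "g c q z \<in> U" if "d y z < e" for z
      using g_lip[of c q z y] that by (intro e(2)) (simp add: dist_real_def d.commute)
    then show "\<exists>r>0. \<forall>z. d y z < r \<longrightarrow> z \<in> {y. g c q y \<in> U}"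
      using e(1) by blast
  qed
  define c :: "nat \<Rightarrow> 'a \<times> real" where "c = from_nat_into (C \<times> \<rat>)"
  have "C \<noteq> {}" using dense[of 1] by auto
  then have c: "range c = C \<times> \<rat>"
    unfolding c_def by (intro range_from_nat_into) (use C countable_rat in \<open>auto intro: Rats_0\<close>)
  define F :: "'a option \<Rightarrow> nat \<Rightarrow> real" where
    "F p k = (case p of None \<Rightarrow> 0 | Some y \<Rightarrow> g (fst (c k)) (snd (c k)) y)" for p k
  let ?A = "Alexandroff_compactification (euclidean :: 'a topology)"
  have topA: "topspace ?A = UNIV" by (auto simp: notin_range_Some)
  note openA = openin_Alexandroff_compactification_iff[OF H]
  have contF: "continuous_map ?A euclidean F"
  proof -
    have "continuous_map ?A euclideanreal (\<lambda>p. F p k)" for k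
      unfolding continuous_map_def topA
    proof (intro conjI allI impI)
      fix U :: "real set" assume "openin euclidean U"
      then have U: "open U" by simp
      let ?g = "g (fst (c k)) (snd (c k))"
      have eq: "Some -` {p. F p k \<in> U} = {y. ?g y \<in> U}" by (auto simp: F_def)
      have "compact (UNIV - {y. ?g y \<in> U})" if "0 \<in> U"
      proof -
        have cl: "closed (UNIV - {y. ?g y \<in> U})"
          by (intro closed_Diff closed_UNIV g_open[OF U])
        show ?thesis
        proof (cases "\<exists>K. compact K \<and> {y. d (fst (c k)) y < snd (c k)} \<subseteq> K")
          case True
          then obtain K where K: "compact K" "{y. d (fst (c k)) y < snd (c k)} \<subseteq> K" by blast
          have "y \<in> K" if "y \<in> UNIV - {y. ?g y \<in> U}" for y
          proof -
            have "?g y \<noteq> 0" using that \<open>0 \<in> U\<close> by auto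
            then have "d (fst (c k)) y < snd (c k)" by (auto simp: g_def max_def split: if_splits)
            then show ?thesis using K by auto
          qed
          then have "K \<inter> (UNIV - {y. ?g y \<in> U}) = UNIV - {y. ?g y \<in> U}" by blast
          then show ?thesis using compact_Int_closed[OF K(1) cl] by simp
        next
          case False
          then have "?g y = 0" for y unfolding g_def by (rule if_not_P)
          then show ?thesis using that by simp
        qed
      qed
      then show "openin ?A {x \<in> UNIV. F x k \<in> U}"
        using g_open[OF U] unfolding openA by (simp add: alexandroff_open_def eq F_def)
    qed simp
    then show ?thesis
      unfolding euclidean_product_topology[symmetric] continuous_map_componentwise_UNIV by simp
  qed
  have separate: "\<exists>k. F (Some x) k > 0 \<and> F p k = 0" if "p \<noteq> Some x" for x p
  proof -
    obtain U K where UK: "open U" "compact K" "x \<in> U" "U \<subseteq> K"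
      using lc unfolding locally_compact_space_def by (metis UNIV_I compactin_euclidean_iff open_openin topspace_euclidean)
    then obtain r0 where r0: "r0 > 0" "\<And>y. d x y < r0 \<Longrightarrow> y \<in> U" using open_d by blast
    define r where "r = (case p of None \<Rightarrow> r0 | Some y \<Rightarrow> min r0 (d x y))"
    have r: "r > 0" "r \<le> r0" "\<And>y. p = Some y \<Longrightarrow> r \<le> d x y"
    proof -
      have "0 < d x y" if "p = Some y" for y
        using that \<open>p \<noteq> Some x\<close> d.nonneg[of x y] d.zero[of x y] by (auto simp: less_le)
      then show "r > 0" "r \<le> r0" "\<And>y. p = Some y \<Longrightarrow> r \<le> d x y"
        using r0(1) by (auto simp: r_def split: option.splits)
    qed
    \<comment> \<open>With \<open>d a x < r/4 < q < r/2\<close> the tent at \<open>a\<close> is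
      positive at \<open>x\<close>, its ball stays within distance \<open>r\<close> of
      \<open>x\<close>, and it vanishes at every point at distance at least \<open>r\<close> from
      \<open>x\<close>.\<close>
    obtain a where a: "a \<in> C" "d a x < r / 4" using dense[of "r / 4"] r by auto
    obtain q where q: "q \<in> \<rat>" "r / 4 < q" "q < r / 2" using Rats_dense_in_real[of "r/4" "r/2"] r by auto
    obtain k where k: "c k = (a, q)" using c a q by (metis SigmaI rangeE)
    have "{y. d a y < q} \<subseteq> K"
    proof
      fix y assume "y \<in> {y. d a y < q}"
      then have "d x y < r0" using d.triangle[of x a y] a q r by (simp add: d.commute)
      then show "y \<in> K" using r0 UK by auto
    qed
    then have ex: "\<exists>K. compact K \<and> {y. d a y < q} \<subseteq> K" using UK by blast
    have "F (Some x) k > 0" using ex a q k by (simp add: F_def g_def)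
    moreover have "F p k = 0"
    proof (cases p)
      case (Some y)
      then have "q \<le> d a y" using d.triangle[of x a y] a q r(3)[OF Some] by (simp add: d.commute)
      then show ?thesis using Some k by (simp add: F_def g_def)
    qed (simp add: F_def)
    ultimately show ?thesis by blast
  qed
  have injF: "inj F"
  proof (rule injI, rule ccontr)
    fix p q assume eq: "F p = F q" and "p \<noteq> q"
    then consider x where "p = Some x" "q \<noteq> Some x" | x where "q = Some x" "p \<noteq> Some x"
      by (cases p; cases q) auto
    then show False
    proof cases
      case 1 then show ?thesis using separate[of q x] eq by auto
    next
      case 2 then show ?thesis using separate[of p x] eq by auto
    qed
  qed
  have "closed_map ?A euclidean F"
    by (rule T1_Spaces.continuous_imp_closed_map[OF contF]) (auto intro: metrizable_imp_Hausdorff_space metrizable_space_euclidean)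
  moreover have "inj_on F (topspace ?A)" unfolding topA by (rule injF)
  ultimately have emb: "embedding_map ?A euclidean F"
    by (rule injective_closed_imp_embedding_map[OF contF])
  define D where "D p q = dist (F p) (F q)" for p q
  have D: "Metric_space UNIV D"
    by unfold_locales (auto simp: D_def dist_commute dist_triangle inj_eq[OF injF])
  moreover have "openin (Metric_space.mtopology UNIV D) V \<longleftrightarrow> alexandroff_open V" for V
  proof -
    have hm: "homeomorphic_map ?A (top_of_set (range F)) F"
      using emb unfolding embedding_map_def topA .
    have "alexandroff_open V \<longleftrightarrow> openin (top_of_set (range F)) (F ` V)"
      using homeomorphic_map_openness[OF hm, of V] unfolding openA topA by simp
    also have "\<dots> \<longleftrightarrow> (\<forall>p\<in>V. \<exists>e>0. \<forall>q. dist (F q) (F p) < e \<longrightarrow> q \<in> V)"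
      unfolding openin_euclidean_subtopology_iff by (auto simp: inj_image_mem_iff[OF injF])
    also have "\<dots> \<longleftrightarrow> openin (Metric_space.mtopology UNIV D) V"
      unfolding Metric_space.openin_mtopology[OF D] subset_eq Metric_space.mball_def[OF D]
      by (simp add: D_def dist_commute Ball_def)
    finally show ?thesis ..
  qed
  ultimately show ?thesis by (rule that)
qed

section \<open>A metric of the compactification and its restriction to the space\<close>

locale compactification_metric =
  fixes D :: "'a::topological_space option \<Rightarrow> 'a option \<Rightarrow> real"
  assumes metric: "Metric_space UNIV D"
    and openin_iff: "openin (Metric_space.mtopology UNIV D) V \<longleftrightarrow> alexandroff_open V"
begin

sublocale D: Metric_space UNIV D by (rule metric)

abbreviation d :: "'a \<Rightarrow> 'a \<Rightarrow> real" where "d x y \<equiv> D (Some x) (Some y)"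

lemma alexandroff_mball: "alexandroff_open {q. D p q < r}"
  using openin_iff[of "D.mball p r"] D.openin_mball[of p r] unfolding D.mball_def by simp

lemma open_less: "open {x. D p (Some x) < r}"
  using alexandroff_mball[of p r] by (simp add: alexandroff_open_def vimage_def)

lemma open_greater: "open {x. r < D p (Some x)}"
proof -
  have "openin D.mtopology (UNIV - D.mcball p r)"
    using D.closedin_mcball[of p r] by (simp add: closedin_def)
  then have "open (Some -` (UNIV - D.mcball p r))" unfolding openin_iff alexandroff_open_def by blast
  moreover have "Some -` (UNIV - D.mcball p r) = {x. r < D p (Some x)}"
    by (auto simp: D.mcball_def)
  ultimately show ?thesis by simp
qed

text \<open>The complement of a neighbourhood of infinity. As \<open>r\<close> decreases to 0 these
  sets exhaust the space.\<close>

lemma compact_far: "r > 0 \<Longrightarrow> compact {x. r \<le> D None (Some x)}"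
proof -
  assume "r > 0"
  then have "compact (UNIV - Some -` {q. D None q < r})"
    using alexandroff_mball[of None r] unfolding alexandroff_open_def by simp
  moreover have "UNIV - Some -` {q. D None q < r} = {x. r \<le> D None (Some x)}" by auto
  ultimately show ?thesis by simp
qed

lemma far_pos: "0 < D None (Some x)"
  using D.nonneg[of None "Some x"] by (simp add: less_le)

lemma Metric_space_d: "Metric_space UNIV d"
  by unfold_locales (auto simp: D.commute intro: D.triangle)

lemma compatible_d: "compatible_metric d"
proof -
  interpret d: Metric_space UNIV d by (rule Metric_space_d)
  have "openin d.mtopology U \<longleftrightarrow> open U" for U
  proof
    assume U: "openin d.mtopology U"
    show "open U"
    proof (rule topological_space_class.openI)
      fix x assume "x \<in> U"
      then obtain r where "r > 0" "d.mball x r \<subseteq> U" using U by (auto simp: d.openin_mtopology)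
      then show "\<exists>V. open V \<and> x \<in> V \<and> V \<subseteq> U"
        using open_less[of "Some x" r] by (intro exI[of _ "{y. d x y < r}"]) auto
    qed
  next
    assume U: "open U"
    have "Some -` Some ` U = U" by auto
    then have "openin D.mtopology (Some ` U)" using U by (simp add: openin_iff alexandroff_open_def image_iff)
    then have "\<exists>r>0. D.mball (Some x) r \<subseteq> Some ` U" if "x \<in> U" for x
      using that by (simp add: D.openin_mtopology)
    moreover have "d.mball x r \<subseteq> U" if sub: "D.mball (Some x) r \<subseteq> Some ` U" for x r
    proof
      fix y assume "y \<in> d.mball x r"
      then have "Some y \<in> D.mball (Some x) r" by simp
      then show "y \<in> U" using sub by blast
    qed
    ultimately have "\<exists>r>0. d.mball x r \<subseteq> U" if "x \<in> U" for x
      using that by meson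
    then show "openin d.mtopology U" by (simp add: d.openin_mtopology)
  qed
  then have "d.mtopology = euclidean" by (simp add: topology_eq)
  then show ?thesis by (simp add: compatible_metric_def Metric_space_d)
qed

lemmas open_d_iff = compatible_metric_open_iff[OF compatible_d]

lemma compact_closed: "compact (K :: 'a set) \<Longrightarrow> closed K"
  by (rule Hausdorff_imp_compact_closed[OF compatible_metric_imp_Hausdorff[OF compatible_d]])

text \<open>The ball about infinity leaves only a compact set to cover. The radius may depend on the
  centre, because it will later be chosen to make the bounding sphere null.\<close>

lemma finite_ball_cover:
  assumes "\<And>p. r p > 0"
  obtains P :: "'a option set" where "finite P" "None \<in> P" "\<And>x. \<exists>p\<in>P. D p (Some x) < r p"
proof -
  have "compact {x. r None \<le> D None (Some x)}" (is "compact ?K") using compact_far assms by simp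
  have "x \<in> (\<Union>x\<in>UNIV. {y. d x y < r (Some x)})" for x
    using assms[of "Some x"] by (intro UN_I[of x]) auto
  then have sub: "?K \<subseteq> (\<Union>x\<in>UNIV. {y. d x y < r (Some x)})" by blast
  obtain S where S: "finite S" "?K \<subseteq> (\<Union>x\<in>S. {y. d x y < r (Some x)})"
    by (rule compactE_image[OF \<open>compact ?K\<close> _ sub]) (use open_less in auto)
  show ?thesis
  proof (rule that[of "insert None (Some ` S)"])
    fix x show "\<exists>p\<in>insert None (Some ` S). D p (Some x) < r p"
      using S(2) by (cases "x \<in> ?K") (auto simp: subset_eq)
  qed (use S in auto)
qed

text \<open>Here a metric of the compactification is essential: even a neighbourhood of infinity has
  small diameter, which may fail for an arbitrary compatible metric.\<close>

lemma small_admissible_cover: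
  assumes "e > 0"
  obtains A where "admissible_open_cover A" "finite A" "\<And>a x y. a \<in> A \<Longrightarrow> x \<in> a \<Longrightarrow> y \<in> a \<Longrightarrow> d x y < e"
proof -
  obtain P where P: "finite P" "None \<in> P" "\<And>x. \<exists>p\<in>P. D p (Some x) < e / 2"
    using finite_ball_cover[of "\<lambda>_. e / 2"] assms by auto
  let ?A = "(\<lambda>p. {x. D p (Some x) < e / 2}) ` P"
  have "UNIV - {x. D None (Some x) < e / 2} = {x. e / 2 \<le> D None (Some x)}" by auto
  then have "compact (UNIV - {x. D None (Some x) < e / 2})" using compact_far[of "e/2"] assms by simp
  then have "admissible_open_cover ?A"
    using P open_less[of _ "e / 2"] unfolding admissible_open_cover_def by auto
  moreover have "d x y < e" if h: "a \<in> ?A" "x \<in> a" "y \<in> a" for a x y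
  proof -
    obtain p where "D p (Some x) < e / 2" "D p (Some y) < e / 2" using h by blast
    then show ?thesis using D.triangle[of "Some x" p "Some y"] by (simp add: D.commute)
  qed
  ultimately show ?thesis using P by (intro that[of ?A]) auto
qed

lemma bowen_entropy_d_le: "bowen_entropy d T \<le> top_entropy T"
  by (rule bowen_entropy_le) (metis small_admissible_cover)

lemma countable_nice_base:
  obtains \<B> :: "'a set set" where "countable \<B>" "\<And>b. b \<in> \<B> \<Longrightarrow> open b"
    "\<And>x G. open G \<Longrightarrow> x \<in> G \<Longrightarrow> \<exists>b\<in>\<B>. \<exists>K. compact K \<and> x \<in> b \<and> b \<subseteq> K \<and> K \<subseteq> G"
proof -
  have "\<forall>m::nat. \<exists>A. admissible_open_cover A \<and> finite A \<and> (\<forall>a\<in>A. \<forall>x\<in>a. \<forall>y\<in>a. d x y < 1 / Suc m)"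
    by (metis small_admissible_cover of_nat_0_less_iff zero_less_Suc zero_less_divide_1_iff)
  then obtain A where A: "\<And>m. admissible_open_cover (A m)" "\<And>m. finite (A m)"
      "\<And>m a x y. a \<in> A m \<Longrightarrow> x \<in> a \<Longrightarrow> y \<in> a \<Longrightarrow> d x y < 1 / Suc m" by metis
  show ?thesis
  proof (rule that[of "\<Union>m. A m"])
    show "countable (\<Union>m. A m)" using A(2) by (intro countable_UN) (auto intro: countable_finite)
    show "open b" if "b \<in> (\<Union>m. A m)" for b using that A(1) by (auto simp: admissible_open_cover_def)
    fix x and G :: "'a set" assume G: "open G" "x \<in> G"
    then obtain r where r: "r > 0" "\<And>y. d x y < r \<Longrightarrow> y \<in> G" using open_d_iff by blast
    \<comment> \<open>Staying below the distance to infinity puts the closed ball of radius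
      \<open>s\<close> inside a compact set.\<close>
    define s where "s = min r (D None (Some x)) / 2"
    have s: "s > 0" "s < r" "s < D None (Some x)" using r far_pos[of x] by (auto simp: s_def min_def)
    obtain m where m: "1 / Suc m < s" using s(1) by (metis nat_approx_posE)
    have "\<Union>(A m) = UNIV" using A(1)[of m] by (simp add: admissible_open_cover_def)
    then obtain a where a: "a \<in> A m" "x \<in> a" by blast
    have "closed {y. d x y \<le> s}"
      using open_greater[of s "Some x"] by (simp add: closed_def Compl_eq not_le)
    then have K: "compact ({y. D None (Some x) - s \<le> D None (Some y)} \<inter> {y. d x y \<le> s})" (is "compact ?K")
      using compact_far[of "D None (Some x) - s"] s by (intro compact_Int_closed) auto
    have "a \<subseteq> ?K"
    proof
      fix y assume "y \<in> a"
      then have "d x y < s" using A(3)[OF a, of y] m by simp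
      then show "y \<in> ?K" using D.triangle[of None "Some y" "Some x"] by (simp add: D.commute)
    qed
    moreover have "?K \<subseteq> G" using r s by auto
    ultimately show "\<exists>b\<in>\<Union>m. A m. \<exists>K. compact K \<and> x \<in> b \<and> b \<subseteq> K \<and> K \<subseteq> G"
      using a K by blast
  qed
qed

end

section \<open>Vague limits\<close>

text \<open>Closed under unions yet countable for a countable base: a single subsequence can be made
  to converge on every member.\<close>

definition finite_unions :: "'a set set \<Rightarrow> 'a set set" where
  "finite_unions \<B> = {\<Union>S | S. finite S \<and> S \<subseteq> \<B>}"

lemma finite_unions_empty: "{} \<in> finite_unions \<B>"
  unfolding finite_unions_def by (intro CollectI exI[of _ "{}"]) simp

lemma finite_unions_Un:
  assumes "U \<in> finite_unions \<B>" "V \<in> finite_unions \<B>"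
  shows "U \<union> V \<in> finite_unions \<B>"
proof -
  obtain S S' where "finite S" "S \<subseteq> \<B>" "U = \<Union>S" "finite S'" "S' \<subseteq> \<B>" "V = \<Union>S'"
    using assms unfolding finite_unions_def by blast
  then show ?thesis unfolding finite_unions_def by (intro CollectI exI[of _ "S \<union> S'"]) auto
qed

lemma finite_unions_UN:
  assumes "finite I" "\<And>i. i \<in> I \<Longrightarrow> b i \<in> \<B>"
  shows "(\<Union>i\<in>I. b i) \<in> finite_unions \<B>"
  unfolding finite_unions_def using assms by (intro CollectI exI[of _ "b ` I"]) auto

lemma countable_finite_unions:
  assumes "countable \<B>"
  shows "countable (finite_unions \<B>)"
proof -
  have "finite_unions \<B> = Union ` {S. finite S \<and> S \<subseteq> \<B>}" by (auto simp: finite_unions_def)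
  then show ?thesis using countable_Collect_finite_subset[OF assms] by (simp add: Collect_conj_eq)
qed

locale nice_base =
  fixes \<B> :: "'a::topological_space set set"
  assumes compact_imp_closed: "compact (K :: 'a set) \<Longrightarrow> closed K"
    and base_open: "b \<in> \<B> \<Longrightarrow> open b"
    and base_nice: "open G \<Longrightarrow> x \<in> G \<Longrightarrow> \<exists>b\<in>\<B>. \<exists>K. compact K \<and> x \<in> b \<and> b \<subseteq> K \<and> K \<subseteq> G"
begin

lemma compact_nbhd:
  assumes "compact K" "open G" "K \<subseteq> G"
  obtains U K' where "U \<in> finite_unions \<B>" "open U" "compact K'" "K \<subseteq> U" "U \<subseteq> K'" "K' \<subseteq> G"
proof -
  have "\<forall>x\<in>K. \<exists>b C. b \<in> \<B> \<and> compact C \<and> x \<in> b \<and> b \<subseteq> C \<and> C \<subseteq> G"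
  proof
    fix x assume "x \<in> K"
    then have "x \<in> G" using assms(3) by auto
    from base_nice[OF assms(2) this] show "\<exists>b C. b \<in> \<B> \<and> compact C \<and> x \<in> b \<and> b \<subseteq> C \<and> C \<subseteq> G" by metis
  qed
  then obtain b C where bC: "\<And>x. x \<in> K \<Longrightarrow> b x \<in> \<B> \<and> compact (C x) \<and> x \<in> b x \<and> b x \<subseteq> C x \<and> C x \<subseteq> G"
    by metis
  obtain S where S: "S \<subseteq> K" "finite S" "K \<subseteq> (\<Union>x\<in>S. b x)"
    by (rule compactE_image[OF assms(1), of K b]) (use bC base_open in auto)
  show ?thesis
  proof (rule that[of "\<Union>x\<in>S. b x" "\<Union>x\<in>S. C x"])
    show "(\<Union>x\<in>S. b x) \<in> finite_unions \<B>" using S bC by (intro finite_unions_UN) auto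
    show "open (\<Union>x\<in>S. b x)" using S bC base_open by (intro open_UN) auto
    show "compact (\<Union>x\<in>S. C x)" using S bC by (intro compact_UN) auto
    show "(\<Union>x\<in>S. b x) \<subseteq> (\<Union>x\<in>S. C x)" using S(1) bC by (intro UN_mono) auto
    show "(\<Union>x\<in>S. C x) \<subseteq> G" using S(1) bC by (intro UN_least) auto
  qed (use S in simp)
qed

end

text \<open>\<open>L\<close> stands for the limits of the given measures on the countable family of finite unions of base sets.\<close>

locale vague_content = nice_base \<B> for \<B> :: "'a::topological_space set set" +
  fixes L :: "'a set \<Rightarrow> real"
  assumes L_nonneg: "U \<in> finite_unions \<B> \<Longrightarrow> 0 \<le> L U"
    and L_le_1: "U \<in> finite_unions \<B> \<Longrightarrow> L U \<le> 1"
    and L_empty: "L {} = 0"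
    and L_mono: "U \<in> finite_unions \<B> \<Longrightarrow> V \<in> finite_unions \<B> \<Longrightarrow> U \<subseteq> V \<Longrightarrow> L U \<le> L V"
    and L_subadd: "U \<in> finite_unions \<B> \<Longrightarrow> V \<in> finite_unions \<B> \<Longrightarrow> L (U \<union> V) \<le> L U + L V"
    and L_add: "U \<in> finite_unions \<B> \<Longrightarrow> V \<in> finite_unions \<B> \<Longrightarrow> U \<inter> V = {} \<Longrightarrow> L (U \<union> V) = L U + L V"
begin

text \<open>The intermediate compact set keeps \<open>U\<close> away from the boundary of
  \<open>G\<close> and from infinity. It supplies the compactness for subadditivity of
  \<open>m\<close> and the disjointness for additivity.\<close>

definition inner :: "'a set \<Rightarrow> 'a set set" where
  "inner G = {U \<in> finite_unions \<B>. \<exists>K. compact K \<and> U \<subseteq> K \<and> K \<subseteq> G}"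

definition m :: "'a set \<Rightarrow> ennreal" where
  "m G = (SUP U\<in>inner G. ennreal (L U))"

definition outer :: "'a set \<Rightarrow> ennreal" where
  "outer A = (INF G\<in>{G. open G \<and> A \<subseteq> G}. m G)"

lemma empty_inner: "{} \<in> inner G"
  by (auto simp: inner_def finite_unions_empty intro!: exI[of _ "{}"])

lemma m_mono: "G \<subseteq> H \<Longrightarrow> m G \<le> m H"
  unfolding m_def by (rule SUP_subset_mono) (auto simp: inner_def)

lemma m_le_1: "m G \<le> 1"
  unfolding m_def by (rule SUP_least) (auto simp: inner_def L_le_1)

lemma outer_open: "open G \<Longrightarrow> outer G = m G"
  unfolding outer_def by (rule antisym) (auto intro!: INF_lower2 INF_greatest m_mono)

lemma outer_le_m: "open G \<Longrightarrow> A \<subseteq> G \<Longrightarrow> outer A \<le> m G"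
  unfolding outer_def by (rule INF_lower) simp

lemma outer_le_1: "outer A \<le> 1"
  using outer_le_m[of UNIV A] m_le_1[of UNIV] by auto

lemma outer_mono: "A \<subseteq> B \<Longrightarrow> outer A \<le> outer B"
  unfolding outer_def by (rule INF_superset_mono) auto

lemma outer_approx:
  assumes "e > 0"
  obtains G where "open G" "A \<subseteq> G" "m G < outer A + e"
proof -
  have "outer A \<noteq> top" using outer_le_1[of A] by (auto simp: top_unique)
  then have "outer A < outer A + e" using assms by (simp add: ennreal_add_left_cancel_less less_top)
  then have "\<exists>G\<in>{G. open G \<and> A \<subseteq> G}. m G < outer A + e"
    by (subst (asm) (1) outer_def) (simp only: INF_less_iff)
  then show ?thesis using that by blast
qed

lemma L_UN_le:
  assumes "finite I" "\<And>i. i \<in> I \<Longrightarrow> U i \<in> finite_unions \<B>"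
  shows "(\<Union>i\<in>I. U i) \<in> finite_unions \<B> \<and> L (\<Union>i\<in>I. U i) \<le> (\<Sum>i\<in>I. L (U i))"
  using assms
proof (induction I)
  case empty
  then show ?case by (simp add: L_empty finite_unions_empty)
next
  case (insert i I)
  then have IH: "(\<Union>i\<in>I. U i) \<in> finite_unions \<B>" "L (\<Union>i\<in>I. U i) \<le> (\<Sum>i\<in>I. L (U i))" "U i \<in> finite_unions \<B>" by auto
  then show ?case using L_subadd[OF IH(3,1)] insert finite_unions_Un[OF IH(3,1)] by simp
qed

text \<open>The compact set around \<open>U\<close> is covered by finitely many base sets, each
  relatively compact in some \<open>G i\<close>; grouping them by \<open>i\<close> reduces the claim
  to finite subadditivity of \<open>L\<close>.\<close>

lemma m_UN_le:
  fixes G :: "nat \<Rightarrow> 'a set"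
  assumes "\<And>i. open (G i)"
  shows "m (\<Union>i. G i) \<le> (\<Sum>i. m (G i))"
  unfolding m_def[of "\<Union>i. G i"]
proof (rule SUP_least)
  fix U assume "U \<in> inner (\<Union>i. G i)"
  then obtain K where K: "U \<in> finite_unions \<B>" "compact K" "U \<subseteq> K" "K \<subseteq> (\<Union>i. G i)"
    by (auto simp: inner_def)
  have "\<forall>x\<in>K. \<exists>i b C. b \<in> \<B> \<and> compact C \<and> x \<in> b \<and> b \<subseteq> C \<and> C \<subseteq> G i"
  proof
    fix x assume "x \<in> K"
    then obtain i where "x \<in> G i" using K by blast
    then show "\<exists>i b C. b \<in> \<B> \<and> compact C \<and> x \<in> b \<and> b \<subseteq> C \<and> C \<subseteq> G i"
      using base_nice[OF assms, of x i] by metis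
  qed
  then obtain k b C where bC: "\<And>x. x \<in> K \<Longrightarrow> b x \<in> \<B> \<and> compact (C x) \<and> x \<in> b x \<and> b x \<subseteq> C x \<and> C x \<subseteq> G (k x)"
    by metis
  obtain S where S: "S \<subseteq> K" "finite S" "K \<subseteq> (\<Union>x\<in>S. b x)"
    by (rule compactE_image[OF K(2), of K b]) (use bC base_open in auto)
  define V where "V i = (\<Union>x\<in>{x\<in>S. k x = i}. b x)" for i
  define I where "I = k ` S"
  have fin: "finite I" using S by (simp add: I_def)
  have VF: "V i \<in> finite_unions \<B>" for i
    unfolding V_def using S bC by (intro finite_unions_UN) auto
  have V_inner: "V i \<in> inner (G i)" for i
  proof -
    have "compact (\<Union>x\<in>{x\<in>S. k x = i}. C x)" using S bC by (intro compact_UN) auto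
    moreover have "V i \<subseteq> (\<Union>x\<in>{x\<in>S. k x = i}. C x)" "(\<Union>x\<in>{x\<in>S. k x = i}. C x) \<subseteq> G i"
      unfolding V_def using S(1) bC by (intro UN_mono UN_least; auto)+
    ultimately show ?thesis using VF by (auto simp: inner_def)
  qed
  have "(\<Union>x\<in>S. b x) = (\<Union>i\<in>I. V i)" by (auto simp: I_def V_def)
  then have sub: "U \<subseteq> (\<Union>i\<in>I. V i)" using order_trans[OF K(3) S(3)] by simp
  note LV = L_UN_le[OF fin VF]
  have "L U \<le> (\<Sum>i\<in>I. L (V i))"
    by (rule order_trans[OF L_mono[OF K(1) conjunct1[OF LV] sub] conjunct2[OF LV]])
  then have "ennreal (L U) \<le> ennreal (\<Sum>i\<in>I. L (V i))" by (rule ennreal_leI)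
  also have "\<dots> = (\<Sum>i\<in>I. ennreal (L (V i)))" by (rule sum_ennreal[symmetric]) (rule L_nonneg[OF VF])
  also have "\<dots> \<le> (\<Sum>i\<in>I. m (G i))" unfolding m_def using V_inner by (intro sum_mono SUP_upper)
  also have "\<dots> \<le> (\<Sum>i. m (G i))" by (rule sum_le_suminf) (auto simp: fin)
  finally show "ennreal (L U) \<le> (\<Sum>i. m (G i))" .
qed

lemma outer_countably_subadditive: "outer (\<Union>i. A i) \<le> (\<Sum>i. outer (A i))" for A :: "nat \<Rightarrow> 'a set"
proof (rule ennreal_le_epsilon)
  fix e :: real assume e: "0 < e"
  have "\<exists>G. open G \<and> A i \<subseteq> G \<and> m G < outer (A i) + ennreal e * ennreal ((1/2) ^ Suc i)" for i
    by (rule outer_approx[of "ennreal e * ennreal ((1/2) ^ Suc i)" "A i"])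
       (use e in \<open>auto simp: ennreal_zero_less_mult_iff\<close>)
  then obtain G where G: "\<And>i. open (G i)" "\<And>i. A i \<subseteq> G i" "\<And>i. m (G i) < outer (A i) + ennreal e * ennreal ((1/2) ^ Suc i)"
    by metis
  have "outer (\<Union>i. A i) \<le> m (\<Union>i. G i)" using G by (intro outer_le_m) (auto intro: open_UN)
  also have "\<dots> \<le> (\<Sum>i. m (G i))" by (rule m_UN_le[OF G(1)])
  also have "\<dots> \<le> (\<Sum>i. outer (A i) + ennreal e * ennreal ((1/2) ^ Suc i))"
    by (intro suminf_le less_imp_le[OF G(3)]) auto
  also have "\<dots> = (\<Sum>i. outer (A i)) + ennreal e * (\<Sum>i. ennreal ((1/2) ^ Suc i))"
    by (subst suminf_add[symmetric]) auto
  also have "(\<Sum>i. ennreal ((1/2) ^ Suc i)) = 1"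
    by (subst suminf_ennreal_eq[OF zero_le_power power_half_series]) auto
  finally show "outer (\<Union>i. A i) \<le> (\<Sum>i. outer (A i)) + ennreal e" by simp
qed

lemma outer_empty: "outer {} = 0"
proof -
  have "inner {} = {{}}" by (auto simp: inner_def finite_unions_empty)
  then show ?thesis by (simp add: outer_open m_def L_empty)
qed

lemma outer_measure_space: "outer_measure_space (Pow UNIV) outer"
  unfolding outer_measure_space_def
  by (auto simp: positive_def increasing_def countably_subadditive_def outer_empty outer_mono outer_countably_subadditive)

text \<open>Approximate \<open>G \<inter> H\<close> from inside by \<open>U\<close>, enclosed in a
  compact \<open>K\<close>. Then \<open>H - K\<close> is open and contains \<open>H - G\<close>; an
  approximation \<open>V\<close> of it from inside is disjoint from \<open>U\<close>, so
  \<open>L\<close> adds up inside \<open>H\<close>.\<close>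

lemma open_in_lambda_system:
  assumes G: "open G"
  shows "G \<in> lambda_system UNIV (Pow UNIV) outer"
proof -
  have "outer (G \<inter> A) + outer ((UNIV - G) \<inter> A) = outer A" for A
  proof (rule antisym)
    have "subadditive (Pow UNIV) outer"
      using outer_measure_space
      by (intro ring_of_sets.countably_subadditive_subadditive[OF ring_of_sets_Pow])
         (auto simp: outer_measure_space_def)
    then have "outer ((G \<inter> A) \<union> ((UNIV - G) \<inter> A)) \<le> outer (G \<inter> A) + outer ((UNIV - G) \<inter> A)"
      by (rule subadditiveD) auto
    moreover have "(G \<inter> A) \<union> ((UNIV - G) \<inter> A) = A" by auto
    ultimately show "outer A \<le> outer (G \<inter> A) + outer ((UNIV - G) \<inter> A)" by simp
  next
    show "outer (G \<inter> A) + outer ((UNIV - G) \<inter> A) \<le> outer A"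
      unfolding outer_def[of A]
    proof (rule INF_greatest, clarsimp)
      fix H assume H: "open H" "A \<subseteq> H"
      have "outer (G \<inter> A) + outer ((UNIV - G) \<inter> A) \<le> m (G \<inter> H) + outer (H - G)"
        using G H by (intro add_mono outer_le_m outer_mono) auto
      also have "\<dots> = (SUP U\<in>inner (G \<inter> H). ennreal (L U) + outer (H - G))"
        unfolding m_def using empty_inner by (intro ennreal_SUP_add_left[symmetric]) auto
      also have "\<dots> \<le> m H"
      proof (rule SUP_least)
        fix U assume "U \<in> inner (G \<inter> H)"
        then obtain K where K: "U \<in> finite_unions \<B>" "compact K" "U \<subseteq> K" "K \<subseteq> G \<inter> H"
          by (auto simp: inner_def)
        have oHK: "open (H - K)" by (intro open_Diff H(1) compact_imp_closed K(2))
        have "ennreal (L U) + outer (H - G) \<le> ennreal (L U) + m (H - K)"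
          using K by (intro add_mono outer_le_m oHK) auto
        also have "\<dots> = (SUP V\<in>inner (H - K). ennreal (L V) + ennreal (L U))"
          unfolding m_def using empty_inner by (subst ennreal_SUP_add_left) (auto simp: add.commute)
        also have "\<dots> \<le> m H"
        proof (rule SUP_least)
          fix V assume "V \<in> inner (H - K)"
          then obtain K' where K': "V \<in> finite_unions \<B>" "compact K'" "V \<subseteq> K'" "K' \<subseteq> H - K"
            by (auto simp: inner_def)
          have "compact (K' \<union> K)" using K K' by auto
          then have "V \<union> U \<in> inner H"
            using K K' finite_unions_Un[OF K'(1) K(1)] unfolding inner_def by blast
          moreover have "L (V \<union> U) = L V + L U" using K K' by (intro L_add) auto
          ultimately have "ennreal (L V + L U) \<le> m H" unfolding m_def by (metis SUP_upper)
          then show "ennreal (L V) + ennreal (L U) \<le> m H" using L_nonneg K(1) K'(1) by simp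
        qed
        finally show "ennreal (L U) + outer (H - G) \<le> m H" .
      qed
      finally show "outer (G \<inter> A) + outer ((UNIV - G) \<inter> A) \<le> m H" .
    qed
  qed
  then show ?thesis by (simp add: lambda_system_def)
qed

definition limit_measure :: "'a measure" where
  "limit_measure = measure_of UNIV (sets borel) outer"

lemma sets_limit_measure [simp]: "sets limit_measure = sets borel"
  using sets.space_closed[of borel] sets.sigma_sets_eq[of borel] by (simp add: limit_measure_def)

lemma space_limit_measure [simp]: "space limit_measure = UNIV"
  using sets_eq_imp_space_eq[OF sets_limit_measure] by simp

lemma emeasure_limit_measure:
  assumes "A \<in> sets borel"
  shows "emeasure limit_measure A = outer A"
proof -
  let ?L = "lambda_system UNIV (Pow UNIV) outer"
  have ms: "measure_space UNIV ?L outer"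
    using sigma_algebra.caratheodory_lemma[OF sigma_algebra_Pow outer_measure_space] .
  then have sa: "sigma_algebra UNIV ?L" by (simp add: measure_space_def)
  have "sigma_sets UNIV {S. open S} \<subseteq> ?L"
    by (rule sigma_algebra.sigma_sets_subset[OF sa]) (use open_in_lambda_system in blast)
  then have sub: "sets borel \<subseteq> ?L" by (simp add: borel_def)
  have "measure_space UNIV (sets borel) outer"
    by (rule measure_down[OF ms _ sub]) (use sets.sigma_algebra_axioms[of borel] in simp)
  then show ?thesis
    unfolding limit_measure_def using assms
    by (intro emeasure_measure_of_sigma) (auto simp: measure_space_def)
qed

lemma finite_measure_limit_measure: "finite_measure limit_measure"
proof
  have "emeasure limit_measure UNIV \<le> 1" using outer_le_1 by (simp add: emeasure_limit_measure)
  then show "emeasure limit_measure (space limit_measure) \<noteq> \<infinity>" by (auto simp: top_unique)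
qed

sublocale lim: finite_measure limit_measure by (rule finite_measure_limit_measure)

lemma limit_measure_le_1: "measure limit_measure UNIV \<le> 1"
proof -
  have "ennreal (measure limit_measure UNIV) \<le> ennreal 1"
    using outer_le_1[of UNIV] emeasure_limit_measure[of UNIV] by (simp add: lim.emeasure_eq_measure)
  then show ?thesis by (simp only: ennreal_le_iff)
qed

text \<open>Source of the lower estimate on open sets. The negative case is separate because
  \<open>ennreal\<close> truncates negative reals.\<close>

lemma limit_measure_open:
  assumes "open G" "e > 0"
  shows "measure limit_measure G - e < 0 \<or> (\<exists>U\<in>finite_unions \<B>. U \<subseteq> G \<and> measure limit_measure G - e < L U)"
proof (cases "measure limit_measure G - e < 0")
  case False
  have "ennreal (measure limit_measure G - e) < ennreal (measure limit_measure G)"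
    using False assms by (intro ennreal_lessI) auto
  also have "\<dots> = m G"
    using emeasure_limit_measure[of G] outer_open assms by (simp add: lim.emeasure_eq_measure)
  finally obtain U where U: "U \<in> inner G" "ennreal (measure limit_measure G - e) < ennreal (L U)"
    unfolding m_def less_SUP_iff by blast
  then have "measure limit_measure G - e < L U" using False by (simp add: ennreal_less_iff)
  then show ?thesis using U by (auto simp: inner_def)
qed simp

lemma limit_measure_outer:
  assumes "A \<in> sets borel" "e > 0"
  obtains G where "open G" "A \<subseteq> G" "measure limit_measure G < measure limit_measure A + e"
proof -
  obtain G where G: "open G" "A \<subseteq> G" "m G < outer A + ennreal e"
    by (rule outer_approx[of "ennreal e" A]) (use assms in simp)
  have "ennreal (measure limit_measure G) < ennreal (measure limit_measure A) + ennreal e"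
    using G emeasure_limit_measure[of G] emeasure_limit_measure[OF assms(1)] outer_open[OF G(1)]
    by (simp add: lim.emeasure_eq_measure)
  then have "measure limit_measure G < measure limit_measure A + e"
    using assms by (simp add: ennreal_less_iff flip: ennreal_plus)
  then show ?thesis by (rule that[OF G(1,2)])
qed

text \<open>Source of the upper estimate. Compactness places \<open>K\<close> inside a member of
  \<open>finite_unions\<close> that is itself sandwiched under an open set of nearly the same
  measure; on closed sets such an estimate can fail, as mass may escape.\<close>

lemma limit_measure_compact:
  assumes "compact K" "e > 0"
  obtains U where "U \<in> finite_unions \<B>" "K \<subseteq> U" "L U < measure limit_measure K + e"
proof -
  have "K \<in> sets borel" using compact_imp_closed[OF assms(1)] by simp
  then obtain G where G: "open G" "K \<subseteq> G" "measure limit_measure G < measure limit_measure K + e"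
    by (rule limit_measure_outer[OF _ assms(2)])
  obtain U K' where U: "U \<in> finite_unions \<B>" "compact K'" "K \<subseteq> U" "U \<subseteq> K'" "K' \<subseteq> G"
    by (rule compact_nbhd[OF assms(1) G(1,2)])
  then have "ennreal (L U) \<le> m G" unfolding m_def by (intro SUP_upper) (auto simp: inner_def)
  also have "\<dots> = ennreal (measure limit_measure G)"
    using emeasure_limit_measure[of G] outer_open G by (simp add: lim.emeasure_eq_measure)
  finally have "L U \<le> measure limit_measure G" by simp
  then have "L U < measure limit_measure K + e" using G(3) by simp
  then show ?thesis by (rule that[OF U(1,3)])
qed

end

text \<open>Tychonoff's theorem for the cube, used in place of a diagonal argument.\<close>

lemma bounded_pointwise_subsequence:
  fixes f :: "nat \<Rightarrow> nat \<Rightarrow> real"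
  assumes "\<And>n k. f n k \<in> {0..1}"
  obtains r l where "strict_mono r" "\<And>k. (\<lambda>n. f (r n) k) \<longlonglongrightarrow> l k"
proof -
  have "compactin (product_topology (\<lambda>_::nat. euclideanreal) UNIV) (PiE UNIV (\<lambda>_. {0..1}))"
    by (simp add: compactin_PiE)
  then have "compact (PiE UNIV (\<lambda>_::nat. {0..1::real}))"
    by (simp add: euclidean_product_topology)
  then have "seq_compact (PiE UNIV (\<lambda>_::nat. {0..1::real}))"
    by (rule compact_imp_seq_compact)
  moreover have "f n \<in> PiE UNIV (\<lambda>_. {0..1})" for n using assms by auto
  ultimately obtain l r where "strict_mono r" "(f \<circ> r) \<longlonglongrightarrow> l"
    unfolding seq_compact_def by blast
  moreover from this(2) have "(\<lambda>n. f (r n) k) \<longlonglongrightarrow> l k" for k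
    using continuous_on_tendsto_compose[OF continuous_on_product_coordinates[of k], of "f \<circ> r" l] by (simp add: o_def)
  ultimately show ?thesis using that by blast
qed

context compactification_metric
begin

lemma compact_nbhd:
  assumes "compact (K :: 'a set)" "open G" "K \<subseteq> G"
  obtains U K' where "open U" "compact K'" "K \<subseteq> U" "U \<subseteq> K'" "K' \<subseteq> G"
proof -
  obtain \<B> :: "'a set set" where \<B>: "\<And>b. b \<in> \<B> \<Longrightarrow> open b"
    "\<And>x G. open G \<Longrightarrow> x \<in> G \<Longrightarrow> \<exists>b\<in>\<B>. \<exists>K. compact K \<and> x \<in> b \<and> b \<subseteq> K \<and> K \<subseteq> G"
    using countable_nice_base by metis
  interpret nice_base \<B> by unfold_locales (use \<B> compact_closed in auto)
  show ?thesis by (rule compact_nbhd[OF assms]) (rule that)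
qed

text \<open>Convergence along a subsequence on a countable family of open sets yields a content,
  whose Caratheodory extension is the limit measure. Its mass can fall below 1 when mass leaves
  every compact set.\<close>

lemma vague_limit:
  fixes p :: "nat \<Rightarrow> 'a pmf"
  obtains r \<mu> where "strict_mono r" "sets \<mu> = sets borel" "finite_measure \<mu>" "measure \<mu> UNIV \<le> 1"
    "\<And>G e. open G \<Longrightarrow> e > 0 \<Longrightarrow> \<forall>\<^sub>F n in sequentially. measure \<mu> G - e < measure_pmf.prob (p (r n)) G"
    "\<And>K e. compact K \<Longrightarrow> e > 0 \<Longrightarrow> \<forall>\<^sub>F n in sequentially. measure_pmf.prob (p (r n)) K < measure \<mu> K + e"
    "\<And>A e. A \<in> sets borel \<Longrightarrow> e > 0 \<Longrightarrow> \<exists>G. open G \<and> A \<subseteq> G \<and> measure \<mu> G < measure \<mu> A + e"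
proof -
  obtain \<B> :: "'a set set" where \<B>: "countable \<B>" "\<And>b. b \<in> \<B> \<Longrightarrow> open b"
    "\<And>x G. open G \<Longrightarrow> x \<in> G \<Longrightarrow> \<exists>b\<in>\<B>. \<exists>K. compact K \<and> x \<in> b \<and> b \<subseteq> K \<and> K \<subseteq> G"
    using countable_nice_base by metis
  define u where "u = from_nat_into (finite_unions \<B>)"
  have "range u = finite_unions \<B>"
    unfolding u_def using countable_finite_unions[OF \<B>(1)] finite_unions_empty by (intro range_from_nat_into) auto
  obtain l r where r: "strict_mono r" "\<And>k. (\<lambda>n. measure_pmf.prob (p (r n)) (u k)) \<longlonglongrightarrow> l k"
    using bounded_pointwise_subsequence[of "\<lambda>n k. measure_pmf.prob (p n) (u k)"] by auto
  define L where "L U = lim (\<lambda>n. measure_pmf.prob (p (r n)) U)" for U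
  have L: "(\<lambda>n. measure_pmf.prob (p (r n)) U) \<longlonglongrightarrow> L U" if U: "U \<in> finite_unions \<B>" for U
  proof -
    obtain k where "U = u k" using U \<open>range u = _\<close> by blast
    then show ?thesis using r(2)[of k] unfolding L_def by (simp add: limI)
  qed
  interpret vague_content \<B> L
  proof
    show "L {} = 0" using LIMSEQ_unique[OF L[OF finite_unions_empty]] by simp
    fix U assume U: "U \<in> finite_unions \<B>"
    show "0 \<le> L U" by (rule LIMSEQ_le_const[OF L[OF U]]) simp
    show "L U \<le> 1" by (rule LIMSEQ_le_const2[OF L[OF U]]) simp
    fix V assume V: "V \<in> finite_unions \<B>"
    show "U \<subseteq> V \<Longrightarrow> L U \<le> L V"
      by (rule LIMSEQ_le[OF L[OF U] L[OF V]]) (auto intro!: measure_pmf.finite_measure_mono)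
    show "L (U \<union> V) \<le> L U + L V"
      by (rule LIMSEQ_le[OF L[OF finite_unions_Un[OF U V]] tendsto_add[OF L[OF U] L[OF V]]])
         (auto intro!: measure_Un_le)
    show "L (U \<union> V) = L U + L V" if UV: "U \<inter> V = {}"
    proof (rule LIMSEQ_unique[OF L[OF finite_unions_Un[OF U V]]])
      have "measure_pmf.prob (p (r n)) (U \<union> V) = measure_pmf.prob (p (r n)) U + measure_pmf.prob (p (r n)) V" for n
        using UV by (intro measure_pmf.finite_measure_Union) auto
      then show "(\<lambda>n. measure_pmf.prob (p (r n)) (U \<union> V)) \<longlonglongrightarrow> L U + L V"
        using tendsto_add[OF L[OF U] L[OF V]] by simp
    qed
  qed (use \<B> compact_closed in auto)
  show ?thesis
  proof (rule that[of r limit_measure])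
    show "measure limit_measure UNIV \<le> 1" by (rule limit_measure_le_1)
    fix e :: real assume e: "e > 0"
    show "\<forall>\<^sub>F n in sequentially. measure limit_measure G - e < measure_pmf.prob (p (r n)) G" if G: "open G" for G
    proof -
      consider "measure limit_measure G - e < 0"
        | U where "U \<in> finite_unions \<B>" "U \<subseteq> G" "measure limit_measure G - e < L U"
        using limit_measure_open[OF G e] by blast
      then show ?thesis
      proof cases
        case 1
        then have "measure limit_measure G - e < measure_pmf.prob (p (r n)) G" for n
          using measure_nonneg[of "p (r n)" G] by linarith
        then show ?thesis by simp
      next
        case 2
        have "\<forall>\<^sub>F n in sequentially. measure limit_measure G - e < measure_pmf.prob (p (r n)) U"
          by (rule order_tendstoD(1)[OF L[OF 2(1)] 2(3)])
        then show ?thesis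
          by (rule eventually_mono) (rule less_le_trans, assumption, rule measure_pmf.finite_measure_mono, use 2 in auto)
      qed
    qed
    show "\<forall>\<^sub>F n in sequentially. measure_pmf.prob (p (r n)) K < measure limit_measure K + e" if K: "compact K" for K
    proof -
      obtain U where U: "U \<in> finite_unions \<B>" "K \<subseteq> U" "L U < measure limit_measure K + e"
        using limit_measure_compact[OF K e] .
      have "\<forall>\<^sub>F n in sequentially. measure_pmf.prob (p (r n)) U < measure limit_measure K + e"
        by (rule order_tendstoD(2)[OF L[OF U(1)] U(3)])
      then show ?thesis
        by (rule eventually_mono) (rule le_less_trans[rotated], assumption, rule measure_pmf.finite_measure_mono, use U in auto)
    qed
    show "\<exists>G. open G \<and> A \<subseteq> G \<and> measure limit_measure G < measure limit_measure A + e" if "A \<in> sets borel" for A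
      using limit_measure_outer[OF that e] by metis
  qed (use r finite_measure_limit_measure in auto)
qed

end

section \<open>Separated sets and orbit measures\<close>

text \<open>A small ball either lies in the member \<open>a0\<close> with compact complement, or
  meets that complement, which finitely many balls cover. No global compactness enters.\<close>

lemma lebesgue_number:
  assumes d: "compatible_metric d" and A: "admissible_open_cover A"
  obtains \<delta> where "\<delta> > 0" "\<And>x. \<exists>a\<in>A. \<forall>y. d x y < \<delta> \<longrightarrow> y \<in> a"
proof -
  interpret d: Metric_space UNIV d using d by (simp add: compatible_metric_def)
  note open_iff = compatible_metric_open_iff[OF d]
  obtain a0 where a0: "a0 \<in> A" "compact (UNIV - a0)" and A': "\<And>b. b \<in> A \<Longrightarrow> open b" "\<Union>A = UNIV"
    using A unfolding admissible_open_cover_def by blast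
  \<comment> \<open>The factor 3: a point \<open>w\<close> is reached from \<open>z\<close> through
    \<open>y\<close> and \<open>x\<close>, at cost less than
    \<open>r z + \<delta> + \<delta>\<close> with \<open>\<delta> <= r z\<close>.\<close>
  have "\<exists>r a. r > 0 \<and> a \<in> A \<and> (\<forall>y. d z y < 3 * r \<longrightarrow> y \<in> a)" for z
  proof -
    obtain a where a: "a \<in> A" "z \<in> a" using A'(2) by blast
    then obtain s where s: "s > 0" "\<forall>y. d z y < s \<longrightarrow> y \<in> a" using A'(1) open_iff by blast
    then show ?thesis using a by (intro exI[of _ "s / 3"] exI[of _ a]) simp
  qed
  then obtain r a where ra: "\<And>z. r z > 0" "\<And>z. a z \<in> A" "\<And>z y. d z y < 3 * r z \<Longrightarrow> y \<in> a z" by metis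
  have cov: "UNIV - a0 \<subseteq> (\<Union>z\<in>UNIV. {y. d z y < r z})"
  proof
    fix x show "x \<in> (\<Union>z\<in>UNIV. {y. d z y < r z})" using ra(1)[of x] by (intro UN_I[of x]) auto
  qed
  obtain S where S: "finite S" "UNIV - a0 \<subseteq> (\<Union>z\<in>S. {y. d z y < r z})"
    by (rule compactE_image[OF a0(2) _ cov]) (use compatible_metric_open_ball[OF d] in auto)
  define \<delta> where "\<delta> = Min (insert 1 (r ` S))"
  have \<delta>: "\<delta> > 0" "\<And>z. z \<in> S \<Longrightarrow> \<delta> \<le> r z"
    using S ra by (auto simp: \<delta>_def)
  show ?thesis
  proof (rule that[OF \<delta>(1)])
    fix x
    show "\<exists>a\<in>A. \<forall>y. d x y < \<delta> \<longrightarrow> y \<in> a"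
    proof (cases "\<forall>y. d x y < \<delta> \<longrightarrow> y \<in> a0")
      case False
      then obtain y where y: "d x y < \<delta>" "y \<in> UNIV - a0" by blast
      then obtain z where z: "z \<in> S" "d z y < r z" using S(2) by blast
      have "w \<in> a z" if "d x w < \<delta>" for w
      proof (rule ra(3))
        have "d z w \<le> d z y + (d y x + d x w)"
          using d.triangle[of z y w] d.triangle[of y x w] by simp
        also have "\<dots> < 3 * r z" using z y(1) that \<delta>(2)[OF z(1)] by (simp add: d.commute)
        finally show "d z w < 3 * r z" .
      qed
      then show ?thesis using ra(2) by blast
    qed (use a0 in blast)
  qed
qed

text \<open>A separated set of maximal size is spanning, and balls inside members of
  \<open>A\<close> turn it into a subcover of the iterate. A maximum exists because the words of the
  fine labelling \<open>f\<close> distinguish separated points, which bounds the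
  cardinality.\<close>

lemma ex_separated_spanning:
  fixes d :: "'a \<Rightarrow> 'a \<Rightarrow> real"
  assumes leb: "\<And>x. \<exists>a\<in>A. \<forall>y. d x y < \<delta> \<longrightarrow> y \<in> a"
    and d0: "\<And>x. d x x < \<delta>" and sym: "\<And>x y. d x y = d y x"
    and f: "finite (range f)" "\<And>x y. f x = f y \<Longrightarrow> d x y < \<delta>" and n: "n \<ge> 1"
  obtains E where "finite E" "E \<noteq> {}"
    "\<And>x y. x \<in> E \<Longrightarrow> y \<in> E \<Longrightarrow> x \<noteq> y \<Longrightarrow> \<exists>j<n. \<delta> \<le> d ((T ^^ j) x) ((T ^^ j) y)"
    "N_cover (cover_iter T A n) \<le> card E"
proof -
  define sep where "sep E \<longleftrightarrow> (\<forall>x\<in>E. \<forall>y\<in>E. x \<noteq> y \<longrightarrow> (\<exists>j<n. \<delta> \<le> d ((T ^^ j) x) ((T ^^ j) y)))" for E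
  have fin: "finite E \<and> card E \<le> card (range (itinerary f T n))" if S: "sep E" for E
  proof -
    have inj: "inj_on (itinerary f T n) E"
    proof (rule inj_onI, rule ccontr)
      fix x y assume *: "x \<in> E" "y \<in> E" "itinerary f T n x = itinerary f T n y" "x \<noteq> y"
      then obtain j where "j < n" "\<delta> \<le> d ((T ^^ j) x) ((T ^^ j) y)" using S unfolding sep_def by blast
      moreover have "d ((T ^^ j) x) ((T ^^ j) y) < \<delta>"
        using *(3) \<open>j < n\<close> by (intro f(2)) (simp add: itinerary_eq_iff)
      ultimately show False by simp
    qed
    have fr: "finite (range (itinerary f T n))" by (rule finite_range_itinerary[OF f(1)])
    have "finite (itinerary f T n ` E)" by (rule finite_subset[OF _ fr]) auto
    then have "finite E" using inj by (rule finite_imageD)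
    then show ?thesis using card_inj_on_le[OF inj _ fr] by auto
  qed
  have "sep {}" by (simp add: sep_def)
  moreover have "\<forall>E. sep E \<longrightarrow> card E < Suc (card (range (itinerary f T n)))" using fin by (simp add: less_Suc_eq_le)
  ultimately have "\<exists>E. sep E \<and> (\<forall>E'. sep E' \<longrightarrow> card E' \<le> card E)" by (rule ex_has_greatest_nat)
  then obtain E where E: "sep E" "\<And>E'. sep E' \<Longrightarrow> card E' \<le> card E" by blast
  have span: "\<exists>x\<in>E. \<forall>j<n. d ((T ^^ j) x) ((T ^^ j) y) < \<delta>" for y
  proof (cases "y \<in> E")
    case True
    then show ?thesis using d0 by blast
  next
    case False
    show ?thesis
    proof (rule ccontr)
      assume "\<not> ?thesis"
      then have *: "\<exists>j<n. \<delta> \<le> d ((T ^^ j) x) ((T ^^ j) y)" if "x \<in> E" for x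
        using that by (auto simp: not_less)
      then have "sep (insert y E)"
        using E(1) unfolding sep_def by (metis insert_iff sym)
      then have "card (insert y E) \<le> card E" by (rule E(2))
      then show False using False fin[OF E(1)] by simp
    qed
  qed
  obtain a where a: "\<And>x. a x \<in> A" "\<And>x y. d x y < \<delta> \<Longrightarrow> y \<in> a x" using leb by metis
  define W where "W x = (\<Inter>j<n. (T ^^ j) -` a ((T ^^ j) x))" for x
  have "N_cover (cover_iter T A n) \<le> card (W ` E)"
    unfolding N_cover_def
  proof (rule N_on_le)
    show "W ` E \<subseteq> cover_iter T A n"
    proof
      fix w assume "w \<in> W ` E"
      then obtain x where w: "w = W x" by blast
      show "w \<in> cover_iter T A n"
        unfolding w W_def by (rule cover_iter_memI[of _ _ _ x]) (use a d0 in auto)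
    qed
    show "UNIV \<subseteq> \<Union> (W ` E)"
    proof
      fix y
      obtain x where "x \<in> E" "\<forall>j<n. d ((T ^^ j) x) ((T ^^ j) y) < \<delta>" using span by blast
      then have "y \<in> W x" using a(2) by (auto simp: W_def)
      then show "y \<in> \<Union> (W ` E)" using \<open>x \<in> E\<close> by blast
    qed
  qed (use fin[OF E(1)] in simp)
  also have "\<dots> \<le> card E" by (rule card_image_le) (use fin[OF E(1)] in simp)
  finally have N: "N_cover (cover_iter T A n) \<le> card E" .
  show ?thesis
  proof (rule that[of E])
    show "E \<noteq> {}" using span by blast
  qed (use fin[OF E(1)] E(1) N sep_def in auto)
qed

text \<open>\<open>Y\<close> is a function of the joint variable of the family, which is encoded as
  an extensional function so that the index set can grow one element at a time.\<close>

lemma (in prob_space) shannon_le_sum: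
  assumes "finite J" "\<And>j. j \<in> J \<Longrightarrow> simple_function M (X j)"
    and det: "\<And>x y. x \<in> space M \<Longrightarrow> y \<in> space M \<Longrightarrow> (\<And>j. j \<in> J \<Longrightarrow> X j x = X j y) \<Longrightarrow> Y x = Y y"
  shows "shannon M Y \<le> (\<Sum>j\<in>J. shannon M (X j))"
proof -
  define W where "W J x = restrict (\<lambda>j. X j x) J" for J x
  have W: "simple_function M (W J) \<and> shannon M (W J) \<le> (\<Sum>j\<in>J. shannon M (X j))"
    using assms(1,2)
  proof (induction J)
    case empty
    have "W {} = (\<lambda>x. \<lambda>j. undefined)" by (simp add: W_def fun_eq_iff)
    then show ?case by (simp add: shannon_const)
  next
    case (insert i J)
    then have IH: "simple_function M (W J)" "shannon M (W J) \<le> (\<Sum>j\<in>J. shannon M (X j))" "simple_function M (X i)" by auto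
    note p = simple_function_Pair[OF IH(3,1)]
    have eq: "W (insert i J) = (\<lambda>x. (\<lambda>(a, w). w(i := a)) (X i x, W J x))"
      by (auto simp: W_def fun_eq_iff)
    have "simple_function M (W (insert i J))"
      unfolding eq using simple_function_compose[OF p, of "\<lambda>(a, w). w(i := a)"] by (simp add: o_def)
    moreover have "shannon M (W (insert i J)) \<le> shannon M (\<lambda>x. (X i x, W J x))"
      unfolding eq by (rule shannon_comp_le[OF p])
    ultimately show ?case using shannon_pair_le[OF IH(3,1)] IH(2) insert by simp
  qed
  define h where "h w = Y (SOME x. x \<in> space M \<and> W J x = w)" for w
  have Y: "Y x = h (W J x)" if "x \<in> space M" for x
    unfolding h_def
  proof (rule someI2[of _ x])
    fix y assume y: "y \<in> space M \<and> W J y = W J x"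
    show "Y x = Y y"
    proof (rule det)
      fix j assume "j \<in> J"
      then show "X j x = X j y" using y by (metis W_def restrict_apply')
    qed (use that y in auto)
  qed (use that in simp)
  have "shannon M Y = shannon M (\<lambda>x. h (W J x))"
  proof -
    have "Y ` space M = (\<lambda>x. h (W J x)) ` space M" using Y by auto
    moreover have "Y -` {l} \<inter> space M = (\<lambda>x. h (W J x)) -` {l} \<inter> space M" for l using Y by auto
    ultimately show ?thesis unfolding shannon_def by simp
  qed
  also have "\<dots> \<le> shannon M (W J)" by (rule shannon_comp_le) (use W in simp)
  finally show ?thesis using W by simp
qed

lemma simple_function_pmf: "finite (range X) \<Longrightarrow> simple_function (measure_pmf p) X"
  by (simp add: simple_function_def)

lemma shannon_pmf_of_set_inj:
  assumes "finite E" "E \<noteq> {}" "inj_on X E" "finite (range X)"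
  shows "shannon (measure_pmf (pmf_of_set E)) X = ln (card E)"
proof -
  have "measure_pmf.prob (pmf_of_set E) (X -` {l}) = (if l \<in> X ` E then 1 / card E else 0)" for l
  proof (cases "l \<in> X ` E")
    case True
    then obtain x where "x \<in> E" "l = X x" by blast
    then have "E \<inter> X -` {l} = {x}" using assms(3) by (auto simp: inj_on_def)
    then show ?thesis using True assms by (simp add: measure_pmf_of_set)
  next
    case False
    then have "E \<inter> X -` {l} = {}" by auto
    then show ?thesis using False assms by (simp add: measure_pmf_of_set)
  qed
  then have "shannon (measure_pmf (pmf_of_set E)) X
      = - (\<Sum>l\<in>range X. if l \<in> X ` E then 1 / card E * ln (1 / card E) else 0)"
    by (auto simp: shannon_def intro!: sum.cong)
  also have "\<dots> = - (\<Sum>l\<in>X ` E. 1 / card E * ln (1 / card E))"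
    using assms(4) by (subst sum.inter_restrict[symmetric]) (auto simp: Int_absorb1 image_mono)
  also have "\<dots> = ln (card E)"
    using assms by (simp add: card_image ln_div)
  finally show ?thesis .
qed

text \<open>Misiurewicz's window argument. As \<open>p\<close> is not invariant, windows at
  different times keep different entropies; summing over the residues of starting times mod
  \<open>q\<close> uses each window once. Every residue pays at most
  \<open>q * ln (card (range f))\<close> for the initial window, hence the square. Windows running
  past time \<open>n\<close> only add information.\<close>

lemma shannon_pmf_itinerary_le:
  assumes f: "finite (range f)" and q: "q \<ge> 1"
  shows "real q * shannon (measure_pmf p) (itinerary f T n)
    \<le> (real q)\<^sup>2 * ln (card (range f)) + (\<Sum>t<n. shannon (measure_pmf p) (\<lambda>x. itinerary f T q ((T ^^ t) x)))"
proof -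
  let ?H = "\<lambda>X. shannon (measure_pmf p) X"
  have fr: "finite (range (\<lambda>x. itinerary f T m ((T ^^ t) x)))" for m t
    by (rule finite_subset[OF _ finite_range_itinerary[OF f, of T m]]) auto
  define X where "X t x = itinerary f T q ((T ^^ t) x)" for t x
  have sX: "simple_function (measure_pmf p) (X t)" for t
    using fr[of q t] by (intro simple_function_pmf) (simp add: X_def[abs_def])
  have X0: "?H (X 0) \<le> real q * ln (card (range f))"
  proof -
    have "0 < card (range (X 0))" using simple_functionD(1)[OF sX[of 0]] by (simp add: card_gt_0_iff)
    moreover have "card (range (X 0)) \<le> card (range f) ^ q"
      using card_range_itinerary_le[OF f, of T q] by (simp add: X_def[abs_def])
    ultimately have "ln (card (range (X 0))) \<le> ln (real (card (range f) ^ q))"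
      by (intro ln_mono of_nat_mono) simp_all
    moreover have "card (range f) > 0" using f by (simp add: card_gt_0_iff)
    ultimately show ?thesis
      using prob_space.shannon_le_ln_card[OF prob_space_measure_pmf sX[of 0]] by (simp add: ln_realpow)
  qed
  have one: "?H (itinerary f T n) \<le> real q * ln (card (range f)) + (\<Sum>t\<in>{t. t < n \<and> t mod q = r}. ?H (X t))"
    if r: "r < q" for r
  proof -
    let ?J = "{t. t < n \<and> t mod q = r}"
    \<comment> \<open>The windows of length \<open>q\<close> starting at times congruent to \<open>r\<close> cover every time from \<open>r\<close> on;
      the window at \<open>0\<close> covers the earlier ones.\<close>
    have "?H (itinerary f T n) \<le> (\<Sum>t\<in>insert 0 ?J. ?H (X t))"
    proof (rule prob_space.shannon_le_sum[OF prob_space_measure_pmf])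
      fix x y assume xy: "\<And>t. t \<in> insert 0 ?J \<Longrightarrow> X t x = X t y"
      show "itinerary f T n x = itinerary f T n y"
        unfolding itinerary_eq_iff
      proof (intro allI impI)
        fix s assume s: "s < n"
        have "\<exists>t\<in>insert 0 ?J. t \<le> s \<and> s - t < q"
        proof (cases "s < r")
          case False
          obtain k l where kl: "k = (s - r) mod q" "l = (s - r) div q * q" by blast
          then have "s - r = l + k" by simp
          then have "s = r + l + k" using False by linarith
          moreover have "(r + l) mod q = r" using r kl by simp
          moreover have "k < q" using q kl by simp
          ultimately show ?thesis using s by (intro bexI[of _ "r + l"]) auto
        qed (use r in auto)
        then obtain t where t: "t \<in> insert 0 ?J" "t \<le> s" "s - t < q" by blast
        have "f ((T ^^ (s - t)) ((T ^^ t) x)) = f ((T ^^ (s - t)) ((T ^^ t) y))"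
          using xy[OF t(1)] t(3) unfolding X_def by (simp add: itinerary_eq_iff)
        moreover have "(T ^^ (s - t)) ((T ^^ t) z) = (T ^^ s) z" for z
          using t(2) by (metis comp_apply funpow_add le_add_diff_inverse2)
        ultimately show "f ((T ^^ s) x) = f ((T ^^ s) y)" by simp
      qed
    qed (use sX in auto)
    also have "\<dots> \<le> ?H (X 0) + (\<Sum>t\<in>?J. ?H (X t))"
      using prob_space.shannon_nonneg[OF prob_space_measure_pmf, of p "X 0"]
      by (cases "0 \<in> ?J") (auto simp: insert_absorb sum.insert)
    finally show ?thesis using X0 by linarith
  qed
  have "real q * ?H (itinerary f T n) = (\<Sum>r<q. ?H (itinerary f T n))" by simp
  also have "\<dots> \<le> (\<Sum>r<q. real q * ln (card (range f)) + (\<Sum>t\<in>{t. t < n \<and> t mod q = r}. ?H (X t)))"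
    by (rule sum_mono) (use one in auto)
  also have "\<dots> = (real q)\<^sup>2 * ln (card (range f)) + (\<Sum>r<q. \<Sum>t\<in>{t\<in>{..<n}. t mod q = r}. ?H (X t))"
    by (simp add: sum.distrib power2_eq_square)
  also have "(\<Sum>r<q. \<Sum>t\<in>{t\<in>{..<n}. t mod q = r}. ?H (X t)) = (\<Sum>t<n. ?H (X t))"
    by (rule sum.group) (use q in auto)
  finally show ?thesis by (simp add: X_def[abs_def])
qed

section \<open>The function x ln x and averages along orbits\<close>

lemma xlnx_superadd:
  fixes a b :: real
  assumes "a \<ge> 0" "b \<ge> 0"
  shows "a * ln a + b * ln b \<le> (a + b) * ln (a + b)"
proof -
  have "x * ln x \<le> x * ln (a + b)" if "x \<ge> 0" "x \<le> a + b" for x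
    using that by (cases "x = 0") (auto intro!: mult_left_mono)
  from this[of a] this[of b] show ?thesis using assms by (simp add: algebra_simps)
qed

lemma xlnx_ge: "- (x * ln x) \<le> 1" if "x \<ge> 0" for x :: real
proof (cases "x = 0")
  case False
  then have x: "x > 0" using that by simp
  have "ln (1 / x) \<le> 1 / x - 1" using x by (intro ln_le_minus_one) simp
  then have "x * ln (1 / x) \<le> x * (1 / x - 1)" using x by (intro mult_left_mono) auto
  then show ?thesis using x by (simp add: ln_div algebra_simps)
qed simp

text \<open>Jensen's inequality for the concave function \<open>- x * ln x\<close>, proved by
  summing its tangent-line bound at the average \<open>a\<close>; the linear terms cancel.\<close>

lemma sum_xlnx_average:
  fixes p :: "'b \<Rightarrow> real"
  assumes "finite I" "I \<noteq> {}" "\<And>t. t \<in> I \<Longrightarrow> p t \<ge> 0"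
  shows "(\<Sum>t\<in>I. - (p t * ln (p t))) \<le> - real (card I) * ((sum p I / card I) * ln (sum p I / card I))"
proof -
  have n: "real (card I) > 0" using assms by (simp add: card_gt_0_iff)
  define a where "a = sum p I / card I"
  have a0: "a \<ge> 0" unfolding a_def by (intro divide_nonneg_nonneg sum_nonneg assms) simp_all
  have trm: "- (p t * ln (p t)) \<le> - p t * ln a + (a - p t)" if t: "t \<in> I" for t
  proof (cases "p t = 0")
    case False
    then have pt: "p t > 0" using assms(3)[OF t] by simp
    have "p t \<le> sum p I" using assms t by (intro member_le_sum) auto
    then have "sum p I > 0" using pt by linarith
    then have "a > 0" using n by (simp add: a_def)
    then have "ln (a / p t) \<le> a / p t - 1" using pt by (intro ln_le_minus_one) simp
    then have "p t * ln (a / p t) \<le> p t * (a / p t - 1)" using pt by simp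
    then show ?thesis using pt \<open>a > 0\<close> by (simp add: ln_div algebra_simps)
  qed (use a0 in simp)
  have "(\<Sum>t\<in>I. - (p t * ln (p t))) \<le> (\<Sum>t\<in>I. - p t * ln a + (a - p t))"
    by (rule sum_mono) (use trm in auto)
  also have "\<dots> = - sum p I * ln a + (real (card I) * a - sum p I)"
    by (simp add: sum.distrib sum_subtractf sum_distrib_right sum_negf)
  also have "\<dots> = - real (card I) * (a * ln a)"
    using n by (simp add: a_def)
  finally show ?thesis by (simp add: a_def)
qed

text \<open>The average over \<open>t < n\<close> of the images under \<open>T ^^ t\<close> of the
  uniform distribution on \<open>E\<close>, written as the image of the uniform distribution on
  pairs of time and starting point.\<close>

definition orbit_pmf :: "('a \<Rightarrow> 'a) \<Rightarrow> nat \<Rightarrow> 'a set \<Rightarrow> 'a pmf" where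
  "orbit_pmf T n E = map_pmf (\<lambda>(t, x). (T ^^ t) x) (pmf_of_set ({..<n} \<times> E))"

lemma prob_orbit_pmf:
  assumes "finite E" "E \<noteq> {}" "n \<ge> 1"
  shows "measure_pmf.prob (orbit_pmf T n E) S = (\<Sum>t<n. measure_pmf.prob (pmf_of_set E) ((T ^^ t) -` S)) / n"
proof -
  have "{..<n} \<noteq> {}" using assms(3) by (simp add: lessThan_empty_iff)
  then have ne: "{..<n} \<times> E \<noteq> {}" "finite ({..<n} \<times> E)" using assms by auto
  have eq: "({..<n} \<times> E) \<inter> (\<lambda>(t, x). (T ^^ t) x) -` S = (SIGMA t:{..<n}. E \<inter> (T ^^ t) -` S)" by auto
  have "measure_pmf.prob (orbit_pmf T n E) S = card (SIGMA t:{..<n}. E \<inter> (T ^^ t) -` S) / card ({..<n} \<times> E)"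
    unfolding orbit_pmf_def measure_map_pmf measure_pmf_of_set[OF ne] eq ..
  also have "\<dots> = (\<Sum>t<n. real (card (E \<inter> (T ^^ t) -` S))) / (n * card E)"
    using assms by (subst card_SigmaI) (auto simp: card_cartesian_product)
  also have "\<dots> = (\<Sum>t<n. real (card (E \<inter> (T ^^ t) -` S)) / card E) / n"
    by (simp add: sum_divide_distrib mult.commute)
  finally show ?thesis using assms by (simp add: measure_pmf_of_set)
qed

text \<open>Pulling back by \<open>T\<close> shifts the time average by one step, so all but two
  terms cancel.\<close>

lemma prob_orbit_pmf_vimage:
  assumes "finite E" "E \<noteq> {}" "n \<ge> 1"
  shows "\<bar>measure_pmf.prob (orbit_pmf T n E) (T -` S) - measure_pmf.prob (orbit_pmf T n E) S\<bar> \<le> 1 / n"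
proof -
  define g where "g t = measure_pmf.prob (pmf_of_set E) ((T ^^ t) -` S)" for t
  have "(T ^^ t) -` (T -` S) = (T ^^ Suc t) -` S" for t by auto
  then have "measure_pmf.prob (orbit_pmf T n E) (T -` S) - measure_pmf.prob (orbit_pmf T n E) S
      = (\<Sum>t<n. g (Suc t)) / n - (\<Sum>t<n. g t) / n"
    by (simp only: prob_orbit_pmf[OF assms] g_def)
  also have "\<dots> = (g n - g 0) / n"
    by (simp add: diff_divide_distrib[symmetric] sum_subtractf[symmetric] sum_lessThan_telescope)
  finally have eq: "measure_pmf.prob (orbit_pmf T n E) (T -` S) - measure_pmf.prob (orbit_pmf T n E) S = (g n - g 0) / n" .
  have "0 \<le> g t" "g t \<le> 1" for t by (auto simp: g_def)
  then have "\<bar>g n - g 0\<bar> \<le> 1" by (smt (verit))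
  then show ?thesis unfolding eq by (simp add: abs_divide divide_right_mono)
qed

text \<open>Injectivity makes the word entropy of the uniform distribution on \<open>E\<close> equal
  to \<open>ln (card E)\<close>; the window bound splits it, and concavity moves the time average
  inside the entropy.\<close>

lemma ln_card_le_shannon_orbit_pmf:
  assumes E: "finite E" "E \<noteq> {}" "n \<ge> 1" and f: "finite (range f)" and q: "q \<ge> 1"
    and inj: "inj_on (itinerary f T n) E"
  shows "real q * ln (card E) \<le> (real q)\<^sup>2 * ln (card (range f))
    + real n * shannon (measure_pmf (orbit_pmf T n E)) (itinerary f T q)"
proof -
  let ?g = "itinerary f T q"
  let ?p = "\<lambda>t l. measure_pmf.prob (pmf_of_set E) ((T ^^ t) -` (?g -` {l}))"
  have fr: "finite (range ?g)" by (rule finite_range_itinerary[OF f])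
  have H: "shannon (measure_pmf (pmf_of_set E)) (\<lambda>x. ?g ((T ^^ t) x)) = (\<Sum>l\<in>range ?g. - (?p t l * ln (?p t l)))" for t
    by (subst prob_space.shannon_superset[OF prob_space_measure_pmf fr]) (auto simp: sum_negf vimage_def)
  have "real q * ln (card E) = real q * shannon (measure_pmf (pmf_of_set E)) (itinerary f T n)"
    using shannon_pmf_of_set_inj[OF E(1,2) inj finite_range_itinerary[OF f]] by simp
  also have "\<dots> \<le> (real q)\<^sup>2 * ln (card (range f)) + (\<Sum>t<n. shannon (measure_pmf (pmf_of_set E)) (\<lambda>x. ?g ((T ^^ t) x)))"
    by (rule shannon_pmf_itinerary_le[OF f q])
  also have "(\<Sum>t<n. shannon (measure_pmf (pmf_of_set E)) (\<lambda>x. ?g ((T ^^ t) x)))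
      = (\<Sum>l\<in>range ?g. \<Sum>t<n. - (?p t l * ln (?p t l)))"
    unfolding H by (rule sum.swap)
  also have "\<dots> \<le> (\<Sum>l\<in>range ?g. - real n * (((\<Sum>t<n. ?p t l) / n) * ln ((\<Sum>t<n. ?p t l) / n)))"
  proof (rule sum_mono)
    fix l
    have "{..<n} \<noteq> {}" using E(3) by (simp add: lessThan_empty_iff)
    then show "(\<Sum>t<n. - (?p t l * ln (?p t l))) \<le> - real n * (((\<Sum>t<n. ?p t l) / n) * ln ((\<Sum>t<n. ?p t l) / n))"
      using sum_xlnx_average[of "{..<n}" "\<lambda>t. ?p t l"] by simp
  qed
  also have "\<dots> = real n * shannon (measure_pmf (orbit_pmf T n E)) ?g"
    by (simp add: shannon_def prob_orbit_pmf[OF E] sum_distrib_left sum_negf)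
  finally show ?thesis by simp
qed

section \<open>Misiurewicz's construction\<close>

context measure_preserving
begin

text \<open>Equality of fibres means that \<open>f\<close> and \<open>cell C\<close> identify the
  same points. It serves both directions: \<open>f = cell C\<close> for a given partition and
  \<open>C = fibers f\<close> for a given labelling.\<close>

lemma partition_entropy_cover_iter:
  assumes "fibers (cell C) = fibers f" "finite (range f)" "disjoint C" "\<Union>C = UNIV"
  shows "partition_entropy M (cover_iter T C n) = shannon M (itinerary f T n)"
proof (rule partition_entropy_fibers[OF space_UNIV finite_range_itinerary[OF assms(2)]])
  have ker: "cell C x = cell C y \<longleftrightarrow> f x = f y" for x y
  proof -
    have "cell C -` {cell C y} = f -` {f y}"
    proof -
      have "cell C -` {cell C y} \<in> fibers (cell C)" unfolding fibers_def by (rule rangeI)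
      then have "cell C -` {cell C y} \<in> fibers f" unfolding assms(1) .
      then obtain z where z: "cell C -` {cell C y} = f -` {f z}" by (auto simp: fibers_def)
      then have "y \<in> f -` {f z}" by auto
      then show ?thesis using z by simp
    qed
    then show ?thesis by auto
  qed
  have "itinerary (cell C) T n -` {itinerary (cell C) T n x} = itinerary f T n -` {itinerary f T n x}" for x
    by (auto simp: itinerary_eq_iff ker)
  then have "fibers (itinerary (cell C) T n) = fibers (itinerary f T n)" by (simp add: fibers_def)
  then show "cover_iter T C n - {{}} = fibers (itinerary f T n)"
    using cover_iter_partition[OF assms(3,4)] by simp
qed

end

lemma simple_function_cell:
  fixes M :: "'a::topological_space measure"
  assumes "sets M = sets borel" "finite_meas_partition C"
  shows "simple_function M (cell C)"
proof -
  have [simp]: "space M = UNIV" using sets_eq_imp_space_eq[OF assms(1)] by simp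
  have C: "finite C" "C \<subseteq> sets borel" "\<Union>C = UNIV" "disjoint C"
    using assms by (auto simp: finite_meas_partition_def)
  have r: "range (cell C) \<subseteq> C" using cell_mem[OF C(4,3)] by auto
  have "cell C -` {c} \<in> sets M" if "c \<in> C" for c
  proof -
    have "cell C -` {c} = c"
    proof (intro set_eqI iffI)
      fix x assume "x \<in> cell C -` {c}" then show "x \<in> c" using mem_cell[OF C(4,3), of x] by auto
    next
      fix x assume "x \<in> c" then show "x \<in> cell C -` {c}" using cell_eq[OF C(4) that] by auto
    qed
    then show ?thesis using that C(2) assms(1) by auto
  qed
  then show ?thesis using finite_subset[OF r C(1)] r by (auto simp: simple_function_def)
qed

lemma ks_partition_entropy_eq_rate:
  fixes M :: "'a::topological_space measure"
  assumes "measure_preserving M T" "finite_meas_partition C" "simple_function M (cell C)"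
  shows "ks_partition_entropy M T C = measure_preserving.rate M T (cell C)"
proof -
  interpret measure_preserving M T by fact
  have C: "\<Union>C = UNIV" "disjoint C" using assms by (auto simp: finite_meas_partition_def)
  have "finite (range (cell C))" using simple_functionD(1)[OF assms(3)] by simp
  from partition_entropy_cover_iter[OF refl this C(2,1)]
  show ?thesis by (simp add: ks_partition_entropy_def rate_def)
qed

lemma rate_le_ks_entropy:
  fixes M :: "'a::topological_space measure"
  assumes "sets M = sets borel" "simple_function M f" "measure_preserving M T"
  shows "ereal (measure_preserving.rate M T f) \<le> ks_entropy M T"
proof -
  interpret measure_preserving M T by fact
  have fin: "finite (range f)" using simple_functionD(1)[OF assms(2)] by simp
  have fib: "fibers f = (\<lambda>l. f -` {l}) ` range f" by (auto simp: fibers_def)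
  have dis: "disjoint (fibers f)" by (auto simp: disjoint_def fibers_def)
  have un: "\<Union>(fibers f) = UNIV" by (auto simp: fibers_def)
  have ne: "fibers f - {{}} = fibers f" by (auto simp: fibers_def)
  have "fibers f \<subseteq> sets borel"
    using simple_functionD(2)[OF assms(2)] assms(1) by (auto simp: fibers_def)
  then have fmp: "finite_meas_partition (fibers f)"
    using fin dis un by (simp add: finite_meas_partition_def fib)
  have "fibers (cell (fibers f)) = fibers f" using fibers_cell[OF dis un] ne by simp
  from partition_entropy_cover_iter[OF this fin dis un]
  have "ks_partition_entropy M T (fibers f) = rate f"
    by (simp add: ks_partition_entropy_def rate_def)
  then show ?thesis unfolding ks_entropy_def using fmp by (intro SUP_upper2[of "fibers f"]) auto
qed

lemma measure_preserving_of_invariant: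
  assumes "continuous_on UNIV T" "radon_prob \<mu>" "invariant_measure T \<mu>"
  shows "measure_preserving \<mu> T"
proof -
  have \<mu>: "prob_space \<mu>" "sets \<mu> = sets borel" using assms by (auto simp: radon_prob_def)
  interpret prob_space \<mu> by (rule \<mu>)
  show ?thesis
  proof
    show "space \<mu> = UNIV" using sets_eq_imp_space_eq[OF \<mu>(2)] by simp
    show "T \<in> measurable \<mu> \<mu>"
      using borel_measurable_continuous_onI[OF assms(1)] measurable_cong_sets[OF \<mu>(2) \<mu>(2)] by simp
    show "prob (T -` A) = prob A" if "A \<in> sets \<mu>" for A
      using assms(3) that by (simp add: invariant_measure_def measure_def)
  qed
qed

text \<open>Words may have limiting probability 0, where \<open>ln\<close> is discontinuous but
  \<open>x * ln x\<close> is continuous from the right.\<close>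

lemma xlnx_tendsto:
  fixes f :: "'b \<Rightarrow> real"
  assumes f: "(f \<longlongrightarrow> a) F" and nn: "\<And>x. 0 \<le> f x" and a: "0 \<le> a"
  shows "((\<lambda>x. f x * ln (f x)) \<longlongrightarrow> a * ln a) F"
proof (cases "a = 0")
  case False
  then show ?thesis using a by (intro tendsto_intros f) auto
next
  case True
  have "((\<lambda>x::real. x * ln x) \<longlongrightarrow> 0) (at 0 within {0..})"
    unfolding at_within_Ici_at_right by real_asymp
  then have "continuous (at 0 within {0..}) (\<lambda>x::real. x * ln x)"
    by (simp add: continuous_within)
  then have "((\<lambda>x. (\<lambda>x::real. x * ln x) (f x)) \<longlongrightarrow> 0 * ln 0) F"
    using f nn True by (intro continuous_within_tendsto_compose[of 0 "{0..}" "\<lambda>x. x * ln x" f F]) auto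
  then show ?thesis using True by simp
qed

context compactification_metric
begin

lemma borel_measurable_D [measurable]: "(\<lambda>x. D p (Some x)) \<in> borel_measurable borel"
  by (subst borel_measurable_iff_less) (auto intro!: borel_open open_less)

text \<open>The distribution of the distance from \<open>p\<close> has only countably many atoms.
  Radii below \<open>e / 2\<close> keep balls of diameter less than \<open>e\<close>.\<close>

lemma ex_null_radius:
  assumes "finite_measure \<mu>" "sets \<mu> = sets borel" "e > 0"
  obtains r where "e / 4 < r" "r < e / 2" "measure \<mu> {x. D p (Some x) = r} = 0"
proof -
  interpret finite_measure \<mu> by fact
  have sp: "space \<mu> = UNIV" using sets_eq_imp_space_eq[OF assms(2)] by simp
  have m: "(\<lambda>x. D p (Some x)) \<in> borel_measurable \<mu>"
    using borel_measurable_D measurable_cong_sets[OF assms(2) refl] by blast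
  interpret N: finite_measure "distr \<mu> borel (\<lambda>x. D p (Some x))"
    by (rule finite_measure_distr[OF m])
  have "\<not> {e/4<..<e/2} \<subseteq> {r. measure (distr \<mu> borel (\<lambda>x. D p (Some x))) {r} \<noteq> 0}"
    using countable_subset[OF _ N.countable_support] uncountable_open_interval[of "e/4" "e/2"] assms(3) by auto
  then obtain r where "e / 4 < r" "r < e / 2" "measure (distr \<mu> borel (\<lambda>x. D p (Some x))) {r} = 0" by auto
  moreover have "measure (distr \<mu> borel (\<lambda>x. D p (Some x))) {r} = measure \<mu> {x. D p (Some x) = r}"
    by (subst measure_distr[OF m]) (auto simp: sp vimage_def)
  ultimately show ?thesis using that by simp
qed

end

section \<open>Regularity and invariance of the vague limit\<close>

locale vague_orbit_limit = compactification_metric D + finite_measure \<mu>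
  for D :: "'a::topological_space option \<Rightarrow> 'a option \<Rightarrow> real" and \<mu> :: "'a measure" +
  fixes T :: "'a \<Rightarrow> 'a" and p :: "nat \<Rightarrow> 'a pmf" and c :: "nat \<Rightarrow> real"
  assumes sets_\<mu> [measurable_cong, simp]: "sets \<mu> = sets borel"
    and mass_le_1: "measure \<mu> UNIV \<le> 1"
    and cont: "continuous_on UNIV T"
    and vague_open: "\<And>G e. open G \<Longrightarrow> e > 0 \<Longrightarrow> \<forall>\<^sub>F n in sequentially. measure \<mu> G - e < measure_pmf.prob (p n) G"
    and vague_compact: "\<And>K e. compact K \<Longrightarrow> e > 0 \<Longrightarrow> \<forall>\<^sub>F n in sequentially. measure_pmf.prob (p n) K < measure \<mu> K + e"
    and outer_regular: "\<And>A e. A \<in> sets borel \<Longrightarrow> e > 0 \<Longrightarrow> \<exists>G. open G \<and> A \<subseteq> G \<and> measure \<mu> G < measure \<mu> A + e"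
    and almost_invariant: "\<And>n S. \<bar>measure_pmf.prob (p n) (T -` S) - measure_pmf.prob (p n) S\<bar> \<le> c n"
    and c_tendsto: "c \<longlonglongrightarrow> 0"
begin

lemma space_\<mu> [simp]: "space \<mu> = UNIV"
  using sets_eq_imp_space_eq[OF sets_\<mu>] by simp

lemma T_borel [measurable]: "T \<in> borel_measurable borel"
  by (rule borel_measurable_continuous_onI[OF cont])

lemma vimage_borel: "A \<in> sets borel \<Longrightarrow> T -` A \<in> sets borel"
  using measurable_sets[OF T_borel, of A] by simp

lemma measure_Compl: "A \<in> sets borel \<Longrightarrow> measure \<mu> (- A) = measure \<mu> UNIV - measure \<mu> A"
  using finite_measure_compl[of A] by (simp add: Compl_eq_Diff_UNIV)

text \<open>Outer regularity of the complement gives a closed subset of \<open>A\<close>; the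
  compact exhaustion then cuts it down to a compact one.\<close>

lemma inner_regular:
  assumes A: "A \<in> sets borel" and e: "e > 0"
  obtains K where "compact K" "K \<subseteq> A" "measure \<mu> A < measure \<mu> K + e"
proof -
  obtain G where G: "open G" "- A \<subseteq> G" "measure \<mu> G < measure \<mu> (- A) + e / 2"
    using outer_regular[of "- A" "e / 2"] A e by auto
  have "measure \<mu> (- G) > measure \<mu> A - e / 2"
    using G A by (simp add: measure_Compl)
  define K where "K n = {x. 1 / Suc n \<le> D None (Some x)}" for n
  have K: "compact (K n)" for n unfolding K_def by (intro compact_far) simp
  have meas: "K n \<inter> - G \<in> sets \<mu>" for n using compact_closed[OF K] G by auto
  have "incseq (\<lambda>n. K n \<inter> - G)"
  proof (intro incseq_SucI subsetI)
    fix n x assume "x \<in> K n \<inter> - G"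
    moreover have "1 / real (Suc (Suc n)) \<le> 1 / real (Suc n)" by (intro divide_left_mono) auto
    ultimately show "x \<in> K (Suc n) \<inter> - G" by (auto simp: K_def)
  qed
  then have "(\<lambda>n. measure \<mu> (K n \<inter> - G)) \<longlonglongrightarrow> measure \<mu> (\<Union>n. K n \<inter> - G)"
    using meas by (intro finite_Lim_measure_incseq) auto
  moreover have "(\<Union>n. K n \<inter> - G) = - G"
  proof -
    have "\<exists>n. x \<in> K n" for x
      using nat_approx_posE[OF far_pos[of x]] unfolding K_def by (metis less_imp_le mem_Collect_eq)
    then show ?thesis by auto
  qed
  ultimately have "(\<lambda>n. measure \<mu> (K n \<inter> - G)) \<longlonglongrightarrow> measure \<mu> (- G)" by simp
  from order_tendstoD(1)[OF this, of "measure \<mu> (- G) - e / 2"] e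
  obtain n where "measure \<mu> (- G) - e / 2 < measure \<mu> (K n \<inter> - G)"
    by (auto simp: eventually_sequentially)
  then have "measure \<mu> A < measure \<mu> (K n \<inter> - G) + e"
    using \<open>measure \<mu> (- G) > measure \<mu> A - e / 2\<close> by linarith
  moreover have "compact (K n \<inter> - G)" using K G by (intro compact_Int_closed) auto
  ultimately show ?thesis using G by (intro that[of "K n \<inter> - G"]) auto
qed

lemma vimage_compact_le:
  assumes K: "compact K"
  shows "measure \<mu> (T -` K) \<le> measure \<mu> K"
proof (rule field_le_epsilon)
  fix e :: real assume "e > 0"
  define e' where "e' = e / 4"
  have e: "e' > 0" using \<open>e > 0\<close> by (simp add: e'_def)
  have Kb: "K \<in> sets borel" using compact_closed[OF K] by simp
  obtain G where G: "open G" "K \<subseteq> G" "measure \<mu> G < measure \<mu> K + e'" using outer_regular[OF Kb e] by blast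
  obtain V K' where V: "open V" "compact K'" "K \<subseteq> V" "V \<subseteq> K'" "K' \<subseteq> G" by (rule compact_nbhd[OF K G(1,2)])
  have oV: "open (T -` V)" by (rule open_vimage[OF V(1) cont])
  have "\<forall>\<^sub>F n in sequentially. measure \<mu> (T -` V) - e' < measure_pmf.prob (p n) (T -` V)" by (rule vague_open[OF oV e])
  moreover have "\<forall>\<^sub>F n in sequentially. measure_pmf.prob (p n) K' < measure \<mu> K' + e'" by (rule vague_compact[OF V(2) e])
  moreover have "\<forall>\<^sub>F n in sequentially. c n < e'" by (rule order_tendstoD(2)[OF c_tendsto e])
  ultimately have "\<forall>\<^sub>F n in sequentially. measure \<mu> (T -` V) < measure \<mu> K' + 3 * e'"
  proof eventually_elim
    case (elim n)
    have "measure_pmf.prob (p n) V \<le> measure_pmf.prob (p n) K'" by (rule measure_pmf.finite_measure_mono) (use V in auto)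
    then show ?case using elim almost_invariant[of n V] by linarith
  qed
  then have "measure \<mu> (T -` V) < measure \<mu> K' + 3 * e'" by simp
  moreover have "measure \<mu> (T -` K) \<le> measure \<mu> (T -` V)"
    using V oV by (intro finite_measure_mono) auto
  moreover have "measure \<mu> K' \<le> measure \<mu> G" using V G by (intro finite_measure_mono) auto
  ultimately show "measure \<mu> (T -` K) \<le> measure \<mu> K + e" using G(3) by (simp add: e'_def)
qed

lemma measure_vimage_T:
  assumes "A \<in> sets borel"
  shows "measure \<mu> (T -` A) = measure \<mu> A"
proof -
  have le: "measure \<mu> (T -` B) \<le> measure \<mu> B" if B: "B \<in> sets borel" for B
  proof (rule field_le_epsilon)
    fix e :: real assume e: "e > 0"
    obtain K where K: "compact K" "K \<subseteq> T -` B" "measure \<mu> (T -` B) < measure \<mu> K + e"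
      by (rule inner_regular[OF vimage_borel[OF B] e])
    have TK: "compact (T ` K)" using K cont by (intro compact_continuous_image) (auto intro: continuous_on_subset)
    then have b: "T ` K \<in> sets borel" using compact_closed by auto
    have "measure \<mu> K \<le> measure \<mu> (T -` (T ` K))" using vimage_borel[OF b] by (intro finite_measure_mono) auto
    also have "\<dots> \<le> measure \<mu> (T ` K)" by (rule vimage_compact_le[OF TK])
    also have "\<dots> \<le> measure \<mu> B" using K B by (intro finite_measure_mono) auto
    finally show "measure \<mu> (T -` B) \<le> measure \<mu> B + e" using K by simp
  qed
  have "measure \<mu> (T -` (- A)) = measure \<mu> UNIV - measure \<mu> (T -` A)"
    using measure_Compl[OF vimage_borel[OF assms]] by (simp add: vimage_Compl)
  then show ?thesis using le[OF assms] le[of "- A"] assms by (simp add: measure_Compl)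
qed

lemma funpow_borel [measurable]: "(T ^^ j) \<in> borel_measurable borel"
  by (rule borel_measurable_continuous_onI[OF continuous_on_funpow[OF cont]])

lemma measure_vimage_funpow: "A \<in> sets borel \<Longrightarrow> measure \<mu> ((T ^^ j) -` A) = measure \<mu> A"
proof (induction j)
  case (Suc j)
  have "(T ^^ j) -` A \<in> sets borel" using measurable_sets[OF funpow_borel, of A j] Suc by simp
  then have "measure \<mu> (T -` ((T ^^ j) -` A)) = measure \<mu> A" using Suc measure_vimage_T by simp
  moreover have "T -` ((T ^^ j) -` A) = (T ^^ Suc j) -` A"
    by (simp only: vimage_comp funpow.simps(2) o_def funpow_swap1)
  ultimately show ?case by metis
qed simp

lemma almost_invariant_funpow:
  "\<bar>measure_pmf.prob (p n) ((T ^^ j) -` S) - measure_pmf.prob (p n) S\<bar> \<le> real j * c n"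
proof (induction j)
  case (Suc j)
  have "T -` ((T ^^ j) -` S) = (T ^^ Suc j) -` S"
    by (simp only: vimage_comp funpow.simps(2) o_def funpow_swap1)
  then have "\<bar>measure_pmf.prob (p n) ((T ^^ Suc j) -` S) - measure_pmf.prob (p n) ((T ^^ j) -` S)\<bar> \<le> c n"
    using almost_invariant[of n "(T ^^ j) -` S"] by metis
  moreover have "real (Suc j) * c n = real j * c n + c n" by (simp add: algebra_simps)
  ultimately show ?case using Suc by linarith
qed simp

text \<open>The preimage need not be compact, so the upper estimate is applied to \<open>K\<close>
  and carried over: approximately for \<open>p n\<close>, exactly for \<open>\<mu>\<close>.\<close>

lemma eventually_prob_vimage_compact:
  assumes "compact K" "e > 0"
  shows "\<forall>\<^sub>F n in sequentially. measure_pmf.prob (p n) ((T ^^ j) -` K) < measure \<mu> ((T ^^ j) -` K) + e"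
proof -
  have "K \<in> sets borel" using compact_closed[OF assms(1)] by simp
  then have eq: "measure \<mu> ((T ^^ j) -` K) = measure \<mu> K" by (rule measure_vimage_funpow)
  have "(\<lambda>n. real j * c n) \<longlonglongrightarrow> real j * 0" by (intro tendsto_intros c_tendsto)
  then have "\<forall>\<^sub>F n in sequentially. real j * c n < e / 2" using assms(2) by (intro order_tendstoD(2)[of _ "0"]) auto
  moreover have "\<forall>\<^sub>F n in sequentially. measure_pmf.prob (p n) K < measure \<mu> K + e / 2"
    using assms by (intro vague_compact) auto
  ultimately show ?thesis
  proof eventually_elim
    case (elim n)
    then show ?case using almost_invariant_funpow[of n j K] unfolding eq by linarith
  qed
qed

end

section \<open>A finite labelling with null boundaries\<close>

locale null_boundary_partition = vague_orbit_limit D \<mu> T p c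
  for D :: "'a::topological_space option \<Rightarrow> 'a option \<Rightarrow> real" and \<mu> T p c +
  fixes P :: "'a option set" and r :: "'a option \<Rightarrow> real"
  assumes finite_P: "finite P" and None_P: "None \<in> P"
    and covers: "\<And>x. \<exists>q\<in>P. D q (Some x) < r q"
    and r_pos: "\<And>q. r q > 0"
    and null_sphere: "\<And>q. measure \<mu> {x. D q (Some x) = r q} = 0"
begin

text \<open>
  All points near infinity get the single label \<open>{None}\<close>, so every other cell is relatively compact and
  no cell has infinity on its boundary.
\<close>

definition label :: "'a \<Rightarrow> 'a option set" where
  "label x = (if D None (Some x) < r None then {None} else {q \<in> P. D q (Some x) < r q})"

lemma label_eq_None_iff: "label x = {None} \<longleftrightarrow> D None (Some x) < r None"
  by (auto simp: label_def)

lemma label_subset: "label x \<subseteq> P"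
  using None_P by (auto simp: label_def)

lemma finite_range_label: "finite (range label)"
  by (rule finite_subset[of _ "Pow P"]) (use label_subset finite_P in auto)

lemma label_small:
  assumes "label x = label y"
  shows "\<exists>q\<in>P. D q (Some x) < r q \<and> D q (Some y) < r q"
proof (cases "label x = {None}")
  case True
  then show ?thesis using assms None_P label_eq_None_iff by metis
next
  case False
  then have "\<not> D None (Some x) < r None" "\<not> D None (Some y) < r None"
    using assms label_eq_None_iff by metis+
  moreover obtain q where "q \<in> P" "D q (Some x) < r q" using covers by blast
  ultimately show ?thesis using assms by (auto simp: label_def)
qed

lemma label_measurable: "label -` {l} \<in> sets borel"
proof -
  have "{q \<in> P. \<phi> q} = l \<longleftrightarrow> l \<subseteq> P \<and> (\<forall>q\<in>P. q \<in> l \<longleftrightarrow> \<phi> q)" for \<phi> by blast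
  then have "label x = l \<longleftrightarrow> (D None (Some x) < r None \<and> l = {None}) \<or>
     (\<not> D None (Some x) < r None \<and> l \<subseteq> P \<and> (\<forall>q\<in>P. q \<in> l \<longleftrightarrow> D q (Some x) < r q))" for x
    by (cases "D None (Some x) < r None") (simp_all add: label_def eq_commute[of _ l])
  then have "label -` {l} = {x \<in> space borel. (D None (Some x) < r None \<and> l = {None}) \<or>
     (\<not> D None (Some x) < r None \<and> l \<subseteq> P \<and> (\<forall>q\<in>P. q \<in> l \<longleftrightarrow> D q (Some x) < r q))}"
    unfolding vimage_def by simp
  also have "\<dots> \<in> sets borel"
    using finite_P by measurable
  finally show ?thesis .
qed

lemma itinerary_measurable: "itinerary label T n -` {l} \<in> sets borel"
proof (cases "length l = n")
  case True
  have "itinerary label T n x = l \<longleftrightarrow> (\<forall>j\<in>{..<n}. label ((T ^^ j) x) = l ! j)" for x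
    using True by (simp add: list_eq_iff_nth_eq nth_itinerary Ball_def)
  then have "itinerary label T n -` {l} = (\<Inter>j\<in>{..<n}. (T ^^ j) -` (label -` {l ! j})) \<inter> space borel"
    by (intro set_eqI) simp
  also have "\<dots> \<in> sets borel"
  proof (cases "n = 0")
    case False
    then show ?thesis using measurable_sets[OF funpow_borel label_measurable]
      by (intro sets.Int sets.finite_INT) auto
  qed simp
  finally show ?thesis .
next
  case False
  then have "itinerary label T n -` {l} = {}" by auto
  then show ?thesis by simp
qed

text \<open>Off this null set the itinerary of length \<open>n\<close> is locally constant.\<close>

definition bad :: "nat \<Rightarrow> 'a set" where
  "bad n = (\<Union>j<n. \<Union>q\<in>P. (T ^^ j) -` {x. D q (Some x) = r q})"

lemma sphere_borel: "{x. D q (Some x) = r q} \<in> sets borel"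
proof -
  have "{x \<in> space borel. D q (Some x) = r q} \<in> sets borel" by measurable
  then show ?thesis by simp
qed

lemma null_sets_bad: "bad n \<in> null_sets \<mu>"
proof -
  have s: "(T ^^ j) -` {x. D q (Some x) = r q} \<in> sets \<mu>" for j q
    using measurable_sets[OF funpow_borel sphere_borel, of j q] by simp
  have "(T ^^ j) -` {x. D q (Some x) = r q} \<in> null_sets \<mu>" for j q
    using s[of j q] measure_vimage_funpow[OF sphere_borel, of j q] null_sphere[of q]
    by (auto simp: null_sets_def emeasure_eq_measure)
  then show ?thesis
    unfolding bad_def using finite_P by (intro null_sets_UN' countable_finite) auto
qed

text \<open>Away from the spheres all comparisons with the radii are strict, and finitely many
  strict inequalities persist in a neighbourhood.\<close>

lemma open_itinerary: "open {x. x \<notin> bad n \<and> itinerary label T n x \<in> Q}"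
proof (rule topological_space_class.openI)
  fix x assume x: "x \<in> {x. x \<notin> bad n \<and> itinerary label T n x \<in> Q}"
  define W where "W j q = (if D q (Some ((T ^^ j) x)) < r q then {y. D q (Some y) < r q} else {y. r q < D q (Some y)})" for j q
  define V where "V = (\<Inter>j<n. \<Inter>q\<in>P. (T ^^ j) -` W j q)"
  have "open ((T ^^ j) -` W j q)" for j q
    by (intro open_vimage continuous_on_funpow[OF cont]) (simp add: W_def open_less open_greater)
  then have "open V" unfolding V_def using finite_P by (intro open_INT ballI) auto
  moreover have "x \<in> V"
  proof -
    have "D q (Some ((T ^^ j) x)) \<noteq> r q" if "j < n" "q \<in> P" for j q
      using x that by (auto simp: bad_def)
    then show ?thesis unfolding V_def W_def by (force simp: not_less le_less)
  qed
  moreover have "V \<subseteq> {x. x \<notin> bad n \<and> itinerary label T n x \<in> Q}"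
  proof
    fix y assume "y \<in> V"
    then have y: "(T ^^ j) y \<in> W j q" if "j < n" "q \<in> P" for j q using that by (auto simp: V_def)
    have eq: "D q (Some ((T ^^ j) y)) < r q \<longleftrightarrow> D q (Some ((T ^^ j) x)) < r q"
      and ne: "D q (Some ((T ^^ j) y)) \<noteq> r q" if "j < n" "q \<in> P" for j q
      using y[OF that] by (auto simp: W_def split: if_splits)
    have "label ((T ^^ j) y) = label ((T ^^ j) x)" if "j < n" for j
      using eq[OF that] None_P by (auto simp: label_def)
    then have "itinerary label T n y = itinerary label T n x" by (simp add: itinerary_eq_iff)
    moreover have "y \<notin> bad n" using ne by (auto simp: bad_def)
    ultimately show "y \<in> {x. x \<notin> bad n \<and> itinerary label T n x \<in> Q}" using x by simp
  qed
  ultimately show "\<exists>V. open V \<and> x \<in> V \<and> V \<subseteq> {x. x \<notin> bad n \<and> itinerary label T n x \<in> Q}" by blast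
qed

lemma measure_remove_bad:
  assumes "A \<in> sets borel"
  shows "measure \<mu> (A - bad n) = measure \<mu> A"
  by (rule measure_Diff_null_set) (use assms null_sets_bad in simp_all)

text \<open>A letter other than \<open>{None}\<close> at time \<open>j\<close> confines the word to
  \<open>?F\<close>, the preimage of a compact set, where an upper estimate holds. Up to a null set
  \<open>?F\<close> is the disjoint union of the open sets \<open>O1\<close> and \<open>O2\<close>,
  and their two lower estimates leave no slack.\<close>

lemma prob_itinerary_tendsto:
  assumes l: "j < n" "length l = n" "l ! j \<noteq> {None}"
  shows "(\<lambda>k. measure_pmf.prob (p k) (itinerary label T n -` {l})) \<longlonglongrightarrow> measure \<mu> (itinerary label T n -` {l})"
proof -
  let ?S = "itinerary label T n -` {l}"
  define V where "V = {x. r None \<le> D None (Some x)}"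
  let ?F = "(T ^^ j) -` V"
  have V: "compact V" unfolding V_def by (intro compact_far r_pos)
  have Sb: "?S \<in> sets borel" by (rule itinerary_measurable)
  have "V \<in> sets borel" using compact_closed[OF V] by simp
  then have Fb: "?F \<in> sets borel" using measurable_sets[OF funpow_borel, of V j] by simp
  have F_iff: "x \<in> ?F \<longleftrightarrow> itinerary label T n x ! j \<noteq> {None}" for x
    using l(1) by (simp add: V_def nth_itinerary label_eq_None_iff not_less)
  have "x \<in> ?F" if "x \<in> ?S" for x using that l(3) unfolding F_iff by simp
  then have SF: "?S \<subseteq> ?F" by (rule subsetI)
  define O1 where "O1 = {x. x \<notin> bad n \<and> itinerary label T n x \<in> {l}}"
  define O2 where "O2 = {x. x \<notin> bad n \<and> itinerary label T n x \<in> {w. w \<noteq> l \<and> w ! j \<noteq> {None}}}"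
  have O: "open O1" "open O2" unfolding O1_def O2_def by (rule open_itinerary)+
  have "O1 = ?S - bad n" unfolding O1_def by (intro set_eqI) (simp add: conj_commute)
  then have m1: "measure \<mu> O1 = measure \<mu> ?S" using measure_remove_bad[OF Sb] by simp
  have "x \<in> O2 \<longleftrightarrow> x \<in> (?F - ?S) - bad n" for x
    unfolding O2_def Diff_iff F_iff by simp metis
  then have "O2 = (?F - ?S) - bad n" by (rule set_eqI)
  then have m2: "measure \<mu> O2 = measure \<mu> ?F - measure \<mu> ?S"
    using measure_remove_bad[of "?F - ?S"] Sb Fb finite_measure_Diff[of ?F ?S] SF by simp
  show ?thesis
  proof (rule tendstoI)
    fix e :: real assume "e > 0"
    then have e: "e / 2 > 0" by simp
    have "\<forall>\<^sub>F k in sequentially. measure \<mu> O1 - e / 2 < measure_pmf.prob (p k) O1" by (rule vague_open[OF O(1) e])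
    moreover have "\<forall>\<^sub>F k in sequentially. measure \<mu> O2 - e / 2 < measure_pmf.prob (p k) O2" by (rule vague_open[OF O(2) e])
    moreover have "\<forall>\<^sub>F k in sequentially. measure_pmf.prob (p k) ?F < measure \<mu> ?F + e / 2"
      by (rule eventually_prob_vimage_compact[OF V e])
    ultimately show "\<forall>\<^sub>F k in sequentially. dist (measure_pmf.prob (p k) ?S) (measure \<mu> ?S) < e"
    proof eventually_elim
      case (elim k)
      have "measure_pmf.prob (p k) O1 \<le> measure_pmf.prob (p k) ?S"
        by (rule measure_pmf.finite_measure_mono) (auto simp: O1_def)
      moreover have "measure_pmf.prob (p k) ?S + measure_pmf.prob (p k) O2 \<le> measure_pmf.prob (p k) ?F"
      proof -
        have "measure_pmf.prob (p k) ?S + measure_pmf.prob (p k) O2 = measure_pmf.prob (p k) (?S \<union> O2)"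
          by (rule measure_pmf.finite_measure_Union[symmetric]) (auto simp: O2_def)
        also have "\<dots> \<le> measure_pmf.prob (p k) ?F"
        proof (rule measure_pmf.finite_measure_mono)
          have "O2 \<subseteq> ?F" unfolding O2_def using F_iff by blast
          then show "?S \<union> O2 \<subseteq> ?F" using SF by (rule Un_least[rotated])
        qed simp
        finally show ?thesis .
      qed
      ultimately show ?case using elim m1 m2 by (simp add: dist_real_def abs_less_iff)
    qed
  qed
qed

abbreviation far :: "nat \<Rightarrow> 'a option set list" where
  "far n \<equiv> replicate n {None}"

text \<open>\<open>far n\<close> is included even if no orbit realizes it, because escaping mass is
  assigned to it.\<close>

definition words :: "nat \<Rightarrow> 'a option set list set" where
  "words n = insert (far n) (range (itinerary label T n))"

lemma finite_words: "finite (words n)"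
  unfolding words_def using finite_range_itinerary[OF finite_range_label] by simp

lemma length_words: "l \<in> words n \<Longrightarrow> length l = n"
  by (auto simp: words_def)

lemma sum_measure_words:
  assumes N: "finite_measure N" "\<And>l. itinerary label T n -` {l} \<in> sets N"
  shows "(\<Sum>l\<in>words n. measure N (itinerary label T n -` {l})) = measure N UNIV"
proof -
  interpret N: finite_measure N by fact
  have "measure N (\<Union>l\<in>words n. itinerary label T n -` {l}) = (\<Sum>l\<in>words n. measure N (itinerary label T n -` {l}))"
    using N(2) finite_words by (intro N.finite_measure_finite_Union) (auto simp: disjoint_family_on_def)
  moreover have "(\<Union>l\<in>words n. itinerary label T n -` {l}) = UNIV" by (auto simp: words_def)
  ultimately show ?thesis by simp
qed

text \<open>The mass that escapes to infinity is carried by the constant word \<open>far n\<close>.\<close>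

definition limit_prob :: "nat \<Rightarrow> 'a option set list \<Rightarrow> real" where
  "limit_prob n l = measure \<mu> (itinerary label T n -` {l}) + (if l = far n then 1 - measure \<mu> UNIV else 0)"

text \<open>No compact set controls \<open>far n\<close>. Its probability is 1 minus that of the
  finitely many other words, and in the limit it absorbs the missing mass.\<close>

lemma prob_word_tendsto:
  assumes "l \<in> words n"
  shows "(\<lambda>k. measure_pmf.prob (p k) (itinerary label T n -` {l})) \<longlonglongrightarrow> limit_prob n l"
proof -
  have other: "(\<lambda>k. measure_pmf.prob (p k) (itinerary label T n -` {l})) \<longlonglongrightarrow> measure \<mu> (itinerary label T n -` {l})"
    if "l \<in> words n" "l \<noteq> far n" for l
  proof -
    have "\<exists>j<n. l ! j \<noteq> {None}"
    proof (rule ccontr)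
      assume "\<not> ?thesis"
      then have "l = far n" using length_words[OF that(1)] by (auto intro: nth_equalityI)
      with that show False by simp
    qed
    then show ?thesis using prob_itinerary_tendsto length_words[OF that(1)] by blast
  qed
  show ?thesis
  proof (cases "l = far n")
    case False
    then show ?thesis using other[OF assms False] by (simp add: limit_prob_def)
  next
    case True
    have split: "measure N (itinerary label T n -` {far n}) = measure N UNIV - (\<Sum>l\<in>words n - {far n}. measure N (itinerary label T n -` {l}))"
      if "finite_measure N" "\<And>l. itinerary label T n -` {l} \<in> sets N" for N
      using sum_measure_words[OF that] sum.remove[OF finite_words, of "far n" n "\<lambda>l. measure N (itinerary label T n -` {l})"]
      by (simp add: words_def)
    have "(\<lambda>k. 1 - (\<Sum>l\<in>words n - {far n}. measure_pmf.prob (p k) (itinerary label T n -` {l})))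
        \<longlonglongrightarrow> 1 - (\<Sum>l\<in>words n - {far n}. measure \<mu> (itinerary label T n -` {l}))"
      by (intro tendsto_intros other) auto
    also have "(\<lambda>k. 1 - (\<Sum>l\<in>words n - {far n}. measure_pmf.prob (p k) (itinerary label T n -` {l})))
       = (\<lambda>k. measure_pmf.prob (p k) (itinerary label T n -` {far n}))"
      using split[OF measure_pmf.finite_measure_axioms] by (auto simp: fun_eq_iff measure_pmf.prob_space[simplified])
    also have "1 - (\<Sum>l\<in>words n - {far n}. measure \<mu> (itinerary label T n -` {l})) = limit_prob n (far n)"
      using split[OF finite_measure_axioms] itinerary_measurable by (simp add: limit_prob_def)
    finally show ?thesis using True by simp
  qed
qed

definition limit_entropy :: "nat \<Rightarrow> real" where
  "limit_entropy n = - (\<Sum>l\<in>words n. limit_prob n l * ln (limit_prob n l))"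

lemma shannon_tendsto:
  "(\<lambda>k. shannon (measure_pmf (p k)) (itinerary label T n)) \<longlonglongrightarrow> limit_entropy n"
proof -
  have "shannon (measure_pmf (p k)) (itinerary label T n) =
      - (\<Sum>l\<in>words n. measure_pmf.prob (p k) (itinerary label T n -` {l}) * ln (measure_pmf.prob (p k) (itinerary label T n -` {l})))" for k
    by (subst prob_space.shannon_superset[OF prob_space_measure_pmf finite_words]) (auto simp: words_def)
  moreover have "0 \<le> limit_prob n l" for l using mass_le_1 by (simp add: limit_prob_def)
  ultimately show ?thesis
    unfolding limit_entropy_def by (simp only:) (intro tendsto_minus tendsto_sum xlnx_tendsto prob_word_tendsto; simp)
qed

lemma limit_entropy_mass_0:
  assumes "measure \<mu> UNIV = 0"
  shows "limit_entropy n = 0"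
proof -
  have "measure \<mu> S = 0" if "S \<in> sets \<mu>" for S
    using finite_measure_mono[of S UNIV] measure_nonneg[of \<mu> S] assms by simp
  then have "limit_prob n l = (if l = far n then 1 else 0)" for l
    using itinerary_measurable[of n l] assms by (simp add: limit_prob_def)
  then show ?thesis unfolding limit_entropy_def by (auto intro!: sum.neutral)
qed

section \<open>Normalization of the limit and comparison of entropies\<close>

definition normalized :: "'a measure" where
  "normalized = scale_measure (ennreal (1 / measure \<mu> UNIV)) \<mu>"

lemma sets_normalized [simp]: "sets normalized = sets borel"
  by (simp add: normalized_def)

lemma emeasure_normalized:
  assumes "measure \<mu> UNIV > 0"
  shows "emeasure normalized A = ennreal (measure \<mu> A / measure \<mu> UNIV)"
proof -
  have "emeasure normalized A = ennreal (1 / measure \<mu> UNIV) * ennreal (measure \<mu> A)"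
    by (simp add: normalized_def emeasure_eq_measure)
  also have "\<dots> = ennreal (1 / measure \<mu> UNIV * measure \<mu> A)"
    by (rule ennreal_mult[symmetric]) auto
  finally show ?thesis by simp
qed

lemma measure_normalized: "measure \<mu> UNIV > 0 \<Longrightarrow> measure normalized A = measure \<mu> A / measure \<mu> UNIV"
  unfolding measure_def[of normalized] emeasure_normalized by simp

lemma
  assumes pos: "measure \<mu> UNIV > 0"
  shows radon_normalized: "radon_prob normalized"
    and invariant_normalized: "invariant_measure T normalized"
proof -
  have sp: "space normalized = UNIV" using sets_eq_imp_space_eq[OF sets_normalized] by simp
  note em = emeasure_normalized[OF pos]
  have mono: "measure \<mu> A \<le> measure \<mu> B \<Longrightarrow> emeasure normalized A \<le> emeasure normalized B" for A B
    unfolding em using pos by (intro ennreal_leI divide_right_mono) auto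
  have approx: "emeasure normalized A \<le> emeasure normalized B + ennreal e"
    if "measure \<mu> A < measure \<mu> B + e * measure \<mu> UNIV" "e > 0" for A B e
  proof -
    have "measure \<mu> A / measure \<mu> UNIV \<le> measure \<mu> B / measure \<mu> UNIV + e"
      using that pos by (simp add: field_simps)
    then show ?thesis unfolding em using that by (simp flip: ennreal_plus)
  qed
  show "radon_prob normalized"
    unfolding radon_prob_def
  proof (intro conjI ballI)
    show "prob_space normalized"
      by (rule prob_spaceI) (use pos in \<open>simp add: sp em\<close>)
    fix A :: "'a set" assume A: "A \<in> sets borel"
    show "emeasure normalized A = (SUP K\<in>{K. compact K \<and> K \<subseteq> A}. emeasure normalized K)" (is "_ = ?S")
    proof (rule antisym)
      show "emeasure normalized A \<le> ?S"
      proof (rule ennreal_le_epsilon)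
        fix e :: real assume e: "0 < e"
        obtain K where K: "compact K" "K \<subseteq> A" "measure \<mu> A < measure \<mu> K + e * measure \<mu> UNIV"
          by (rule inner_regular[OF A, of "e * measure \<mu> UNIV"]) (use e pos in auto)
        have "emeasure normalized A \<le> emeasure normalized K + ennreal e" by (rule approx[OF K(3) e])
        also have "\<dots> \<le> ?S + ennreal e"
          using K by (intro add_right_mono SUP_upper) auto
        finally show "emeasure normalized A \<le> ?S + ennreal e" .
      qed
      show "?S \<le> emeasure normalized A"
        using A by (intro SUP_least mono finite_measure_mono) auto
    qed
    show "emeasure normalized A = (INF U\<in>{U. open U \<and> A \<subseteq> U}. emeasure normalized U)" (is "_ = ?I")
    proof (rule antisym)
      show "?I \<le> emeasure normalized A"
      proof (rule ennreal_le_epsilon)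
        fix e :: real assume e: "0 < e"
        then have "e * measure \<mu> UNIV > 0" using pos by simp
        then obtain G where G: "open G" "A \<subseteq> G" "measure \<mu> G < measure \<mu> A + e * measure \<mu> UNIV"
          using outer_regular[OF A] by blast
        have "?I \<le> emeasure normalized G"
          using G by (intro INF_lower) auto
        also have "\<dots> \<le> emeasure normalized A + ennreal e" by (rule approx[OF G(3) e])
        finally show "?I \<le> emeasure normalized A + ennreal e" .
      qed
      show "emeasure normalized A \<le> ?I"
        by (intro INF_greatest mono finite_measure_mono) auto
    qed
  qed simp
  show "invariant_measure T normalized"
    unfolding invariant_measure_def using vimage_borel measure_vimage_T by (simp add: em)
qed

text \<open>Subadditivity of \<open>- x * ln x\<close> separates the escaping mass from
  \<open>far n\<close>, and rescaling by the mass \<open>m\<close> brings in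
  \<open>- m * ln m\<close>. This and \<open>- (1 - m) * ln (1 - m)\<close> are at most 1 each,
  whence 2 for every \<open>n\<close>.\<close>

lemma limit_entropy_le:
  assumes pos: "measure \<mu> UNIV > 0"
  shows "limit_entropy n \<le> measure \<mu> UNIV * shannon normalized (itinerary label T n) + 2"
proof -
  let ?m = "measure \<mu> UNIV"
  define \<nu> where "\<nu> l = measure normalized (itinerary label T n -` {l})" for l
  interpret N: prob_space normalized using radon_normalized[OF pos] by (simp add: radon_prob_def)
  have sp: "space normalized = UNIV" using sets_eq_imp_space_eq[OF sets_normalized] by simp
  have \<nu>0: "\<nu> l \<ge> 0" for l by (simp add: \<nu>_def)
  have sum1: "(\<Sum>l\<in>words n. \<nu> l) = 1"
    using sum_measure_words[OF N.finite_measure_axioms, of n] itinerary_measurable N.prob_space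
    by (simp add: \<nu>_def sp)
  have H: "shannon normalized (itinerary label T n) = - (\<Sum>l\<in>words n. \<nu> l * ln (\<nu> l))"
    by (subst N.shannon_superset[OF finite_words[of n]]) (auto simp: \<nu>_def sp words_def)
  have lp: "limit_prob n l = ?m * \<nu> l + (if l = far n then 1 - ?m else 0)" for l
    using pos by (simp add: limit_prob_def \<nu>_def measure_normalized)
  have "- (limit_prob n l * ln (limit_prob n l)) \<le>
      ?m * (- (\<nu> l * ln (\<nu> l))) - (?m * ln ?m) * \<nu> l + (if l = far n then - ((1 - ?m) * ln (1 - ?m)) else 0)" for l
  proof -
    have "- ((?m * \<nu> l) * ln (?m * \<nu> l)) = ?m * (- (\<nu> l * ln (\<nu> l))) - (?m * ln ?m) * \<nu> l"
      using pos \<nu>0[of l] by (cases "\<nu> l = 0") (auto simp: ln_mult algebra_simps)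
    moreover have "- (limit_prob n l * ln (limit_prob n l)) \<le> - ((?m * \<nu> l) * ln (?m * \<nu> l)) + (if l = far n then - ((1 - ?m) * ln (1 - ?m)) else 0)"
    proof (cases "l = far n")
      case True
      then have "limit_prob n l = ?m * \<nu> l + (1 - ?m)" by (simp add: lp)
      moreover have "(?m * \<nu> l) * ln (?m * \<nu> l) + (1 - ?m) * ln (1 - ?m) \<le> (?m * \<nu> l + (1 - ?m)) * ln (?m * \<nu> l + (1 - ?m))"
        using \<nu>0[of l] mass_le_1 by (intro xlnx_superadd) auto
      ultimately show ?thesis using True by simp
    qed (simp add: lp)
    ultimately show ?thesis by simp
  qed
  then have "limit_entropy n \<le> (\<Sum>l\<in>words n. ?m * (- (\<nu> l * ln (\<nu> l))) - (?m * ln ?m) * \<nu> l + (if l = far n then - ((1 - ?m) * ln (1 - ?m)) else 0))"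
    unfolding limit_entropy_def sum_negf[symmetric] by (intro sum_mono) auto
  also have "\<dots> = ?m * shannon normalized (itinerary label T n) - ?m * ln ?m - (1 - ?m) * ln (1 - ?m)"
  proof -
    have "(\<Sum>l\<in>words n. if l = far n then - ((1 - ?m) * ln (1 - ?m)) else 0) = - ((1 - ?m) * ln (1 - ?m))"
      using finite_words by (subst sum.delta) (auto simp: words_def)
    then show ?thesis
      by (simp add: sum.distrib sum_subtractf H sum_negf flip: sum_distrib_left) (simp add: sum1)
  qed
  also have "\<dots> \<le> ?m * shannon normalized (itinerary label T n) + 2"
    using xlnx_ge[of ?m] xlnx_ge[of "1 - ?m"] mass_le_1 by simp
  finally show ?thesis .
qed

lemma simple_function_label: "simple_function normalized label"
proof -
  have "space normalized = UNIV" using sets_eq_imp_space_eq[OF sets_normalized] by simp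
  then show ?thesis using finite_range_label label_measurable by (simp add: simple_function_def)
qed

lemma rate_label_ge:
  assumes h: "0 \<le> h" and le: "\<And>n. n \<ge> 1 \<Longrightarrow> real n * h \<le> limit_entropy n"
  shows "h = 0 \<or> (\<exists>\<nu>. radon_prob \<nu> \<and> invariant_measure T \<nu> \<and> ereal h \<le> ks_entropy \<nu> T)"
proof (cases "measure \<mu> UNIV = 0")
  case True
  then show ?thesis using le[of 1] h limit_entropy_mass_0[OF True, of 1] by simp
next
  case False
  let ?m = "measure \<mu> UNIV"
  have pos: "?m > 0" using False by (simp add: zero_less_measure_iff)
  note \<nu> = radon_normalized[OF pos] invariant_normalized[OF pos]
  have mp: "measure_preserving normalized T" by (rule measure_preserving_of_invariant[OF cont \<nu>])
  interpret mp: measure_preserving normalized T by (rule mp)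
  have "(\<lambda>n. ?m * (shannon normalized (itinerary label T n) / real n) + 2 * (1 / real n)) \<longlonglongrightarrow> ?m * mp.rate label + 2 * 0"
    by (intro tendsto_intros mp.rate_tendsto simple_function_label lim_1_over_n)
  moreover have "\<forall>\<^sub>F n in sequentially. h \<le> ?m * (shannon normalized (itinerary label T n) / real n) + 2 * (1 / real n)"
    using eventually_ge_at_top[of 1]
  proof eventually_elim
    case (elim n)
    then have "real n * h \<le> ?m * shannon normalized (itinerary label T n) + 2"
      using le[of n] limit_entropy_le[OF pos, of n] by simp
    then show ?case using elim by (simp add: field_simps)
  qed
  ultimately have "h \<le> ?m * mp.rate label + 2 * 0"
    by (rule tendsto_lowerbound) simp
  also have "\<dots> \<le> mp.rate label"
    using mp.rate_nonneg[OF simple_function_label] mass_le_1 by (simp add: mult_left_le_one_le)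
  finally have "ereal h \<le> ereal (mp.rate label)" by simp
  also have "\<dots> \<le> ks_entropy normalized T"
    by (rule rate_le_ks_entropy[OF sets_normalized simple_function_label mp])
  finally show ?thesis using \<nu> by blast
qed

end

context compactification_metric
begin

lemma cover_entropy_le_ks:
  fixes T :: "'a \<Rightarrow> 'a"
  assumes T: "continuous_on UNIV T" and A: "admissible_open_cover A"
  shows "cover_entropy T A = 0 \<or> (\<exists>\<nu>. radon_prob \<nu> \<and> invariant_measure T \<nu> \<and> ereal (cover_entropy T A) \<le> ks_entropy \<nu> T)"
proof -
  obtain A' where A': "A' \<subseteq> A" "finite A'" "\<Union>A' = UNIV" using admissible_finite_subcover[OF A] .
  obtain \<delta> where \<delta>: "\<delta> > 0" "\<And>x. \<exists>a\<in>A. \<forall>y. d x y < \<delta> \<longrightarrow> y \<in> a"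
    using lebesgue_number[OF compatible_d A] by blast
  \<comment> \<open>This preliminary labelling only bounds the separated sets. The labelling used
    for the entropy needs spheres that are null for \<open>\<mu>\<close>, so it is chosen once the
    limit is known.\<close>
  obtain B where B: "admissible_open_cover B" "finite B" "\<And>a x y. a \<in> B \<Longrightarrow> x \<in> a \<Longrightarrow> y \<in> a \<Longrightarrow> d x y < \<delta>"
    using small_admissible_cover[OF \<delta>(1)] by blast
  have "\<exists>b. b \<in> B \<and> x \<in> b" for x using B(1) unfolding admissible_open_cover_def by blast
  then obtain f0 where f0: "\<And>x. f0 x \<in> B" "\<And>x. x \<in> f0 x" by metis
  have fin0: "finite (range f0)" using f0(1) by (intro finite_subset[OF _ B(2)]) auto
  have small0: "d x y < \<delta>" if "f0 x = f0 y" for x y using B(3)[OF f0(1) f0(2)] f0(2)[of y] that by metis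
  have "\<exists>E. finite E \<and> E \<noteq> {} \<and> (\<forall>x\<in>E. \<forall>y\<in>E. x \<noteq> y \<longrightarrow> (\<exists>j<Suc k. \<delta> \<le> d ((T ^^ j) x) ((T ^^ j) y))) \<and>
      N_cover (cover_iter T A (Suc k)) \<le> card E" for k
    by (rule ex_separated_spanning[of A d \<delta> f0 "Suc k" T, OF \<delta>(2)])
       (use \<delta>(1) D.commute fin0 small0 in auto)
  then obtain E where E: "\<And>k. finite (E k)" "\<And>k. E k \<noteq> {}"
    and sep: "\<And>k x y. x \<in> E k \<Longrightarrow> y \<in> E k \<Longrightarrow> x \<noteq> y \<Longrightarrow> \<exists>j<Suc k. \<delta> \<le> d ((T ^^ j) x) ((T ^^ j) y)"
    and N_le: "\<And>k. N_cover (cover_iter T A (Suc k)) \<le> card (E k)" by metis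
  define p where "p k = orbit_pmf T (Suc k) (E k)" for k
  obtain r \<mu> where r: "strict_mono r" and \<mu>: "sets \<mu> = sets borel" "finite_measure \<mu>" "measure \<mu> UNIV \<le> 1"
    "\<And>G e. open G \<Longrightarrow> e > 0 \<Longrightarrow> \<forall>\<^sub>F n in sequentially. measure \<mu> G - e < measure_pmf.prob (p (r n)) G"
    "\<And>K e. compact K \<Longrightarrow> e > 0 \<Longrightarrow> \<forall>\<^sub>F n in sequentially. measure_pmf.prob (p (r n)) K < measure \<mu> K + e"
    "\<And>A e. A \<in> sets borel \<Longrightarrow> e > 0 \<Longrightarrow> \<exists>G. open G \<and> A \<subseteq> G \<and> measure \<mu> G < measure \<mu> A + e"
    by (rule vague_limit[of p]) blast
  define c where "c n = 1 / real (Suc (r n))" for n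
  have c0: "c \<longlonglongrightarrow> 0"
    using LIMSEQ_subseq_LIMSEQ[OF LIMSEQ_Suc[OF lim_1_over_n] r] by (simp add: c_def[abs_def] o_def)
  interpret finite_measure \<mu> by (rule \<mu>(2))
  interpret V: vague_orbit_limit D \<mu> T "\<lambda>n. p (r n)" c
  proof
    show "\<bar>measure_pmf.prob (p (r n)) (T -` S) - measure_pmf.prob (p (r n)) S\<bar> \<le> c n" for n S
      unfolding p_def c_def by (rule prob_orbit_pmf_vimage) (use E in auto)
  qed (use \<mu> T c0 in auto)
  have "\<exists>\<rho>. \<delta> / 4 < \<rho> \<and> \<rho> < \<delta> / 2 \<and> measure \<mu> {x. D q (Some x) = \<rho>} = 0" for q
    using ex_null_radius[OF \<mu>(2,1) \<delta>(1), of q] by blast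
  then obtain \<rho> where \<rho>: "\<And>q. \<delta> / 4 < \<rho> q" "\<And>q. \<rho> q < \<delta> / 2" "\<And>q. measure \<mu> {x. D q (Some x) = \<rho> q} = 0"
    by metis
  have \<rho>0: "\<rho> q > 0" for q using \<rho>(1)[of q] \<delta>(1) by simp
  obtain P where P: "finite P" "None \<in> P" "\<And>x. \<exists>q\<in>P. D q (Some x) < \<rho> q"
    by (rule finite_ball_cover[of \<rho>, OF \<rho>0]) blast
  interpret W: null_boundary_partition D \<mu> T "\<lambda>n. p (r n)" c P \<rho>
    by unfold_locales (use P \<rho>0 \<rho>(3) in auto)
  have label_small: "d x y < \<delta>" if same: "W.label x = W.label y" for x y
  proof -
    obtain q where "D q (Some x) < \<rho> q" "D q (Some y) < \<rho> q" using W.label_small[OF same] by blast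
    then show ?thesis
      using D.triangle[of "Some x" q "Some y"] \<rho>(2)[of q] by (simp add: D.commute)
  qed
  have inj: "inj_on (itinerary W.label T (Suc k)) (E k)" for k
  proof (rule inj_onI, rule ccontr)
    fix x y assume xy: "x \<in> E k" "y \<in> E k" "itinerary W.label T (Suc k) x = itinerary W.label T (Suc k) y" "x \<noteq> y"
    obtain j where j: "j < Suc k" "\<delta> \<le> d ((T ^^ j) x) ((T ^^ j) y)" using sep[OF xy(1,2,4)] by blast
    have "d ((T ^^ j) x) ((T ^^ j) y) < \<delta>"
      using xy(3) j(1) by (intro label_small) (simp add: itinerary_eq_iff)
    with j show False by simp
  qed
  let ?a = "\<lambda>n. ln (real (N_cover (cover_iter T A n))) / real n"
  have a_lim: "(\<lambda>n. ?a (Suc (r n))) \<longlonglongrightarrow> cover_entropy T A"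
    using LIMSEQ_subseq_LIMSEQ[OF LIMSEQ_Suc[OF cover_entropy_tendsto[OF A', of T]] r] by (simp add: o_def)
  \<comment> \<open>With the window length \<open>q\<close> fixed, the orbit length tends to
    infinity and the initial-window term, proportional to \<open>c n\<close>, vanishes.\<close>
  have "real q * cover_entropy T A \<le> W.limit_entropy q" if q: "q \<ge> 1" for q
  proof -
    let ?C = "(real q)\<^sup>2 * ln (card (range W.label))"
    have "real q * ?a (Suc (r n)) \<le> ?C * c n + shannon (measure_pmf (p (r n))) (itinerary W.label T q)" for n
    proof -
      let ?N = "Suc (r n)"
      have "ln (real (N_cover (cover_iter T A ?N))) \<le> ln (card (E (r n)))"
        using N_le[of "r n"] N_cover_iter_pos[OF A', of T ?N] by simp
      then have "real q * ln (real (N_cover (cover_iter T A ?N))) \<le> real q * ln (card (E (r n)))"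
        by (rule mult_left_mono) simp
      also have "\<dots> \<le> ?C + real ?N * shannon (measure_pmf (p (r n))) (itinerary W.label T q)"
        unfolding p_def
        by (rule ln_card_le_shannon_orbit_pmf[OF E _ W.finite_range_label q inj]) simp
      finally have "real q * ln (real (N_cover (cover_iter T A ?N))) / ?N \<le> (?C + real ?N * shannon (measure_pmf (p (r n))) (itinerary W.label T q)) / ?N"
        by (rule divide_right_mono) simp
      then show ?thesis by (simp add: add_divide_distrib c_def del: of_nat_Suc)
    qed
    moreover have "(\<lambda>n. real q * ?a (Suc (r n))) \<longlonglongrightarrow> real q * cover_entropy T A"
      by (intro tendsto_intros a_lim)
    moreover have "(\<lambda>n. ?C * c n + shannon (measure_pmf (p (r n))) (itinerary W.label T q)) \<longlonglongrightarrow> ?C * 0 + W.limit_entropy q"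
      by (intro tendsto_intros c0 W.shannon_tendsto)
    ultimately have "real q * cover_entropy T A \<le> ?C * 0 + W.limit_entropy q"
      by (intro LIMSEQ_le) auto
    then show ?thesis by simp
  qed
  then show ?thesis using W.rate_label_ge[OF cover_entropy_nonneg[OF A']] by blast
qed

end

section \<open>The bound by Bowen entropy\<close>

lemma ex_small_xlnx:
  fixes e :: real
  assumes "e > 0"
  obtains \<eta> where "\<eta> > 0" "\<And>x. 0 \<le> x \<Longrightarrow> x < \<eta> \<Longrightarrow> - (x * ln x) \<le> e"
proof -
  have "((\<lambda>x::real. - (x * ln x)) \<longlongrightarrow> 0) (at_right 0)" by real_asymp
  then have "\<forall>\<^sub>F x in at_right 0. - (x * ln x :: real) < e" using assms by (rule order_tendstoD)
  then obtain \<eta> where \<eta>: "\<eta> > 0" "\<And>x. 0 < x \<Longrightarrow> x < \<eta> \<Longrightarrow> - (x * ln x :: real) < e"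
    unfolding eventually_at_right_field by blast
  show ?thesis
  proof (rule that[OF \<eta>(1)])
    fix x :: real assume "0 \<le> x" "x < \<eta>"
    then show "- (x * ln x) \<le> e" using \<eta>(2)[of x] assms by (cases "x = 0") auto
  qed
qed

lemma radon_prob_inner:
  assumes "radon_prob \<mu>" "A \<in> sets borel" "e > 0"
  obtains K where "compact K" "K \<subseteq> A" "measure \<mu> A < measure \<mu> K + e"
proof -
  interpret prob_space \<mu> using assms by (simp add: radon_prob_def)
  have "emeasure \<mu> A = (SUP K\<in>{K. compact K \<and> K \<subseteq> A}. emeasure \<mu> K)"
    using assms by (simp add: radon_prob_def)
  also have "emeasure \<mu> A = ennreal (measure \<mu> A)" by (rule emeasure_eq_measure)
  finally have sup: "(SUP K\<in>{K. compact K \<and> K \<subseteq> A}. emeasure \<mu> K) = ennreal (measure \<mu> A)" by simp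
  show ?thesis
  proof (cases "measure \<mu> A - e < 0")
    case True
    then show ?thesis using measure_nonneg[of \<mu> "{}"] by (intro that[of "{}"]) auto
  next
    case False
    then have "ennreal (measure \<mu> A - e) < (SUP K\<in>{K. compact K \<and> K \<subseteq> A}. emeasure \<mu> K)"
      unfolding sup using assms(3) by (intro ennreal_lessI) auto
    then obtain K where K: "compact K" "K \<subseteq> A" "ennreal (measure \<mu> A - e) < emeasure \<mu> K"
      unfolding less_SUP_iff by blast
    then have "measure \<mu> A - e < measure \<mu> K" using False by (simp add: emeasure_eq_measure ennreal_less_iff)
    then show ?thesis using K by (intro that[of K]) auto
  qed
qed

lemma card_words_le:
  assumes "\<And>j. j < n \<Longrightarrow> finite (Q j) \<and> card (Q j) \<le> 2"
  shows "finite {w. length w = n \<and> (\<forall>j<n. w ! j \<in> Q j)} \<and> card {w. length w = n \<and> (\<forall>j<n. w ! j \<in> Q j)} \<le> 2 ^ n"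
proof -
  let ?W = "{w. length w = n \<and> (\<forall>j<n. w ! j \<in> Q j)}"
  let ?P = "PiE {..<n} Q"
  have sub: "?W \<subseteq> (\<lambda>\<phi>. map \<phi> [0..<n]) ` ?P"
  proof
    fix w assume w: "w \<in> ?W"
    then have "w = map (restrict ((!) w) {..<n}) [0..<n]" by (intro nth_equalityI) auto
    moreover have "restrict ((!) w) {..<n} \<in> ?P" using w by auto
    ultimately show "w \<in> (\<lambda>\<phi>. map \<phi> [0..<n]) ` ?P" by blast
  qed
  have fin: "finite ?P" using assms by (intro finite_PiE) auto
  have "card ?W \<le> card ((\<lambda>\<phi>. map \<phi> [0..<n]) ` ?P)" using fin sub by (intro card_mono) auto
  also have "\<dots> \<le> card ?P" by (rule card_image_le[OF fin])
  also have "\<dots> = (\<Prod>j<n. card (Q j))" by (rule card_PiE) simp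
  also have "\<dots> \<le> (\<Prod>j<n. 2)" using assms by (intro prod_mono) auto
  finally have "card ?W \<le> 2 ^ n" by simp
  moreover have "finite ?W" by (rule finite_subset[OF sub]) (use fin in simp)
  ultimately show ?thesis by blast
qed

text \<open>The values split into few likely ones, \<open>W0\<close>, and many of total probability
  at most \<open>\<kappa>\<close>. By concavity a group of probability \<open>s\<close> with at most
  \<open>b\<close> members contributes at most \<open>s * ln b + 1\<close>; the two groups account
  for the 2.\<close>

lemma (in prob_space) shannon_le_split:
  assumes X: "simple_function M X" and W: "W0 \<subseteq> X ` space M" "W0 \<noteq> {}" "real (card W0) \<le> c"
    and k: "real (card (X ` space M)) \<le> k" and out: "prob {x \<in> space M. X x \<notin> W0} \<le> \<kappa>"
  shows "shannon M X \<le> ln c + \<kappa> * ln k + 2"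
proof -
  let ?p = "\<lambda>l. prob (X -` {l} \<inter> space M)"
  have fin: "finite (X ` space M)" using simple_functionD(1)[OF X] .
  have ms: "X -` {l} \<inter> space M \<in> events" for l using simple_functionD(2)[OF X] .
  have part: "(\<Sum>l\<in>U. - (?p l * ln (?p l))) \<le> prob {x \<in> space M. X x \<in> U} * ln b + 1"
    if U: "U \<subseteq> X ` space M" "real (card U) \<le> b" for U b
  proof (cases "U = {}")
    case False
    have finU: "finite U" using U fin finite_subset by blast
    then have cU: "card U \<ge> 1" using False by (simp add: Suc_le_eq card_gt_0_iff)
    let ?s = "\<Sum>l\<in>U. ?p l"
    have s: "?s = prob {x \<in> space M. X x \<in> U}"
    proof -
      have "?s = prob (\<Union>l\<in>U. X -` {l} \<inter> space M)"
        using finU ms by (intro finite_measure_finite_Union[symmetric]) (auto simp: disjoint_family_on_def)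
      also have "(\<Union>l\<in>U. X -` {l} \<inter> space M) = {x \<in> space M. X x \<in> U}" by auto
      finally show ?thesis .
    qed
    have s0: "?s \<ge> 0" by (intro sum_nonneg) simp
    have "(\<Sum>l\<in>U. - (?p l * ln (?p l))) \<le> - real (card U) * ((?s / card U) * ln (?s / card U))"
      by (rule sum_xlnx_average[OF finU False]) simp
    also have "\<dots> = - (?s * ln ?s) + ?s * ln (card U)"
      using cU s0 by (cases "?s = 0") (auto simp: ln_div algebra_simps)
    also have "\<dots> \<le> 1 + ?s * ln b"
    proof (intro add_mono mult_left_mono s0)
      show "- (?s * ln ?s) \<le> 1" by (rule xlnx_ge[OF s0])
      show "ln (card U) \<le> ln b" using U(2) cU by simp
    qed
    finally show ?thesis using s by simp
  qed simp
  have c1: "1 \<le> c"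
  proof -
    have "card W0 \<ge> 1" using W fin finite_subset by (auto simp: Suc_le_eq card_gt_0_iff)
    then show ?thesis using W(3) by linarith
  qed
  have k1: "1 \<le> k"
  proof -
    have "card (X ` space M) \<ge> 1" using fin not_empty by (auto simp: Suc_le_eq card_gt_0_iff)
    then show ?thesis using k by linarith
  qed
  have "shannon M X = (\<Sum>l\<in>W0. - (?p l * ln (?p l))) + (\<Sum>l\<in>X ` space M - W0. - (?p l * ln (?p l)))"
    using sum.subset_diff[OF W(1) fin, of "\<lambda>l. - (?p l * ln (?p l))"] by (simp add: shannon_def sum_negf)
  also have "\<dots> \<le> (prob {x \<in> space M. X x \<in> W0} * ln c + 1) + (prob {x \<in> space M. X x \<in> X ` space M - W0} * ln k + 1)"
  proof (intro add_mono part)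
    have "card (X ` space M - W0) \<le> card (X ` space M)" by (intro card_mono fin) auto
    then show "real (card (X ` space M - W0)) \<le> k" using k by linarith
  qed (use W in auto)
  also have "\<dots> \<le> (1 * ln c + 1) + (\<kappa> * ln k + 1)"
  proof (intro add_mono mult_right_mono order_refl)
    have "{x \<in> space M. X x \<in> X ` space M - W0} = {x \<in> space M. X x \<notin> W0}" by auto
    then show "prob {x \<in> space M. X x \<in> X ` space M - W0} \<le> \<kappa>" using out by simp
  qed (use c1 k1 in auto)
  finally show ?thesis by simp
qed

lemma open_bowen_ball:
  assumes d: "compatible_metric d" and T: "continuous_on UNIV T" and n: "n \<ge> 1"
  shows "open {y. bowen_dist d T n x y < e}"
proof -
  have "{y. bowen_dist d T n x y < e} = (\<Inter>j<n. (T ^^ j) -` {y. d ((T ^^ j) x) y < e})"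
    by (intro set_eqI) (simp add: bowen_dist_less_iff[OF n] Ball_def[of "{..<n}"])
  also have "open \<dots>" by (intro open_INT ballI open_vimage compatible_metric_open_ball[OF d] continuous_on_funpow[OF T]) simp
  finally show ?thesis .
qed

lemma bowen_ball_cover:
  assumes d: "compatible_metric d" and T: "continuous_on UNIV T" and n: "n \<ge> 1" and K: "compact K" and e: "e > 0"
  obtains B where "B \<subseteq> bowen_balls d T n e" "finite B" "K \<subseteq> \<Union>B" "card B = N_on K (bowen_balls d T n e)"
proof -
  interpret d: Metric_space UNIV d using d by (simp add: compatible_metric_def)
  have "x \<in> {y. bowen_dist d T n x y < e}" for x
    using e by (simp add: bowen_dist_less_iff[OF n])
  then have "K \<subseteq> (\<Union>x\<in>UNIV. {y. bowen_dist d T n x y < e})" by auto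
  then obtain S where S: "finite S" "K \<subseteq> (\<Union>x\<in>S. {y. bowen_dist d T n x y < e})"
    by (rule compactE_image[OF K, rotated]) (use open_bowen_ball[OF d T n] in auto)
  show ?thesis
  proof (rule N_on_obtain[of "(\<lambda>x. {y. bowen_dist d T n x y < e}) ` S" "bowen_balls d T n e" K])
    show "(\<lambda>x. {y. bowen_dist d T n x y < e}) ` S \<subseteq> bowen_balls d T n e"
      by (auto simp: bowen_balls_def)
  qed (use S that in auto)
qed

text \<open>The empty compact set needs no balls, and \<open>ln 0 = 0\<close>. This settles the case
  without invariant measures.\<close>

lemma bowen_entropy_nonneg:
  fixes d :: "'a::topological_space \<Rightarrow> 'a \<Rightarrow> real"
  shows "0 \<le> bowen_entropy d T"
proof -
  have "N_on {} A = 0" for A :: "'a set set"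
    using N_on_le[of "{}" A "{}"] by simp
  then have "limsup (\<lambda>n. ereal (ln (real (N_on {} (bowen_balls d T n 1))) / real n)) = limsup (\<lambda>n. ereal 0)"
    by simp
  also have "\<dots> = 0" by (simp add: Limsup_const)
  finally have "0 = limsup (\<lambda>n. ereal (ln (real (N_on {} (bowen_balls d T n 1))) / real n))" by simp
  then show ?thesis
    unfolding bowen_entropy_def by (intro SUP_upper2[of "(1, {})"]) auto
qed

text \<open>Each cell of \<open>g\<close> has a compact core \<open>K l\<close>. Recording the label
  only on the cores, or only off them, splits \<open>g\<close> into two variables that together
  determine it, the second of entropy at most 2.\<close>

lemma radon_compact_approx:
  fixes \<mu> :: "'a::topological_space measure"
  assumes \<mu>: "radon_prob \<mu>" and closed: "\<And>K :: 'a set. compact K \<Longrightarrow> closed K" and g: "simple_function \<mu> g"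
  obtains K where "\<And>l. compact (K l)" "\<And>x l. x \<in> K l \<Longrightarrow> g x = l"
    "simple_function \<mu> (\<lambda>x. if x \<in> K (g x) then Some (g x) else None)"
    "simple_function \<mu> (\<lambda>x. if x \<in> K (g x) then None else Some (g x))"
    "shannon \<mu> (\<lambda>x. if x \<in> K (g x) then None else Some (g x)) \<le> 2"
proof -
  interpret prob_space \<mu> using \<mu> by (simp add: radon_prob_def)
  have sets: "sets \<mu> = sets borel" using \<mu> by (simp add: radon_prob_def)
  have sp: "space \<mu> = UNIV" using sets_eq_imp_space_eq[OF sets] by simp
  let ?L = "range g"
  have fin: "finite ?L" using simple_functionD(1)[OF g] by (simp add: sp)
  define k where "k = real (card ?L)"
  have k: "k > 0" using fin by (simp add: k_def card_gt_0_iff)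
  have gb: "g -` {l} \<in> sets \<mu>" for l using simple_functionD(2)[OF g, of "{l}"] by (simp add: sp)
  \<comment> \<open>The \<open>k\<close> leftover pieces contribute at most \<open>1 / k\<close>
    each, and the value \<open>None\<close> at most 1.\<close>
  obtain \<eta> where \<eta>: "\<eta> > 0" "\<And>x. 0 \<le> x \<Longrightarrow> x < \<eta> \<Longrightarrow> - (x * ln x) \<le> 1 / k"
    using ex_small_xlnx[of "1 / k"] k by auto
  have "\<exists>K. compact K \<and> K \<subseteq> g -` {l} \<and> prob (g -` {l}) < prob K + \<eta>" for l
    using radon_prob_inner[OF \<mu> _ \<eta>(1), of "g -` {l}"] gb[of l] sets by metis
  then obtain K where K: "\<And>l. compact (K l)" "\<And>l. K l \<subseteq> g -` {l}" "\<And>l. prob (g -` {l}) < prob (K l) + \<eta>"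
    by metis
  have Kb: "K l \<in> sets \<mu>" for l using closed[OF K(1)] sets by simp
  have Kg: "g x = l" if "x \<in> K l" for x l using K(2)[of l] that by auto
  let ?R = "\<lambda>l. g -` {l} - K l"
  let ?h = "\<lambda>x. if x \<in> K (g x) then Some (g x) else None"
  let ?r = "\<lambda>x. if x \<in> K (g x) then None else Some (g x)"
  have pre: "{x. x \<in> K (g x)} = (\<Union>l\<in>?L. g -` {l} \<inter> K l)" by auto
  have m: "{x. x \<in> K (g x)} \<in> sets \<mu>" unfolding pre using fin gb Kb by (intro sets.finite_UN) auto
  have sfb: "simple_function \<mu> (\<lambda>x. x \<in> K (g x))"
  proof -
    have "(\<lambda>x. x \<in> K (g x)) -` {b} = (if b then {x. x \<in> K (g x)} else space \<mu> - {x. x \<in> K (g x)})" for b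
      by (auto simp: sp)
    then have "(\<lambda>x. x \<in> K (g x)) -` {b} \<in> sets \<mu>" for b using sets.compl_sets[OF m] m by simp
    then show ?thesis by (simp add: simple_function_def sp)
  qed
  note p = simple_function_Pair[OF sfb g]
  have h: "simple_function \<mu> ?h" and r: "simple_function \<mu> ?r"
    using simple_function_compose[OF p, of "\<lambda>(b, l). if b then Some l else None"]
      simple_function_compose[OF p, of "\<lambda>(b, l). if b then None else Some l"]
    by (simp_all add: o_def)
  have "?r -` {Some l} = ?R l" for l by (auto split: if_splits)
  then have R: "prob (?r -` {Some l}) = prob (?R l)" for l by simp
  have "shannon \<mu> ?r = (\<Sum>v\<in>insert None (Some ` ?L). - (prob (?r -` {v}) * ln (prob (?r -` {v}))))"
    by (subst shannon_superset[of "insert None (Some ` ?L)"]) (use fin in \<open>auto simp: sum_negf sp\<close>)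
  also have "\<dots> = - (prob (?r -` {None}) * ln (prob (?r -` {None}))) + (\<Sum>v\<in>Some ` ?L. - (prob (?r -` {v}) * ln (prob (?r -` {v}))))"
    using fin by (intro sum.insert) auto
  also have "\<dots> = - (prob (?r -` {None}) * ln (prob (?r -` {None}))) + (\<Sum>l\<in>?L. - (prob (?R l) * ln (prob (?R l))))"
    by (subst sum.reindex) (simp_all only: inj_Some inj_on_subset[OF inj_Some] o_def R subset_UNIV)
  also have "\<dots> \<le> 1 + (\<Sum>l\<in>?L. 1 / k)"
  proof (intro add_mono sum_mono xlnx_ge)
    fix l
    have "prob (?R l) = prob (g -` {l}) - prob (K l)"
      using gb[of l] Kb[of l] K(2)[of l] by (intro finite_measure_Diff) auto
    then have "prob (?R l) < \<eta>" using K(3)[of l] by simp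
    then show "- (prob (?R l) * ln (prob (?R l))) \<le> 1 / k" by (intro \<eta>(2)) simp_all
  qed simp
  also have "\<dots> = 2" using k by (simp add: k_def)
  finally show ?thesis using that[OF K(1) Kg h r] by blast
qed

text \<open>Near the centre of a \<open>\<delta>\<close>-ball \<open>h\<close> takes at most one
  value besides \<open>None\<close>, so a Bowen ball meets at most \<open>2 ^ n\<close> words. Order
  \<open>n * m\<close> for \<open>T\<close> controls \<open>n\<close> steps of \<open>T ^^ m\<close>
  without uniform continuity.\<close>

lemma card_itineraries_le:
  fixes d :: "'a::topological_space \<Rightarrow> 'a \<Rightarrow> real"
  assumes d: "compatible_metric d" and T: "continuous_on UNIV T" and \<delta>: "\<delta> > 0"
    and q: "\<And>x y. d x y < \<delta> \<Longrightarrow> h y \<in> {None, Some (q x)}" and nm: "n \<ge> 1" "m \<ge> 1" and K: "compact K"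
  shows "card (itinerary h (T ^^ m) n ` K) \<le> N_on K (bowen_balls d T (n * m) \<delta>) * 2 ^ n"
proof -
  have nm1: "n * m \<ge> 1" using nm by simp
  obtain B where B: "B \<subseteq> bowen_balls d T (n * m) \<delta>" "finite B" "K \<subseteq> \<Union>B"
     "card B = N_on K (bowen_balls d T (n * m) \<delta>)"
    by (rule bowen_ball_cover[OF d T nm1 K \<delta>])
  let ?X = "itinerary h (T ^^ m) n"
  have ball: "finite (?X ` \<beta>) \<and> card (?X ` \<beta>) \<le> 2 ^ n" if \<beta>: "\<beta> \<in> B" for \<beta>
  proof -
    obtain x where x: "\<beta> = {y. bowen_dist d T (n * m) x y < \<delta>}" using B(1) \<beta> by (auto simp: bowen_balls_def)
    let ?W = "{w. length w = n \<and> (\<forall>j<n. w ! j \<in> {None, Some (q ((T ^^ (m * j)) x))})}"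
    have "?X y \<in> ?W" if y: "y \<in> \<beta>" for y
    proof -
      have "h (((T ^^ m) ^^ j) y) \<in> {None, Some (q ((T ^^ (m * j)) x))}" if "j < n" for j
      proof -
        have "m * j < n * m" using that nm by (simp add: mult.commute)
        then have "d ((T ^^ (m * j)) x) ((T ^^ (m * j)) y) < \<delta>"
          using y unfolding x by (simp add: bowen_dist_less_iff[OF nm1])
        from q[OF this] show ?thesis by (simp add: funpow_mult)
      qed
      then show ?thesis by (simp add: nth_itinerary)
    qed
    then have sub: "?X ` \<beta> \<subseteq> ?W" by (rule image_subsetI)
    have W: "finite ?W \<and> card ?W \<le> 2 ^ n" by (rule card_words_le) simp
    show ?thesis
      using card_mono[OF conjunct1[OF W] sub] conjunct2[OF W] finite_subset[OF sub conjunct1[OF W]]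
      by (intro conjI) (assumption, rule le_trans)
  qed
  have "?X ` K \<subseteq> (\<Union>\<beta>\<in>B. ?X ` \<beta>)" using image_mono[OF B(3), of ?X] by (simp add: image_Union)
  then have "card (?X ` K) \<le> card (\<Union>\<beta>\<in>B. ?X ` \<beta>)" using B(2) ball by (intro card_mono finite_UN_I) auto
  also have "\<dots> \<le> (\<Sum>\<beta>\<in>B. card (?X ` \<beta>))" by (rule card_UN_le[OF B(2)])
  also have "\<dots> \<le> (\<Sum>\<beta>\<in>B. 2 ^ n)" using ball by (intro sum_mono) auto
  also have "\<dots> = card B * 2 ^ n" by simp
  finally show ?thesis by (simp add: B(4))
qed

text \<open>The point is that 3 depends on neither \<open>m\<close> nor \<open>g\<close>, although
  the cores and \<open>\<delta>\<close> do. It covers 2 for the leftover labels and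
  \<open>ln 2 <= 1\<close> for the two choices per letter.\<close>

lemma rate_funpow_le:
  fixes d :: "'a::topological_space \<Rightarrow> 'a \<Rightarrow> real"
  assumes d: "compatible_metric d" and T: "continuous_on UNIV T"
    and \<mu>: "radon_prob \<mu>" "invariant_measure T \<mu>"
    and b: "bowen_entropy d T \<le> ereal b" and m: "m \<ge> 1" and g: "simple_function \<mu> g"
  shows "measure_preserving.rate \<mu> (T ^^ m) g \<le> real m * b + 3"
proof -
  interpret measure_preserving \<mu> T by (rule measure_preserving_of_invariant[OF T \<mu>])
  interpret S: measure_preserving \<mu> "T ^^ m" by (rule measure_preserving_funpow)
  note closed = Hausdorff_imp_compact_closed[OF compatible_metric_imp_Hausdorff[OF d]]
  have sets: "sets \<mu> = sets borel" using \<mu> by (simp add: radon_prob_def)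
  let ?L = "range g"
  have finL: "finite ?L" using simple_functionD(1)[OF g] by simp
  obtain K where K: "\<And>l. compact (K l)" and Kg: "\<And>x l. x \<in> K l \<Longrightarrow> g x = l"
    and sh: "simple_function \<mu> (\<lambda>x. if x \<in> K (g x) then Some (g x) else None)"
    and sr: "simple_function \<mu> (\<lambda>x. if x \<in> K (g x) then None else Some (g x))"
    and Hr: "shannon \<mu> (\<lambda>x. if x \<in> K (g x) then None else Some (g x)) \<le> 2"
    by (rule radon_compact_approx[OF \<mu>(1) closed g]) blast+
  let ?h = "\<lambda>x. if x \<in> K (g x) then Some (g x) else None"
  let ?r = "\<lambda>x. if x \<in> K (g x) then None else Some (g x)"
  have finh: "finite (range ?h)" using simple_functionD(1)[OF sh] by simp
  define k where "k = real (card (range ?h))"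
  have "card (range ?h) > 0" unfolding card_gt_0_iff using finh by blast
  then have k1: "k \<ge> 1" unfolding k_def by linarith
  \<comment> \<open>Each member omits all cores but one, so a Lebesgue number of this cover is a
    radius at which balls meet at most one core.\<close>
  let ?A = "(\<lambda>l. UNIV - (\<Union>l'\<in>?L - {l}. K l')) ` ?L"
  have cover: "admissible_open_cover ?A"
    unfolding admissible_open_cover_def
  proof (intro conjI ballI)
    fix a assume "a \<in> ?A"
    then obtain l where "a = UNIV - (\<Union>l'\<in>?L - {l}. K l')" by blast
    moreover have "closed (\<Union>l'\<in>?L - {l}. K l')" using finL closed K by (intro closed_UN) auto
    ultimately show "open a" by (simp only: open_Diff open_UNIV)
  next
    have "x \<in> UNIV - (\<Union>l'\<in>?L - {g x}. K l')" for x
    proof -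
      have "x \<notin> K l'" if "l' \<noteq> g x" for l' using Kg[of x l'] that by blast
      then show ?thesis by simp
    qed
    then show "\<Union>?A = UNIV" by blast
  next
    have "compact (\<Union>l'\<in>?L - {g undefined}. K l')" using finL K by (intro compact_UN) auto
    then show "\<exists>a\<in>?A. compact (UNIV - a)"
      by (intro bexI[of _ "UNIV - (\<Union>l'\<in>?L - {g undefined}. K l')"]) (auto simp: double_diff)
  qed
  obtain \<delta> where \<delta>: "\<delta> > 0" "\<And>x. \<exists>a\<in>?A. \<forall>y. d x y < \<delta> \<longrightarrow> y \<in> a"
    by (rule lebesgue_number[OF d cover]) blast
  have "\<exists>l. \<forall>y. d x y < \<delta> \<longrightarrow> ?h y \<in> {None, Some l}" for x
  proof -
    obtain l where l: "\<And>y. d x y < \<delta> \<Longrightarrow> y \<in> UNIV - (\<Union>l'\<in>?L - {l}. K l')" using \<delta>(2)[of x] by blast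
    have "g y = l" if "d x y < \<delta>" "y \<in> K (g y)" for y using l[OF that(1)] that(2) by blast
    then show ?thesis by (intro exI[of _ l]) simp
  qed
  then obtain q where q: "\<And>x y. d x y < \<delta> \<Longrightarrow> ?h y \<in> {None, Some (q x)}" by metis
  \<comment> \<open>Words met on \<open>K0\<close> are counted by Bowen balls; the others have
    probability at most \<open>\<kappa>\<close> and number at most \<open>k ^ n\<close>. The rate
    lies below every quotient, so one suitable \<open>n\<close> suffices.\<close>
  have bound: "S.rate g \<le> 2 + real m * (b + \<epsilon>) + ln 2 + \<kappa> * ln k + 2 * (1 / real n)"
    if \<kappa>: "0 < \<kappa>" "\<kappa> < 1" and n: "n \<ge> 1" and K0: "compact K0" "1 < prob K0 + \<kappa>"
      and lim: "ln (real (N_on K0 (bowen_balls d T (n * m) \<delta>))) / real (n * m) < b + \<epsilon>" for \<kappa> \<epsilon> K0 n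
  proof -
    let ?N = "N_on K0 (bowen_balls d T (n * m) \<delta>)"
    have nm: "n * m \<ge> 1" using n m by simp
    let ?X = "itinerary ?h (T ^^ m) n" and ?Y = "itinerary ?r (T ^^ m) n"
    note sX = S.simple_function_itinerary[OF sh, of n] and sY = S.simple_function_itinerary[OF sr, of n]
    have "K0 \<noteq> {}" using K0(2) \<kappa> by auto
    have c: "real (card (?X ` K0)) \<le> real ?N * 2 ^ n"
      using of_nat_mono[OF card_itineraries_le[OF d T \<delta>(1) q n m K0(1)], where 'a=real] by simp
    have "real (card (range ?X)) \<le> k ^ n"
      using of_nat_mono[OF card_range_itinerary_le[OF finh, of "T ^^ m" n], where 'a=real] by (simp add: k_def)
    moreover have "prob {x \<in> space \<mu>. ?X x \<notin> ?X ` K0} \<le> \<kappa>"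
    proof -
      have K0s: "K0 \<in> events" using closed[OF K0(1)] sets by simp
      have "prob {x \<in> space \<mu>. ?X x \<notin> ?X ` K0} \<le> prob (space \<mu> - K0)"
        using sets.compl_sets[OF K0s] by (intro finite_measure_mono) auto
      also have "\<dots> = 1 - prob K0" by (rule prob_compl[OF K0s])
      finally show ?thesis using K0(2) by linarith
    qed
    ultimately have "shannon \<mu> ?X \<le> ln (real ?N * 2 ^ n) + \<kappa> * ln (k ^ n) + 2"
      using \<open>K0 \<noteq> {}\<close> c by (intro shannon_le_split[OF sX, of "?X ` K0"]) auto
    also have "\<dots> = ln (real ?N) + real n * ln 2 + real n * (\<kappa> * ln k) + 2"
    proof -
      obtain B where "B \<subseteq> bowen_balls d T (n * m) \<delta>" "finite B" "K0 \<subseteq> \<Union>B"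
        by (rule bowen_ball_cover[OF d T nm K0(1) \<delta>(1)])
      then have "?N \<ge> 1" using \<open>K0 \<noteq> {}\<close> by (rule N_on_pos)
      then show ?thesis using k1 by (simp add: ln_mult ln_realpow algebra_simps)
    qed
    also have "ln (real ?N) \<le> real n * (real m * (b + \<epsilon>))"
    proof -
      have "ln (real ?N) < (b + \<epsilon>) * real (n * m)"
        using lim nm by (subst (asm) pos_divide_less_eq) auto
      then show ?thesis by (simp add: algebra_simps)
    qed
    finally have hX: "shannon \<mu> ?X \<le> real n * (real m * (b + \<epsilon>)) + real n * ln 2 + real n * (\<kappa> * ln k) + 2" by simp
    \<comment> \<open>\<open>g\<close> is determined by \<open>?h\<close> and \<open>?r\<close>, and \<open>?r\<close> carries little entropy;
      plain subadditivity then replaces conditional entropy.\<close>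
    have eq: "itinerary g (T ^^ m) n = (\<lambda>x. (\<lambda>(u, v). map2 (\<lambda>a b. case a of None \<Rightarrow> the b | Some l \<Rightarrow> l) u v) (?X x, ?Y x))"
      by (auto simp: itinerary_def fun_eq_iff zip_map_map o_def zip_same_conv_map)
    have "shannon \<mu> (itinerary g (T ^^ m) n) \<le> shannon \<mu> (\<lambda>x. (?X x, ?Y x))"
      unfolding eq by (rule shannon_comp_le[OF simple_function_Pair[OF sX sY]])
    also have "\<dots> \<le> shannon \<mu> ?X + shannon \<mu> ?Y" by (rule shannon_pair_le[OF sX sY])
    also have "shannon \<mu> ?Y \<le> real n * 2"
      using S.shannon_itinerary_le[OF sr, of n] mult_left_mono[OF Hr, of "real n"] by linarith
    finally have "shannon \<mu> (itinerary g (T ^^ m) n) \<le> real n * (2 + real m * (b + \<epsilon>) + ln 2 + \<kappa> * ln k) + 2"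
      using hX by (simp add: algebra_simps)
    then have "shannon \<mu> (itinerary g (T ^^ m) n) / real n \<le> 2 + real m * (b + \<epsilon>) + ln 2 + \<kappa> * ln k + 2 * (1 / real n)"
      using n by (simp add: field_simps)
    then show ?thesis using S.rate_le[OF g, of n] n by linarith
  qed
  have "S.rate g \<le> (2 + real m * b + ln 2) + e" if e: "e > 0" for e
  proof -
    \<comment> \<open>The three errors \<open>m * \<epsilon>\<close>, \<open>\<kappa> * ln k\<close>
      and \<open>2 / n\<close> are each made at most \<open>e / 3\<close>; \<open>ln k + 1\<close>
      avoids division by zero when \<open>k = 1\<close>.\<close>
    define \<epsilon> where "\<epsilon> = e / (3 * real m)"
    define \<kappa> where "\<kappa> = min (1/2) (e / (3 * (ln k + 1)))"
    have lk: "ln k \<ge> 0" using k1 by simp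
    have \<epsilon>: "\<epsilon> > 0" "real m * \<epsilon> = e / 3" using e m by (auto simp: \<epsilon>_def)
    have \<kappa>: "0 < \<kappa>" "\<kappa> < 1" using e lk by (auto simp: \<kappa>_def)
    have \<kappa>e: "\<kappa> * ln k \<le> e / 3"
    proof -
      have "\<kappa> * ln k \<le> e / (3 * (ln k + 1)) * (ln k + 1)"
        using lk e by (intro mult_mono) (auto simp: \<kappa>_def)
      also have "\<dots> = e / 3"
      proof -
        have "e / (3 * L) * L = e / 3" if "L > 0" for L using that by simp
        from this[of "ln k + 1"] show ?thesis using lk by linarith
      qed
      finally show ?thesis .
    qed
    obtain K0 where K0: "compact K0" "1 < prob K0 + \<kappa>"
      using radon_prob_inner[OF \<mu>(1) _ \<kappa>(1), of UNIV] prob_space by (metis sets.top space_UNIV sets)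
    let ?a = "\<lambda>n. ln (real (N_on K0 (bowen_balls d T n \<delta>))) / real n"
    have "limsup (\<lambda>n. ereal (?a n)) \<le> bowen_entropy d T"
      unfolding bowen_entropy_def using K0(1) \<delta>(1) by (intro SUP_upper2[of "(\<delta>, K0)"]) auto
    also have "\<dots> < ereal (b + \<epsilon>)" by (rule le_less_trans[OF b]) (simp add: \<epsilon>(1))
    finally have "\<forall>\<^sub>F n in sequentially. ereal (?a n) < ereal (b + \<epsilon>)" by (rule Limsup_lessD)
    then obtain n0 where n0: "\<And>n. n \<ge> n0 \<Longrightarrow> ?a n < b + \<epsilon>" by (auto simp: eventually_sequentially)
    obtain n1 :: nat where n1: "real n1 > 6 / e" using reals_Archimedean2 by blast
    define n where "n = n0 + n1 + 1"
    have "n \<ge> n0" by (simp add: n_def)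
    then have "n * m \<ge> n0" using m by (metis le_trans mult_le_mono mult.right_neutral)
    then have "S.rate g \<le> 2 + real m * (b + \<epsilon>) + ln 2 + \<kappa> * ln k + 2 * (1 / real n)"
      by (intro bound[OF \<kappa> _ K0] n0) (simp_all add: n_def)
    moreover have "2 * (1 / real n) \<le> e / 3"
    proof -
      have "6 / e < real n" using n1 by (simp add: n_def)
      then have "6 < real n * e" using e by (simp add: field_simps)
      then show ?thesis using e by (simp add: n_def field_simps)
    qed
    ultimately show ?thesis using \<kappa>e \<epsilon>(2) by (simp add: algebra_simps)
  qed
  then have "S.rate g \<le> 2 + real m * b + ln 2" by (rule field_le_epsilon)
  also have "\<dots> \<le> real m * b + 3" using ln_le_minus_one[of "2::real"] by simp
  finally show ?thesis .
qed

text \<open>Applying the previous bound to the words of length \<open>m\<close> under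
  \<open>T ^^ m\<close> gives \<open>m * rate f <= m * b + 3\<close>; division by a large
  \<open>m\<close> removes the constant.\<close>

lemma ks_entropy_le_bowen:
  fixes d :: "'a::topological_space \<Rightarrow> 'a \<Rightarrow> real"
  assumes d: "compatible_metric d" and T: "continuous_on UNIV T"
    and \<mu>: "radon_prob \<mu>" "invariant_measure T \<mu>"
  shows "ks_entropy \<mu> T \<le> bowen_entropy d T"
proof (cases "bowen_entropy d T = \<infinity>")
  case False
  then obtain b where b: "bowen_entropy d T = ereal b"
    using bowen_entropy_nonneg[of d T] by (cases "bowen_entropy d T") auto
  interpret measure_preserving \<mu> T by (rule measure_preserving_of_invariant[OF T \<mu>])
  have sets: "sets \<mu> = sets borel" using \<mu> by (simp add: radon_prob_def)
  have le: "rate f \<le> b" if f: "simple_function \<mu> f" for f :: "'a \<Rightarrow> 'a set"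
  proof (rule field_le_epsilon)
    fix e :: real assume e: "e > 0"
    obtain m0 :: nat where m0: "real m0 > 3 / e" using reals_Archimedean2 by blast
    define m where "m = Suc m0"
    have m: "m \<ge> 1" "3 / e < real m" using m0 by (auto simp: m_def)
    have "real m * rate f \<le> real m * b + 3"
      using rate_funpow_le[OF d T \<mu> _ m(1) simple_function_itinerary[OF f, of m], of b] b rate_funpow[OF f m(1)] by simp
    also have "3 < real m * e" using m(2) e by (simp add: field_simps)
    finally have "real m * rate f < real m * (b + e)" by (simp add: algebra_simps)
    then show "rate f \<le> b + e" using m(1) by simp
  qed
  show ?thesis
    unfolding ks_entropy_def b
  proof (rule SUP_least)
    fix C :: "'a set set" assume "C \<in> {C. finite_meas_partition C}"
    then have C: "finite_meas_partition C" by simp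
    note sf = simple_function_cell[OF sets C]
    show "ereal (ks_partition_entropy \<mu> T C) \<le> ereal b"
      using le[OF sf] ks_partition_entropy_eq_rate[OF measure_preserving_axioms C sf] by simp
  qed
qed simp

lemma ks_entropy_nonneg:
  fixes T :: "'a::topological_space \<Rightarrow> 'a"
  assumes "continuous_on UNIV T" "radon_prob \<mu>" "invariant_measure T \<mu>"
  shows "0 \<le> ks_entropy \<mu> T"
proof -
  interpret measure_preserving \<mu> T by (rule measure_preserving_of_invariant[OF assms])
  have sets: "sets \<mu> = sets borel" using assms by (simp add: radon_prob_def)
  have sf: "simple_function \<mu> (\<lambda>x. ())" by simp
  have "0 \<le> ereal (rate (\<lambda>x. ()))" using rate_nonneg[OF sf] by simp
  also have "\<dots> \<le> ks_entropy \<mu> T" by (rule rate_le_ks_entropy[OF sets sf measure_preserving_axioms])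
  finally show ?thesis .
qed

theorem theorem3p1:
  fixes T :: "'a::topological_space \<Rightarrow> 'a"
  assumes "metrizable_space (euclidean :: 'a topology)"
    and "locally_compact_space (euclidean :: 'a topology)"
    and "separable_space (euclidean :: 'a topology)"
    and "continuous_on UNIV T"
  shows "(let Ms = {\<mu>. radon_prob \<mu> \<and> invariant_measure T \<mu>}
          in (if Ms = {} then 0 else (SUP \<mu>\<in>Ms. ks_entropy \<mu> T))) = top_entropy T
    \<and> (\<forall>d. compatible_metric d \<longrightarrow> top_entropy T \<le> bowen_entropy d T)
    \<and> (\<exists>d. compatible_metric d \<and> bowen_entropy d T = top_entropy T)
    \<and> (\<forall>d. compatible_metric d \<and> extends_to_compactification d
            \<longrightarrow> bowen_entropy d T = top_entropy T)"
proof -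
  note T = assms(4)
  define Ms where "Ms = {\<mu>. radon_prob \<mu> \<and> invariant_measure T \<mu>}"
  define s where "s = (if Ms = {} then 0 else (SUP \<mu>\<in>Ms. ks_entropy \<mu> T))"
  obtain D :: "'a option \<Rightarrow> 'a option \<Rightarrow> real"
    where D: "Metric_space UNIV D" "\<And>V. openin (Metric_space.mtopology UNIV D) V \<longleftrightarrow> alexandroff_open V"
    by (rule ex_compactification_metric[OF assms(1-3)]) blast
  interpret compactification_metric D by (rule compactification_metric.intro[OF D])
  \<comment> \<open>Covers of entropy 0 yield no measure and are compared with \<open>s\<close>
    through this inequality, including when \<open>Ms\<close> is empty.\<close>
  have s0: "0 \<le> s"
  proof (cases "Ms = {}")
    case False
    then obtain \<mu> where \<mu>: "\<mu> \<in> Ms" by blast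
    then have "0 \<le> ks_entropy \<mu> T" using ks_entropy_nonneg[OF T] by (simp add: Ms_def)
    then show ?thesis unfolding s_def using \<mu> by (auto intro: SUP_upper2)
  qed (simp add: s_def)
  have top_le: "top_entropy T \<le> s"
    unfolding top_entropy_def
  proof (rule SUP_least)
    fix A :: "'a set set" assume "A \<in> {A. admissible_open_cover A}"
    then consider "cover_entropy T A = 0"
      | \<nu> where "\<nu> \<in> Ms" "ereal (cover_entropy T A) \<le> ks_entropy \<nu> T"
      using cover_entropy_le_ks[OF T, of A] by (auto simp: Ms_def)
    then show "ereal (cover_entropy T A) \<le> s"
    proof cases
      case 2
      then show ?thesis unfolding s_def by (auto intro: SUP_upper2)
    qed (use s0 in \<open>simp add: zero_ereal_def[symmetric]\<close>)
  qed
  have s_le: "s \<le> bowen_entropy d' T" if "compatible_metric d'" for d'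
    using ks_entropy_le_bowen[OF that T] bowen_entropy_nonneg[of d' T]
    by (auto simp: s_def Ms_def intro!: SUP_least)
  have "bowen_entropy d T \<le> top_entropy T" by (rule bowen_entropy_d_le)
  then have s_eq: "s = top_entropy T" and attained: "bowen_entropy d T = top_entropy T"
    using top_le s_le[OF compatible_d] by auto
  have ext: "bowen_entropy d' T = top_entropy T" if d': "compatible_metric d'" "extends_to_compactification d'" for d'
  proof -
    obtain D' where D': "Metric_space UNIV D'" "\<And>V. openin (Metric_space.mtopology UNIV D') V \<longleftrightarrow> alexandroff_open V"
      "\<And>x y. d' x y = D' (Some x) (Some y)"
      using d'(2) unfolding extends_to_compactification_def by blast
    interpret D': compactification_metric D' by (rule compactification_metric.intro[OF D'(1,2)])
    have "d' = D'.d" using D'(3) by (simp add: fun_eq_iff)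
    then have "bowen_entropy d' T \<le> top_entropy T" using D'.bowen_entropy_d_le by simp
    then show ?thesis using s_le[OF d'(1)] s_eq by simp
  qed
  show ?thesis
    unfolding Let_def Ms_def[symmetric] s_def[symmetric]
  proof (intro conjI allI impI exI[of _ d])
    show "s = top_entropy T" by (rule s_eq)
    show "compatible_metric d" by (rule compatible_d)
    show "bowen_entropy d T = top_entropy T" by (rule attained)
    show "top_entropy T \<le> bowen_entropy d' T" if "compatible_metric d'" for d'
      using s_le[OF that] unfolding s_eq .
    show "bowen_entropy d' T = top_entropy T" if "compatible_metric d' \<and> extends_to_compactification d'" for d'
      using ext that by blast
  qed
qed

end
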